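(* Assume Assumptions A.1–A.6 and suppose $E(|e_1|^r)<\infty$ for some $r>0$. Consider the conditions: (i) there exists $\lambda:\Theta\to(0,\infty)$, bounded and bounded away from $0$, such that $$\sup_{\theta\in\Theta}E\Big(\frac{\lambda(\theta_1^* )}{\lambda(\theta)}(w(\theta,e_1))^r\,\Big|\,\theta_0^*=\theta\Big)<1;$$ (ii) $\displaystyle\limsup_{n\to\infty}\sup_{\theta\in\Theta}\Big(E\Big(\prod_{t=1}^n(w(\theta^*_{t-1},e_t))^r\,\Big|\,\theta_0^*=\theta\Big)\Big)^{1/n}<1.$ Then (i) and (ii) are equivalent, and each of them implies that $\{X_t\}$ is $V$-uniformly ergodic for some $V$ satisfying $K\|x\|^r\le V(x)\le L+M\|x\|^r$ for all $x$ (with some $K>0$ and $L,M<\infty$), and that the stationary distribution of $\{X_t\}$ has finite $r$th moment.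
   Context: Model: $\xi_t=a(X_{t-1})+b(X_{t-1})e_t$ with $X_t=(\xi_t,\dots,\xi_{t-p+1})\in\mathbb{R}^p$, $a,b$ measurable, $\{e_t\}$ i.i.d. independent of $X_0$. $\|\cdot\|$ Euclidean, $\Theta=\{\theta:\|\theta\|=1\}$, $\mathbb{R}^p_0=\mathbb{R}^p\setminus\{0\}$. A.1: $e_t$ has Lebesgue density $f$ locally bounded away from $0$; $b$ positive, locally bounded, locally bounded away from $0$. A.2: $\sup_u(1+|u|)f(u)<\infty$, $E|e_1|^{r_0}<\infty$ for some $r_0>0$. A.3: $a(x)/(1+\|x\|)$, $b(x)/(1+\|x\|)$ bounded. A.4: bounded $a_*,b_*$ on $\Theta$ with $\sup_{\theta}|a(w\theta)/w-a_*(\theta)|\to0$, $\sup_\theta|b(w\theta)/w-b_*(\theta)|\to0$ as $w\to\infty$; $a^*(x)=a_*(x/\|x\|)\|x\|$, $b^*(x)=b_*(x/\|x\|)\|x\|$, $a^*(0)=b^*(0)=0$. A.5: if $p>1$, $\max(|a^*|,b^* )$ locally bounded away from $0$ on $\mathbb{R}^p_0$ and $b^*$ locally bounded away from $0$ on $\mathbb{R}^p\setminus H_0$, $H_0=\{x:\min_i|x_i|=0\}$. A.6: if $p>1$, there are hyperplanes $H_1,\dots,H_m$ through the origin with $a^*,b^*$ continuous off $\bigcup_jH_j$. $z(x,u)=a^*(x)+b^*(x)u$, $w(x,u)=\|(z(x,u),x_1,\dots,x_{p-1})\|$; collapsed chain on $\Theta$: $\theta_t^*=(z(\theta^*_{t-1},e_t),\theta^*_{t-1,1},\dots,\theta^*_{t-1,p-1})/w(\theta^*_{t-1},e_t)$.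 $V$-uniform ergodicity: stationary $\Gamma$ and $M<\infty,\beta<1$ with $\sup_{|g|\le V}|E(g(X_n)\mid X_0=x)-\int g\,d\Gamma|\le M\beta^nV(x)$. *)

theory Defs
  imports "HOL-Probability.Probability"
begin

definition loc_bounded_on :: "'a::metric_space set \<Rightarrow> ('a \<Rightarrow> real) \<Rightarrow> bool" where
  "loc_bounded_on A h \<longleftrightarrow>
     (\<forall>x\<in>A. \<exists>\<delta>>0. \<exists>C. \<forall>y\<in>A. dist y x < \<delta> \<longrightarrow> \<bar>h y\<bar> \<le> C)"

definition loc_bounded_away_from_0_on :: "'a::metric_space set \<Rightarrow> ('a \<Rightarrow> real) \<Rightarrow> bool" where
  "loc_bounded_away_from_0_on A h \<longleftrightarrow>
     (\<forall>x\<in>A. \<exists>\<delta>>0. \<exists>c>0. \<forall>y\<in>A. dist y x < \<delta> \<longrightarrow> c \<le> h y)"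

section \<open>The state space R^p, p = CARD('n), coordinates ordered by the wellorder on 'n\<close>

text \<open>shift z x = (z, x_1, ..., x_{p-1}).\<close>
definition shift :: "real \<Rightarrow> (real, 'n::{finite,wellorder}) vec \<Rightarrow> (real, 'n) vec" where
  "shift z x = (\<chi> i. if i = (LEAST j::'n. True) then z else x $ (Max {j::'n. j < i}))"

definition ar_step :: "((real, 'n::{finite,wellorder}) vec \<Rightarrow> real) \<Rightarrow> ((real, 'n) vec \<Rightarrow> real)
    \<Rightarrow> (real, 'n) vec \<Rightarrow> real \<Rightarrow> (real, 'n) vec" where
  "ar_step a b x u = shift (a x + b x * u) x"

text \<open>Path of a chain driven by the noise sequence omega = (e_1, e_2, ...): chain F x omega n = X_n given X_0 = x.\<close>
primrec chain :: "('a \<Rightarrow> real \<Rightarrow> 'a) \<Rightarrow> 'a \<Rightarrow> real stream \<Rightarrow> nat \<Rightarrow> 'a" where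
  "chain F x \<omega> 0 = x"
| "chain F x \<omega> (Suc n) = F (chain F x \<omega> n) (\<omega> !! n)"

definition star_ext :: "((real, 'n::finite) vec \<Rightarrow> real) \<Rightarrow> (real, 'n) vec \<Rightarrow> real" where
  "star_ext h x = (if x = 0 then 0 else h (x /\<^sub>R norm x) * norm x)"

definition zfun :: "((real, 'n::finite) vec \<Rightarrow> real) \<Rightarrow> ((real, 'n) vec \<Rightarrow> real) \<Rightarrow> (real, 'n) vec \<Rightarrow> real \<Rightarrow> real" where
  "zfun as bs x u = star_ext as x + star_ext bs x * u"

definition wfun :: "((real, 'n::{finite,wellorder}) vec \<Rightarrow> real) \<Rightarrow> ((real, 'n) vec \<Rightarrow> real) \<Rightarrow> (real, 'n) vec \<Rightarrow> real \<Rightarrow> real" where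
  "wfun as bs x u = norm (shift (zfun as bs x u) x)"

definition collapsed_step :: "((real, 'n::{finite,wellorder}) vec \<Rightarrow> real) \<Rightarrow> ((real, 'n) vec \<Rightarrow> real)
    \<Rightarrow> (real, 'n) vec \<Rightarrow> real \<Rightarrow> (real, 'n) vec" where
  "collapsed_step as bs x u = shift (zfun as bs x u) x /\<^sub>R wfun as bs x u"

definition stationary_distr :: "('a::topological_space \<Rightarrow> real \<Rightarrow> 'a) \<Rightarrow> real measure \<Rightarrow> 'a measure \<Rightarrow> bool" where
  "stationary_distr F \<mu> \<Gamma> \<longleftrightarrow>
     prob_space \<Gamma> \<and> sets \<Gamma> = sets borel \<and> distr (\<Gamma> \<Otimes>\<^sub>M \<mu>) borel (case_prod F) = \<Gamma>"

text \<open>E(g(X_n) | X_0 = x) is the integral of g (chain F x omega n) over the iid noise law stream_space mu.\<close>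
definition V_uniformly_ergodic_with ::
    "('a::topological_space \<Rightarrow> real \<Rightarrow> 'a) \<Rightarrow> real measure \<Rightarrow> ('a \<Rightarrow> real) \<Rightarrow> 'a measure \<Rightarrow> bool" where
  "V_uniformly_ergodic_with F \<mu> V \<Gamma> \<longleftrightarrow>
     stationary_distr F \<mu> \<Gamma> \<and>
     (\<exists>M::real. \<exists>\<beta>::real. \<beta> < 1 \<and>
        (\<forall>g \<in> borel_measurable borel. (\<forall>x. \<bar>g x\<bar> \<le> V x) \<longrightarrow>
           (\<forall>x n. integrable (stream_space \<mu>) (\<lambda>\<omega>. g (chain F x \<omega> n)) \<and> integrable \<Gamma> g \<and>
              \<bar>(\<integral>\<omega>. g (chain F x \<omega> n) \<partial>stream_space \<mu>) - (\<integral>y. g y \<partial>\<Gamma>)\<bar> \<le> M * \<beta> ^ n * V x)))"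

definition enn_root :: "nat \<Rightarrow> ennreal \<Rightarrow> ennreal" where
  "enn_root n x = (if x = \<top> then \<top> else ennreal (root n (enn2real x)))"

end

theory Submission
  imports Defs
begin

text \<open>
  Write \<open>Q\<close> for the one-step operator of the homogeneous limit chain and let \<open>\<Pi>\<^sub>n(\<theta>)\<close> be the expected
  product in (ii). If (i) holds, iterating \<open>Q \<lambda> \<le> \<rho> \<lambda>\<close> gives \<open>\<Pi>\<^sub>n = O(\<rho>\<^sup>n)\<close>; conversely
  \<open>\<lambda> = \<Sum>k<N. \<rho>\<^sup>-\<^sup>k \<Pi>\<^sub>k\<close> works as soon as \<open>\<Pi>\<^sub>N \<le> \<rho>\<^sup>N\<close>.

  For ergodicity, extend \<open>\<lambda>\<close> to a homogeneous function \<open>\<Lambda>\<close> of degree \<open>r\<close>. Far from the origin the rescaled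
  one-step law of the chain is an affine image of the noise whose coefficients are uniformly close to those of
  the limit, and where \<open>b\<^sub>*\<close> is bounded away from 0 this makes the laws close in weighted total variation
  (continuity of translations and dilations in \<open>L\<^sup>1\<close>). Hence \<open>\<Lambda>\<close> contracts there, without any regularity of
  \<open>\<lambda>\<close>, \<open>a\<^sub>*\<close> or \<open>b\<^sub>*\<close>. By A.5 the exceptional states have a coordinate that is small relative to the norm.
  Such states are disposed of by multiplying \<open>\<Lambda>\<close> with a penalty for small coordinates: the penalty drops
  geometrically as the coordinate ages, and by A.2 a new small coordinate is unlikely, uniformly in the
  state. The product satisfies a one-step drift condition, bounded sets satisfy a \<open>p\<close>-step minorization,
  and the Hairer--Mattingly form of Harris' theorem applies.
\<close>

section \<open>Geometric ergodicity from drift and minorization\<close>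

text \<open>The obstacle: \<open>bs\<close> may vanish on coordinate hyperplanes while
  \<open>lam\<close> is merely measurable. Where \<open>bs\<close> is 0 the limit law of the new
  coordinate is a point mass, whereas the process has a density, so the two laws are never close in
  total variation, and only the crude bound \<open>E1 Lam x \<le> C2 * Lam x\<close> with a possibly
  large \<open>C2\<close> is left. The penalty is built to beat this constant: its unit
  \<open>H\<close> is a multiple of \<open>C2\<close>, a state with a small coordinate pays at least
  \<open>H\<close>, and one typical step divides the excess of the penalty over 1 by
  \<open>H\<close>. Atypical noise may push the penalty up to its maximum \<open>k\<close>. As
  \<open>k\<close> is fixed by \<open>H\<close> and the dimension, the admissible weight
  \<open>\<epsilon>\<close> of that event can be chosen after it, then the truncation
  \<open>T\<close>, the growth factor \<open>\<tau>\<close> and the threshold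
  \<open>\<delta>\<close>, and only last the compact set of good directions, its lower bound
  \<open>\<eta>\<close> for \<open>bs\<close> and the radius \<open>W\<close>. Harris' theorem is
  proved for a random iterated map on a general topological space. The invariant law comes from
  limits of expectations, so neither a metric on measures nor a residual kernel has to be
  constructed.\<close>

lemma chain_Stream: "chain F x (u ## \<omega>) (Suc n) = chain F (F x u) \<omega> n"
  by (induction n) auto

text \<open>Splitting off the first noise variable at the level of measures makes Fubini available
  for Bochner integrals over the noise sequence.\<close>

lemma (in prob_space) stream_space_eq_distr_Stream:
  "stream_space M = distr (M \<Otimes>\<^sub>M stream_space M) (stream_space M) (\<lambda>(u, \<omega>). u ## \<omega>)"
    (is "?S = distr ?P ?S ?f")
proof (rule measure_eqI)
  interpret S: prob_space "stream_space M" by (rule prob_space_stream_space)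
  fix X assume X[measurable]: "X \<in> sets ?S"
  have "emeasure ?S X = (\<integral>\<^sup>+\<omega>. indicator X \<omega> \<partial>?S)" by simp
  also have "\<dots> = (\<integral>\<^sup>+u. \<integral>\<^sup>+\<omega>. indicator X (u ## \<omega>) \<partial>?S \<partial>M)"
    by (rule nn_integral_stream_space) measurable
  also have "\<dots> = (\<integral>\<^sup>+z. indicator X (?f z) \<partial>?P)"
    by (subst S.nn_integral_fst[symmetric]) (auto simp: split_beta')
  also have "\<dots> = (\<integral>\<^sup>+\<omega>. indicator X \<omega> \<partial>distr ?P ?S ?f)"
    by (subst nn_integral_distr) auto
  finally show "emeasure ?S X = emeasure (distr ?P ?S ?f) X" by simp
qed simp

locale noise_chain = prob_space \<mu> for \<mu> :: "real measure" +
  fixes F :: "'a::topological_space \<Rightarrow> real \<Rightarrow> 'a"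
  assumes sets_mu[measurable_cong]: "sets \<mu> = sets borel"
    and F_measurable[measurable]: "case_prod F \<in> borel \<Otimes>\<^sub>M borel \<rightarrow>\<^sub>M borel"
begin

abbreviation "S \<equiv> stream_space \<mu>"

text \<open>The \<open>n\<close>-step transition operator. As a Bochner integral it defaults to 0 on
  non-integrable functions, hence the growth conditions relative to \<open>V\<close> below.\<close>

definition En :: "nat \<Rightarrow> ('a \<Rightarrow> real) \<Rightarrow> 'a \<Rightarrow> real" where
  "En n g x = (\<integral>\<omega>. g (chain F x \<omega> n) \<partial>S)"

lemma F_measurable2[measurable (raw)]:
  assumes "f \<in> N \<rightarrow>\<^sub>M borel" "g \<in> N \<rightarrow>\<^sub>M borel"
  shows "(\<lambda>z. F (f z) (g z)) \<in> N \<rightarrow>\<^sub>M borel"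
  using measurable_compose[OF measurable_Pair[OF assms] F_measurable] by simp

lemma snth_borel[measurable]: "(\<lambda>\<omega>. \<omega> !! n) \<in> S \<rightarrow>\<^sub>M borel"
  using measurable_snth[of n \<mu>] measurable_cong_sets[OF refl sets_mu] by blast

lemma chain_measurable_pair[measurable]: "(\<lambda>(x, \<omega>). chain F x \<omega> n) \<in> borel \<Otimes>\<^sub>M S \<rightarrow>\<^sub>M borel"
  by (induction n) (auto simp: split_beta')

lemma chain_measurable[measurable (raw)]:
  assumes "f \<in> N \<rightarrow>\<^sub>M borel" "g \<in> N \<rightarrow>\<^sub>M S"
  shows "(\<lambda>z. chain F (f z) (g z) n) \<in> N \<rightarrow>\<^sub>M borel"
  using measurable_compose[OF measurable_Pair[OF assms] chain_measurable_pair] by simp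

sublocale S: prob_space S by (rule prob_space_stream_space)

lemma nn_chain_Suc:
  assumes [measurable]: "h \<in> borel_measurable borel"
  shows "(\<integral>\<^sup>+\<omega>. h (chain F x \<omega> (Suc n)) \<partial>S) = (\<integral>\<^sup>+u. \<integral>\<^sup>+\<omega>. h (chain F (F x u) \<omega> n) \<partial>S \<partial>\<mu>)"
  by (subst nn_integral_stream_space) (simp_all only: chain_Stream, measurable)

lemma En_measurable[measurable]:
  assumes [measurable]: "g \<in> borel_measurable borel"
  shows "En n g \<in> borel_measurable borel"
  unfolding En_def by measurable

lemma En_Suc:
  assumes [measurable]: "g \<in> borel_measurable borel"
    and int: "integrable S (\<lambda>\<omega>. g (chain F x \<omega> (Suc n)))"
  shows "En (Suc n) g x = (\<integral>u. En n g (F x u) \<partial>\<mu>)"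
proof -
  interpret PP: pair_sigma_finite \<mu> S ..
  have m: "(\<lambda>(u,\<omega>). u ## \<omega>) \<in> \<mu> \<Otimes>\<^sub>M S \<rightarrow>\<^sub>M S" by measurable
  have i: "integrable (\<mu> \<Otimes>\<^sub>M S) (\<lambda>z. g (chain F x (case z of (u, \<omega>) \<Rightarrow> u ## \<omega>) (Suc n)))"
    using int by (subst (asm) stream_space_eq_distr_Stream) (subst (asm) integrable_distr_eq[OF m], simp_all)
  have "En (Suc n) g x = (\<integral>z. g (chain F x (case z of (u, \<omega>) \<Rightarrow> u ## \<omega>) (Suc n)) \<partial>(\<mu> \<Otimes>\<^sub>M S))"
    unfolding En_def
    by (subst stream_space_eq_distr_Stream) (subst integral_distr[OF m], simp_all)
  also have "\<dots> = (\<integral>u. \<integral>\<omega>. g (chain F x (u ## \<omega>) (Suc n)) \<partial>S \<partial>\<mu>)"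
    using PP.integral_fst'[OF i] by simp
  finally show ?thesis unfolding chain_Stream En_def .
qed

end

text \<open>The additive constant is written \<open>(1 - \<gamma>) * K\<close> so that
  \<open>K\<close> is the fixed point of the affine bound; its \<open>n\<close>-th iterate is then
  \<open>\<gamma> ^ n * v + (1 - \<gamma> ^ n) * K\<close>.\<close>

locale drift_chain = noise_chain \<mu> F for \<mu> :: "real measure" and F :: "'a::topological_space \<Rightarrow> real \<Rightarrow> 'a" +
  fixes V :: "'a \<Rightarrow> real" and \<gamma> K :: real
  assumes V_measurable[measurable]: "V \<in> borel_measurable borel"
    and V_ge_1: "1 \<le> V x"
    and gamma: "0 \<le> \<gamma>" "\<gamma> < 1" and K_nonneg: "0 \<le> K"
    and drift: "(\<integral>\<^sup>+u. ennreal (V (F x u)) \<partial>\<mu>) \<le> ennreal (\<gamma> * V x + (1 - \<gamma>) * K)"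
begin

lemma V_nonneg: "0 \<le> V x" using V_ge_1[of x] by linarith

lemma drift_iterate:
  "(\<integral>\<^sup>+\<omega>. ennreal (V (chain F x \<omega> n)) \<partial>S) \<le> ennreal (\<gamma> ^ n * V x + (1 - \<gamma> ^ n) * K)"
proof (induction n arbitrary: x)
  case 0
  show ?case by (simp add: S.emeasure_space_1)
next
  case (Suc n)
  have g: "0 \<le> \<gamma> ^ n" "\<gamma> ^ n \<le> 1" using gamma by (auto simp: power_le_one)
  have "(\<integral>\<^sup>+\<omega>. ennreal (V (chain F x \<omega> (Suc n))) \<partial>S)
      = (\<integral>\<^sup>+u. \<integral>\<^sup>+\<omega>. ennreal (V (chain F (F x u) \<omega> n)) \<partial>S \<partial>\<mu>)"
    by (rule nn_chain_Suc) measurable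
  also have "\<dots> \<le> (\<integral>\<^sup>+u. ennreal (\<gamma> ^ n * V (F x u) + (1 - \<gamma> ^ n) * K) \<partial>\<mu>)"
    by (intro nn_integral_mono Suc)
  also have "\<dots> = (\<integral>\<^sup>+u. ennreal (\<gamma> ^ n) * ennreal (V (F x u)) + ennreal ((1 - \<gamma> ^ n) * K) \<partial>\<mu>)"
    using g V_nonneg K_nonneg by (intro nn_integral_cong) (simp add: ennreal_plus ennreal_mult)
  also have "\<dots> = ennreal (\<gamma> ^ n) * (\<integral>\<^sup>+u. ennreal (V (F x u)) \<partial>\<mu>) + ennreal ((1 - \<gamma> ^ n) * K)"
    by (subst nn_integral_add) (auto simp: nn_integral_cmult emeasure_space_1)
  also have "\<dots> \<le> ennreal (\<gamma> ^ n) * ennreal (\<gamma> * V x + (1 - \<gamma>) * K) + ennreal ((1 - \<gamma> ^ n) * K)"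
    by (intro add_mono mult_left_mono drift) auto
  also have "\<dots> = ennreal (\<gamma> ^ n * (\<gamma> * V x + (1 - \<gamma>) * K) + (1 - \<gamma> ^ n) * K)"
    using g gamma V_nonneg K_nonneg by (subst ennreal_plus) (auto simp: ennreal_mult)
  also have "\<gamma> ^ n * (\<gamma> * V x + (1 - \<gamma>) * K) + (1 - \<gamma> ^ n) * K = \<gamma> ^ Suc n * V x + (1 - \<gamma> ^ Suc n) * K"
    by (simp add: algebra_simps)
  finally show ?case .
qed

lemma integrable_V_chain: "integrable S (\<lambda>\<omega>. V (chain F x \<omega> n))"
  using V_nonneg le_less_trans[OF drift_iterate[of x n] ennreal_less_top]
  by (intro integrableI_bounded) auto

lemma En_V_le: "En n V x \<le> \<gamma> ^ n * V x + (1 - \<gamma> ^ n) * K"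
proof -
  have "ennreal (En n V x) = (\<integral>\<^sup>+\<omega>. ennreal (V (chain F x \<omega> n)) \<partial>S)"
    unfolding En_def using V_nonneg
    by (subst nn_integral_eq_integral[OF integrable_V_chain]) auto
  also note drift_iterate
  finally show ?thesis
    using V_nonneg[of x] gamma K_nonneg by (subst (asm) ennreal_le_iff) (auto simp: power_le_one)
qed

lemma En_V_le': "En n V x \<le> V x + K"
proof -
  have "\<gamma> ^ n * V x \<le> 1 * V x" "(1 - \<gamma> ^ n) * K \<le> 1 * K"
    using gamma V_nonneg K_nonneg by (intro mult_right_mono; simp add: power_le_one)+
  then show ?thesis using En_V_le[of n x] by simp
qed

lemma integrable_chain:
  assumes [measurable]: "g \<in> borel_measurable borel" and "\<And>x. \<bar>g x\<bar> \<le> B * V x"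
  shows "integrable S (\<lambda>\<omega>. g (chain F x \<omega> n))"
proof (rule Bochner_Integration.integrable_bound)
  show "integrable S (\<lambda>\<omega>. B * V (chain F x \<omega> n))" using integrable_V_chain by auto
  show "AE \<omega> in S. norm (g (chain F x \<omega> n)) \<le> norm (B * V (chain F x \<omega> n))"
    using assms(2) by (intro AE_I2) (simp, meson abs_ge_self order_trans)
qed measurable

lemma En_abs_le:
  assumes [measurable]: "g \<in> borel_measurable borel" and g: "\<And>x. \<bar>g x\<bar> \<le> B * V x"
  shows "\<bar>En n g x\<bar> \<le> B * En n V x"
proof -
  have "\<bar>En n g x\<bar> \<le> (\<integral>\<omega>. \<bar>g (chain F x \<omega> n)\<bar> \<partial>S)"
    unfolding En_def by (rule integral_abs_bound)
  also have "\<dots> \<le> (\<integral>\<omega>. B * V (chain F x \<omega> n) \<partial>S)"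
    using integrable_chain[OF assms] integrable_V_chain g by (intro integral_mono) auto
  finally show ?thesis by (simp add: En_def)
qed

text \<open>Functions dominated by a multiple of \<open>V\<close> stay so under \<open>En n\<close>,
  with a constant independent of \<open>n\<close>. This supplies the integrability that the
  semigroup law needs.\<close>

lemma En_growth:
  assumes "g \<in> borel_measurable borel" and g: "\<And>x. \<bar>g x\<bar> \<le> B * V x"
  shows "\<bar>En n g x\<bar> \<le> (B * (1 + K)) * V x"
proof -
  have B: "0 \<le> B" using g[of x] V_ge_1[of x]
    by (smt (verit) mult_neg_pos)
  have "V x + K \<le> (1 + K) * V x" using K_nonneg V_ge_1[of x] mult_left_mono[of 1 "V x" K]
    by (simp add: algebra_simps)
  with En_V_le'[of n x] have "En n V x \<le> (1 + K) * V x" by linarith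
  then show ?thesis using En_abs_le[OF assms, of n x] mult_left_mono[OF _ B] by (fastforce simp: algebra_simps)
qed

lemma En_add:
  assumes [measurable]: "g \<in> borel_measurable borel" and g: "\<And>x. \<bar>g x\<bar> \<le> B * V x"
  shows "En (n + k) g x = En n (En k g) x"
proof (induction n arbitrary: x)
  case 0
  show ?case by (simp add: En_def[of 0] S.prob_space)
next
  case (Suc n)
  have "En (Suc (n + k)) g x = (\<integral>u. En (n + k) g (F x u) \<partial>\<mu>)"
    by (intro En_Suc integrable_chain[OF assms]) measurable
  also have "\<dots> = (\<integral>u. En n (En k g) (F x u) \<partial>\<mu>)" by (simp add: Suc)
  also have "\<dots> = En (Suc n) (En k g) x"
    by (intro En_Suc[symmetric] integrable_chain[OF _ En_growth[OF assms]]) measurable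
  finally show ?case by simp
qed

end

section \<open>Contraction of a weighted oscillation seminorm (Hairer and Mattingly)\<close>

locale harris_chain = drift_chain \<mu> F V \<gamma> K
  for \<mu> :: "real measure" and F :: "'a::topological_space \<Rightarrow> real \<Rightarrow> 'a" and V \<gamma> K +
  fixes m :: nat
  assumes m_pos: "0 < m"
    and minorization: "\<exists>\<epsilon>>0. \<exists>\<nu>. prob_space \<nu> \<and> sets \<nu> = sets borel \<and>
      (\<forall>x. V x \<le> R \<longrightarrow> (\<forall>h\<in>borel_measurable borel.
         ennreal \<epsilon> * (\<integral>\<^sup>+y. h y \<partial>\<nu>) \<le> (\<integral>\<^sup>+\<omega>. h (chain F x \<omega> m) \<partial>stream_space \<mu>)))"
begin

text \<open>The Lipschitz seminorm for the distance \<open>2 + \<beta> * V x + \<beta> * V y\<close>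
  is a weighted sup norm modulo constants. The constant is the supremum of the lower envelopes
  \<open>\<phi> x - L * (1 + \<beta> * V x)\<close>; the hypothesis places it below all upper
  envelopes.\<close>

lemma lipschitz_centre:
  assumes "\<And>x y. \<bar>\<phi> x - \<phi> y\<bar> \<le> L * (2 + \<beta> * V x + \<beta> * V y)"
  obtains c where "\<And>x. \<bar>\<phi> x - c\<bar> \<le> L * (1 + \<beta> * V x)"
proof
  have le: "\<phi> x - L * (1 + \<beta> * V x) \<le> \<phi> y + L * (1 + \<beta> * V y)" for x y
    using assms[of x y] by (simp add: algebra_simps)
  fix x
  let ?c = "SUP x. \<phi> x - L * (1 + \<beta> * V x)"
  have "?c \<le> \<phi> x + L * (1 + \<beta> * V x)" using le by (intro cSUP_least) auto
  moreover have "\<phi> x - L * (1 + \<beta> * V x) \<le> ?c"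
    by (rule cSUP_upper) (auto intro!: bdd_aboveI2[where M="\<phi> x + L * (1 + \<beta> * V x)"] le)
  ultimately show "\<bar>\<phi> x - ?c\<bar> \<le> L * (1 + \<beta> * V x)" by linarith
qed

context
  fixes \<phi> :: "'a \<Rightarrow> real" and L \<beta> c :: real
  assumes \<phi>_meas[measurable]: "\<phi> \<in> borel_measurable borel" and L: "0 \<le> L" and \<beta>: "0 < \<beta>"
    and c: "\<And>x. \<bar>\<phi> x - c\<bar> \<le> L * (1 + \<beta> * V x)"
begin

lemma weight_growth: "L * (1 + \<beta> * V x) \<le> (L * (1 + \<beta>)) * V x"
  using L \<beta> V_ge_1[of x] mult_left_mono[of 1 "V x" L] by (simp add: algebra_simps)

lemma centred_growth: "\<bar>\<phi> x - c\<bar> \<le> (L * (1 + \<beta>)) * V x"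
  using c weight_growth order_trans by blast

lemma phi_growth: "\<bar>\<phi> x\<bar> \<le> (L * (1 + \<beta>) + \<bar>c\<bar>) * V x"
  using centred_growth[of x] V_ge_1[of x] mult_left_mono[of 1 "V x" "\<bar>c\<bar>"]
  by (simp add: algebra_simps)

lemma integrable_phi: "integrable S (\<lambda>\<omega>. \<phi> (chain F x \<omega> n))"
  by (rule integrable_chain[OF \<phi>_meas phi_growth])

lemma En_centred: "En n (\<lambda>x. \<phi> x - c) x = En n \<phi> x - c"
  using integrable_phi[of x n] by (simp add: En_def S.prob_space)

lemma En_weight: "En n (\<lambda>x. L * (1 + \<beta> * V x)) x = L * (1 + \<beta> * En n V x)"
  using integrable_V_chain[of x n] by (simp add: En_def S.prob_space)

text \<open>Integrating the envelope around the centre \<open>c\<close> brings in the drift alone.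
  This serves pairs of points far out, and also the incomplete block of steps left over by division
  by \<open>m\<close>.\<close>

lemma En_lipschitz_no_minorization:
  "\<bar>En n \<phi> x - En n \<phi> y\<bar> \<le> L * (2 + \<beta> * En n V x + \<beta> * En n V y)"
proof -
  have "\<bar>En n \<phi> z - c\<bar> \<le> L * (1 + \<beta> * En n V z)" for z
  proof -
    have "\<bar>En n \<phi> z - c\<bar> = \<bar>\<integral>\<omega>. \<phi> (chain F z \<omega> n) - c \<partial>S\<bar>"
      using En_centred[of n z] by (simp add: En_def)
    also have "\<dots> \<le> (\<integral>\<omega>. \<bar>\<phi> (chain F z \<omega> n) - c\<bar> \<partial>S)"
      by (rule integral_abs_bound)
    also have "\<dots> \<le> (\<integral>\<omega>. L * (1 + \<beta> * V (chain F z \<omega> n)) \<partial>S)"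
      using integrable_phi integrable_V_chain by (intro integral_mono c) auto
    finally show ?thesis using En_weight[of n z] by (simp only: En_def)
  qed
  from this[of x] this[of y] show ?thesis by (simp add: algebra_simps)
qed

text \<open>The minorization is applied to the two nonnegative functions
  \<open>L * (1 + \<beta> * V x)\<close> plus and minus \<open>\<phi> x - c\<close>. Adding the
  bound of one sign at \<open>x\<close> to that of the other sign at \<open>y\<close> cancels the
  \<open>\<nu>\<close>-mean of \<open>\<phi>\<close> and leaves the \<open>\<nu>\<close>-mean of the
  envelope twice, a gain of at least \<open>2 * \<epsilon> * L\<close>.\<close>

lemma En_lipschitz_minorization:
  assumes \<nu>: "prob_space \<nu>" "sets \<nu> = sets borel" and \<epsilon>: "0 < \<epsilon>"
    and mi: "\<And>z h. z \<in> {x, y} \<Longrightarrow> h \<in> borel_measurable borel \<Longrightarrow>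
         ennreal \<epsilon> * (\<integral>\<^sup>+y. h y \<partial>\<nu>) \<le> (\<integral>\<^sup>+\<omega>. h (chain F z \<omega> m) \<partial>S)"
  shows "\<bar>En m \<phi> x - En m \<phi> y\<bar> \<le> L * (2 - 2 * \<epsilon> + \<beta> * En m V x + \<beta> * En m V y)"
proof -
  interpret N: prob_space \<nu> by fact
  have [measurable_cong]: "sets \<nu> = sets borel" by fact
  let ?W = "\<lambda>x. L * (1 + \<beta> * V x)"
  \<comment> \<open>Testing the minorization with \<open>V\<close> itself shows that
    \<open>\<nu>\<close> integrates \<open>V\<close>.\<close>
  have "ennreal \<epsilon> * (\<integral>\<^sup>+y. ennreal (V y) \<partial>\<nu>) < \<infinity>"
    using mi[of x "\<lambda>x. ennreal (V x)"] le_less_trans[OF drift_iterate[of x m] ennreal_less_top]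
    by (auto simp: le_less_trans)
  then have "(\<integral>\<^sup>+y. ennreal (V y) \<partial>\<nu>) < \<infinity>"
    using \<epsilon> by (auto simp: ennreal_mult_less_top)
  then have iV: "integrable \<nu> V"
    using V_nonneg by (intro integrableI_bounded) auto
  then have iW: "integrable \<nu> ?W" by auto
  have ip: "integrable \<nu> (\<lambda>x. \<phi> x - c)"
  proof (rule Bochner_Integration.integrable_bound[OF iW])
    show "AE x in \<nu>. norm (\<phi> x - c) \<le> norm (?W x)"
      using c by (intro AE_I2) (simp, meson abs_ge_self order_trans)
  qed measurable
  have mi': "\<epsilon> * (\<integral>y. h y \<partial>\<nu>) \<le> En m h z"
    if "z \<in> {x, y}" and [measurable]: "h \<in> borel_measurable borel" and "\<And>x. 0 \<le> h x" "integrable \<nu> h"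
      "integrable S (\<lambda>\<omega>. h (chain F z \<omega> m))" for h z
  proof -
    have "ennreal (\<epsilon> * (\<integral>y. h y \<partial>\<nu>)) = ennreal \<epsilon> * (\<integral>\<^sup>+y. ennreal (h y) \<partial>\<nu>)"
      using that \<epsilon> by (subst nn_integral_eq_integral) (auto simp: ennreal_mult)
    also have "\<dots> \<le> (\<integral>\<^sup>+\<omega>. ennreal (h (chain F z \<omega> m)) \<partial>S)"
      by (rule mi) (use that in auto)
    also have "\<dots> = ennreal (En m h z)"
      unfolding En_def using that by (subst nn_integral_eq_integral) auto
    finally show ?thesis
      by (subst (asm) ennreal_le_iff) (use that in \<open>auto simp: En_def intro!: integral_nonneg_AE\<close>)
  qed
  have W1: "L \<le> (\<integral>x. ?W x \<partial>\<nu>)"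
  proof -
    have "0 \<le> (\<integral>x. V x \<partial>\<nu>)" using V_nonneg by (intro integral_nonneg_AE) auto
    then show ?thesis using iV L \<beta> by (simp add: N.prob_space mult_left_mono algebra_simps)
  qed
  define A where "A = \<epsilon> * (\<integral>x. ?W x \<partial>\<nu>)"
  define B where "B = \<epsilon> * (\<integral>x. \<phi> x - c \<partial>\<nu>)"
  have up: "A - B \<le> L * (1 + \<beta> * En m V z) - (En m \<phi> z - c)" if "z \<in> {x, y}" for z
  proof -
    have "A - B = \<epsilon> * (\<integral>x. ?W x - (\<phi> x - c) \<partial>\<nu>)"
      unfolding A_def B_def by (subst Bochner_Integration.integral_diff[OF iW ip]) (simp add: algebra_simps)
    also have "\<dots> \<le> En m (\<lambda>x. ?W x - (\<phi> x - c)) z"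
      by (rule mi'[OF that])
         (use c iW ip integrable_phi integrable_V_chain in \<open>auto simp: abs_le_iff intro!: Bochner_Integration.integrable_diff\<close>)
    also have "\<dots> = En m ?W z - En m (\<lambda>x. \<phi> x - c) z"
      unfolding En_def using integrable_phi integrable_V_chain
      by (intro Bochner_Integration.integral_diff) auto
    finally show ?thesis by (simp only: En_weight En_centred)
  qed
  have lo: "A + B \<le> L * (1 + \<beta> * En m V z) + (En m \<phi> z - c)" if "z \<in> {x, y}" for z
  proof -
    have "A + B = \<epsilon> * (\<integral>x. ?W x + (\<phi> x - c) \<partial>\<nu>)"
      unfolding A_def B_def by (subst Bochner_Integration.integral_add[OF iW ip]) (simp add: algebra_simps)
    also have "\<dots> \<le> En m (\<lambda>x. ?W x + (\<phi> x - c)) z"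
    proof (rule mi'[OF that])
      show "0 \<le> ?W u + (\<phi> u - c)" for u using c[of u] by linarith
    qed (use iW ip integrable_phi integrable_V_chain in \<open>auto intro!: Bochner_Integration.integrable_add\<close>)
    also have "\<dots> = En m ?W z + En m (\<lambda>x. \<phi> x - c) z"
      unfolding En_def using integrable_phi integrable_V_chain
      by (intro Bochner_Integration.integral_add) auto
    finally show ?thesis by (simp only: En_weight En_centred)
  qed
  have "\<epsilon> * L \<le> A" unfolding A_def using W1 \<epsilon> by simp
  moreover have "L * (2 - 2 * \<epsilon> + \<beta> * En m V x + \<beta> * En m V y)
     = L * (1 + \<beta> * En m V x) + L * (1 + \<beta> * En m V y) - 2 * (\<epsilon> * L)"
    by (simp add: algebra_simps)
  ultimately show ?thesis
    using up[of x] up[of y] lo[of x] lo[of y] by (simp add: abs_le_iff)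
qed

end

text \<open>If \<open>V x + V y\<close> is large, the drift shrinks the \<open>\<beta>\<close>-part
  of the distance, which is then not negligible against the constant 2. Otherwise both points lie in
  a sublevel set and the minorization shrinks the 2, provided \<open>\<beta>\<close> is small enough
  for the additive constant of the drift not to consume the gain.\<close>

lemma contraction:
  obtains \<alpha> \<beta> :: real where "0 < \<alpha>" "\<alpha> < 1" "0 < \<beta>"
    "\<And>\<phi> L x y. \<phi> \<in> borel_measurable borel \<Longrightarrow> 0 \<le> L \<Longrightarrow>
      (\<And>x y. \<bar>\<phi> x - \<phi> y\<bar> \<le> L * (2 + \<beta> * V x + \<beta> * V y)) \<Longrightarrow>
      \<bar>En m \<phi> x - En m \<phi> y\<bar> \<le> (\<alpha> * L) * (2 + \<beta> * V x + \<beta> * V y)"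
proof -
  \<comment> \<open>For \<open>R \<le> s\<close> this gives
    \<open>\<gamma> * s + 2 * K \<le> \<gamma>0 * s\<close>, with \<open>\<gamma>0\<close> halfway
    between \<open>\<gamma>\<close> and 1.\<close>
  define R where "R = 4 * K / (1 - \<gamma>) + 1"
  have R: "0 < R" "4 * K \<le> (1 - \<gamma>) * R"
    using gamma K_nonneg by (auto simp: R_def distrib_left intro!: add_nonneg_pos divide_nonneg_pos)
  obtain \<epsilon>0 \<nu> where \<epsilon>0: "0 < \<epsilon>0" and \<nu>: "prob_space \<nu>" "sets \<nu> = sets borel"
    and mi0: "\<And>x h. V x \<le> R \<Longrightarrow> h \<in> borel_measurable borel \<Longrightarrow>
         ennreal \<epsilon>0 * (\<integral>\<^sup>+y. h y \<partial>\<nu>) \<le> (\<integral>\<^sup>+\<omega>. h (chain F x \<omega> m) \<partial>S)"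
    using minorization[of R] by blast
  define \<epsilon> where "\<epsilon> = min \<epsilon>0 1"
  have \<epsilon>: "0 < \<epsilon>" "\<epsilon> \<le> 1" using \<epsilon>0 by (auto simp: \<epsilon>_def)
  have mi: "ennreal \<epsilon> * (\<integral>\<^sup>+y. h y \<partial>\<nu>) \<le> (\<integral>\<^sup>+\<omega>. h (chain F x \<omega> m) \<partial>S)"
    if "V x \<le> R" "h \<in> borel_measurable borel" for x h
    by (rule order_trans[OF mult_right_mono mi0[OF that]]) (auto simp: \<epsilon>_def intro!: ennreal_leI)
  \<comment> \<open>The minorization gains \<open>2 * \<epsilon>\<close>, the drift constants at the
    two points cost \<open>2 * \<beta> * K \<le> \<epsilon>\<close>; a net gain of
    \<open>\<epsilon>\<close> remains.\<close>
  define \<beta> where "\<beta> = \<epsilon> / (2 * K + 1)"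
  have \<beta>: "0 < \<beta>" "2 * \<beta> * K \<le> \<epsilon>" using \<epsilon> K_nonneg by (auto simp: \<beta>_def field_simps)
  define \<gamma>0 where "\<gamma>0 = (1 + \<gamma>) / 2"
  \<comment> \<open>The ratio \<open>(2 + \<beta> * \<gamma>0 * s) / (2 + \<beta> * s)\<close>
    decreases in \<open>s\<close>, so its value at \<open>s = R\<close> bounds it on the far
    region.\<close>
  define \<alpha>1 where "\<alpha>1 = (2 + \<beta> * \<gamma>0 * R) / (2 + \<beta> * R)"
  define \<alpha> where "\<alpha> = max \<alpha>1 (max (1 - \<epsilon> / 2) \<gamma>)"
  have "\<beta> * \<gamma>0 * R < \<beta> * R" using \<beta> R gamma by (simp add: \<gamma>0_def)
  moreover have "0 < 2 + \<beta> * R" using \<beta> R by (simp add: add_pos_pos)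
  ultimately have "\<alpha>1 < 1" by (simp add: \<alpha>1_def)
  then have \<alpha>: "0 < \<alpha>" "\<alpha> < 1" using \<epsilon> gamma by (auto simp: \<alpha>_def)
  have pw: "\<gamma> ^ m \<le> \<gamma>" using gamma m_pos by (simp add: power_le_one_iff power_decreasing[of 1 m \<gamma>, simplified] Suc_leI)
  have EV: "En m V x \<le> \<gamma> * V x + K" for x
  proof -
    have "\<gamma> ^ m * V x \<le> \<gamma> * V x" "(1 - \<gamma> ^ m) * K \<le> 1 * K"
      using pw V_nonneg gamma K_nonneg by (intro mult_right_mono; simp)+
    then show ?thesis using En_V_le[of m x] by linarith
  qed
  have main: "\<bar>En m \<phi> x - En m \<phi> y\<bar> \<le> (\<alpha> * L) * (2 + \<beta> * V x + \<beta> * V y)"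
    if \<phi>: "\<phi> \<in> borel_measurable borel" and L: "0 \<le> L"
      and lip: "\<And>x y. \<bar>\<phi> x - \<phi> y\<bar> \<le> L * (2 + \<beta> * V x + \<beta> * V y)" for \<phi> L x y
  proof -
    obtain c where c: "\<And>x. \<bar>\<phi> x - c\<bar> \<le> L * (1 + \<beta> * V x)" using lipschitz_centre[OF lip] by blast
    define s where "s = V x + V y"
    have s0: "0 \<le> s" using V_nonneg by (simp add: s_def)
    have EVs: "\<beta> * En m V x + \<beta> * En m V y \<le> \<beta> * (\<gamma> * s + 2 * K)"
      using mult_left_mono[OF add_mono[OF EV[of x] EV[of y]], of \<beta>] \<beta> by (simp add: s_def algebra_simps)
    have goal: "\<bar>En m \<phi> x - En m \<phi> y\<bar> \<le> (\<alpha> * L) * (2 + \<beta> * V x + \<beta> * V y)"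
      if "\<bar>En m \<phi> x - En m \<phi> y\<bar> \<le> L * t" "t \<le> \<alpha> * (2 + \<beta> * s)" for t
      using order_trans[OF that(1) mult_left_mono[OF that(2) L]] by (simp add: s_def algebra_simps)
    show ?thesis
    proof (cases "R \<le> s")
      case True
      have "4 * K \<le> (1 - \<gamma>) * s" using R True gamma by (smt (verit) mult_left_mono)
      then have "\<gamma> * s + 2 * K \<le> \<gamma>0 * s" by (simp add: \<gamma>0_def field_simps)
      then have "2 + \<beta> * (\<gamma> * s + 2 * K) \<le> 2 + \<beta> * (\<gamma>0 * s)" using \<beta> by simp
      also have "\<dots> \<le> \<alpha>1 * (2 + \<beta> * s)"
      proof -
        have "0 \<le> (\<beta> * (1 - \<gamma>0)) * (s - R)" using \<beta> True gamma by (auto simp: \<gamma>0_def intro!: mult_nonneg_nonneg)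
        then have "(2 + \<beta> * (\<gamma>0 * s)) * (2 + \<beta> * R) \<le> (2 + \<beta> * \<gamma>0 * R) * (2 + \<beta> * s)"
          by (simp add: algebra_simps)
        then show ?thesis using \<open>0 < 2 + \<beta> * R\<close> by (simp add: \<alpha>1_def field_simps)
      qed
      also have "\<dots> \<le> \<alpha> * (2 + \<beta> * s)" using \<beta> s0 by (intro mult_right_mono) (auto simp: \<alpha>_def)
      finally show ?thesis
        using En_lipschitz_no_minorization[OF \<phi> L \<beta>(1) c, of m x y] EVs
        by (intro goal[of "2 + \<beta> * En m V x + \<beta> * En m V y"]) auto
    next
      case False
      have le: "V x \<le> R" "V y \<le> R" using False V_nonneg[of x] V_nonneg[of y] by (auto simp: s_def)
      have "\<bar>En m \<phi> x - En m \<phi> y\<bar> \<le> L * (2 - 2 * \<epsilon> + \<beta> * En m V x + \<beta> * En m V y)"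
        by (rule En_lipschitz_minorization[OF \<phi> L \<beta>(1) c \<nu> \<epsilon>(1)]) (use mi le in auto)
      moreover have "2 - 2 * \<epsilon> + \<beta> * En m V x + \<beta> * En m V y \<le> \<alpha> * (2 + \<beta> * s)"
      proof -
        have "2 - 2 * \<epsilon> + \<beta> * En m V x + \<beta> * En m V y \<le> (1 - \<epsilon> / 2) * 2 + \<gamma> * (\<beta> * s)"
          using EVs \<beta> by (simp add: algebra_simps)
        also have "\<dots> \<le> \<alpha> * 2 + \<alpha> * (\<beta> * s)"
          using \<beta> s0 by (intro add_mono mult_right_mono) (auto simp: \<alpha>_def)
        finally show ?thesis by (simp add: algebra_simps)
      qed
      ultimately show ?thesis by (rule goal)
    qed
  qed
  show ?thesis by (rule that[OF \<alpha> \<beta>(1)]) (rule main)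
qed

end

section \<open>Geometric rates and the invariant law\<close>

context harris_chain
begin

text \<open>Blocks of \<open>m\<close> steps contract by \<open>\<alpha>\<close>, and the remaining
  \<open>n mod m\<close> steps are handled by the drift alone; \<open>\<kappa>\<close> is the
  \<open>m\<close>-th root of \<open>\<alpha>\<close>.\<close>

lemma geometric_contraction:
  obtains C \<kappa> :: real where "0 \<le> C" "0 < \<kappa>" "\<kappa> < 1"
    "\<And>g B n x y. g \<in> borel_measurable borel \<Longrightarrow> (\<And>x. \<bar>g x\<bar> \<le> B * V x) \<Longrightarrow>
      \<bar>En n g x - En n g y\<bar> \<le> C * \<kappa> ^ n * B * (V x + V y)"
proof -
  obtain \<alpha> \<beta> :: real where \<alpha>: "0 < \<alpha>" "\<alpha> < 1" and \<beta>: "0 < \<beta>" and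
    con: "\<And>\<phi> L x y. \<phi> \<in> borel_measurable borel \<Longrightarrow> 0 \<le> L \<Longrightarrow>
      (\<And>x y. \<bar>\<phi> x - \<phi> y\<bar> \<le> L * (2 + \<beta> * V x + \<beta> * V y)) \<Longrightarrow>
      \<bar>En m \<phi> x - En m \<phi> y\<bar> \<le> (\<alpha> * L) * (2 + \<beta> * V x + \<beta> * V y)"
    using contraction by blast
  define \<kappa> where "\<kappa> = root m \<alpha>"
  have \<kappa>: "0 < \<kappa>" "\<kappa> < 1" "\<kappa> ^ m = \<alpha>"
    using \<alpha> m_pos by (auto simp: \<kappa>_def)
  \<comment> \<open>The factor \<open>1 / \<alpha>\<close> pays for the incomplete block,
    \<open>1 / \<beta>\<close> converts the growth constant \<open>B\<close> into a Lipschitz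
    constant, and the remaining factors absorb the drift during the last steps.\<close>
  define C where "C = (1 + \<beta> * K) / \<alpha> * (1 + \<beta>) / \<beta>"
  have C: "0 \<le> C" using \<alpha> \<beta> K_nonneg by (simp add: C_def)
  have main: "\<bar>En n g x - En n g y\<bar> \<le> C * \<kappa> ^ n * B * (V x + V y)"
    if [measurable]: "g \<in> borel_measurable borel" and g: "\<And>x. \<bar>g x\<bar> \<le> B * V x" for g B n x y
  proof -
    have B: "0 \<le> B" using g[of x] V_ge_1[of x] by (smt (verit) mult_neg_pos)
    define L where "L = B / \<beta>"
    have L: "0 \<le> L" "L * \<beta> = B" using B \<beta> by (auto simp: L_def)
    have lipq: "\<bar>En (m * q) g x - En (m * q) g y\<bar> \<le> (\<alpha> ^ q * L) * (2 + \<beta> * V x + \<beta> * V y)" for q x y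
    proof (induction q arbitrary: x y)
      case 0
      have "\<bar>g x - g y\<bar> \<le> L * \<beta> * V x + L * \<beta> * V y" using g[of x] g[of y] L by (simp add: abs_le_iff)
      then show ?case using L(1) by (simp add: En_def S.prob_space algebra_simps)
    next
      case (Suc q)
      have "En (m * Suc q) g z = En m (En (m * q) g) z" for z
        using En_add[OF that, of m "m * q" z] by (simp add: algebra_simps)
      moreover have "\<bar>En m (En (m * q) g) x - En m (En (m * q) g) y\<bar>
         \<le> (\<alpha> * (\<alpha> ^ q * L)) * (2 + \<beta> * V x + \<beta> * V y)"
        by (rule con) (use Suc \<alpha> L in auto)
      ultimately show ?case by (simp add: mult.assoc)
    qed
    define q j where "q = n div m" and "j = n mod m"
    have n: "n = j + m * q" "j \<le> m" using m_pos by (auto simp: q_def j_def)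
    let ?L = "\<alpha> ^ q * L"
    have L': "0 \<le> ?L" using \<alpha> L by simp
    obtain c where c: "\<And>x. \<bar>En (m * q) g x - c\<bar> \<le> ?L * (1 + \<beta> * V x)"
      using lipschitz_centre[OF lipq] by blast
    have "En n g z = En j (En (m * q) g) z" for z
      unfolding n by (rule En_add[OF that])
    then have "\<bar>En n g x - En n g y\<bar> \<le> ?L * (2 + \<beta> * En j V x + \<beta> * En j V y)"
      using En_lipschitz_no_minorization[OF En_measurable[OF that(1)] L' \<beta> c, of j x y] by simp
    also have "\<dots> \<le> ?L * (2 + \<beta> * (V x + K) + \<beta> * (V y + K))"
      using En_V_le'[of j] \<beta> L' by (intro mult_left_mono add_mono) auto
    also have "\<dots> \<le> ?L * ((1 + \<beta> * K) * (1 + \<beta>) * (V x + V y))"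
    proof (rule mult_left_mono[OF _ L'])
      let ?s = "V x + V y"
      have s: "2 \<le> ?s" using V_ge_1[of x] V_ge_1[of y] by linarith
      have "2 + \<beta> * (V x + K) + \<beta> * (V y + K) = 2 * (1 + \<beta> * K) + \<beta> * ?s" by (simp add: algebra_simps)
      also have "\<dots> \<le> (1 + \<beta> * K) * ?s + (1 + \<beta> * K) * (\<beta> * ?s)"
      proof (rule add_mono)
        show "2 * (1 + \<beta> * K) \<le> (1 + \<beta> * K) * ?s"
          using mult_left_mono[OF s, of "1 + \<beta> * K"] \<beta> K_nonneg by (simp add: mult.commute)
        show "\<beta> * ?s \<le> (1 + \<beta> * K) * (\<beta> * ?s)"
          using mult_right_mono[of 1 "1 + \<beta> * K" "\<beta> * ?s"] \<beta> K_nonneg s by simp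
      qed
      also have "\<dots> = (1 + \<beta> * K) * (1 + \<beta>) * ?s" by (simp add: algebra_simps)
      finally show "2 + \<beta> * (V x + K) + \<beta> * (V y + K) \<le> (1 + \<beta> * K) * (1 + \<beta>) * ?s" .
    qed
    also have "\<dots> \<le> (\<kappa> ^ n / \<alpha> * L) * ((1 + \<beta> * K) * (1 + \<beta>) * (V x + V y))"
    proof (rule mult_right_mono)
      have "\<alpha> ^ q * \<alpha> = \<kappa> ^ (m * q) * \<kappa> ^ m" using \<kappa> by (simp add: power_mult)
      also have "\<dots> \<le> \<kappa> ^ (m * q) * \<kappa> ^ j"
        using n \<kappa> by (intro mult_left_mono power_decreasing) auto
      also have "\<dots> = \<kappa> ^ n" using n by (simp add: power_add mult.commute)
      finally have "\<alpha> ^ q \<le> \<kappa> ^ n / \<alpha>" using \<alpha> by (simp add: field_simps)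
      then show "?L \<le> \<kappa> ^ n / \<alpha> * L" using L by (intro mult_right_mono) auto
      show "0 \<le> (1 + \<beta> * K) * (1 + \<beta>) * (V x + V y)"
        using \<beta> K_nonneg V_nonneg by (intro mult_nonneg_nonneg add_nonneg_nonneg) auto
    qed
    also have "\<dots> = C * \<kappa> ^ n * B * (V x + V y)"
      by (simp add: C_def L_def)
    finally show ?thesis .
  qed
  show ?thesis by (rule that[OF C \<kappa>(1,2)]) (rule main)
qed

text \<open>\<open>En (k + n) g x\<close> averages \<open>En n g\<close> over the state at time
  \<open>k\<close>, so contraction in the starting point becomes a Cauchy rate in time. The mean of
  \<open>V\<close> at time \<open>k\<close> is at most \<open>V x + K\<close>, uniformly in
  \<open>k\<close>.\<close>

lemma geometric_Cauchy:
  obtains C \<kappa> :: real where "0 \<le> C" "0 < \<kappa>" "\<kappa> < 1"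
    "\<And>g B n x. g \<in> borel_measurable borel \<Longrightarrow> (\<And>x. \<bar>g x\<bar> \<le> B * V x) \<Longrightarrow>
      convergent (\<lambda>n. En n g x)"
    "\<And>g B n x. g \<in> borel_measurable borel \<Longrightarrow> (\<And>x. \<bar>g x\<bar> \<le> B * V x) \<Longrightarrow>
      \<bar>En n g x - lim (\<lambda>n. En n g x)\<bar> \<le> C * \<kappa> ^ n * B * V x"
proof -
  obtain C0 \<kappa> where C0: "0 \<le> C0" and \<kappa>: "0 < \<kappa>" "\<kappa> < 1" and con:
    "\<And>g B n x y. g \<in> borel_measurable borel \<Longrightarrow> (\<And>x. \<bar>g x\<bar> \<le> B * V x) \<Longrightarrow>
      \<bar>En n g x - En n g y\<bar> \<le> C0 * \<kappa> ^ n * B * (V x + V y)"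
    using geometric_contraction by blast
  define C where "C = C0 * (2 + K)"
  have C: "0 \<le> C" using C0 K_nonneg by (simp add: C_def)
  have cauchy: "\<bar>En (k + n) g x - En n g x\<bar> \<le> C * \<kappa> ^ n * B * V x"
    if [measurable]: "g \<in> borel_measurable borel" and g: "\<And>x. \<bar>g x\<bar> \<le> B * V x" for g B n k x
  proof -
    have B: "0 \<le> B" using g[of x] V_ge_1[of x] by (smt (verit) mult_neg_pos)
    let ?D = "C0 * \<kappa> ^ n * B"
    have D: "0 \<le> ?D" using C0 \<kappa> B by simp
    have i: "integrable S (\<lambda>\<omega>. En n g (chain F x \<omega> k))"
      by (rule integrable_chain[OF En_measurable[OF that(1)] En_growth[OF that]])
    have "En (k + n) g x - En n g x = (\<integral>\<omega>. En n g (chain F x \<omega> k) - En n g x \<partial>S)"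
      unfolding En_add[OF that, of k n x] En_def[of k] using i by (simp add: S.prob_space)
    also have "\<bar>\<dots>\<bar> \<le> (\<integral>\<omega>. \<bar>En n g (chain F x \<omega> k) - En n g x\<bar> \<partial>S)"
      by (rule integral_abs_bound)
    also have "\<dots> \<le> (\<integral>\<omega>. ?D * (V (chain F x \<omega> k) + V x) \<partial>S)"
      using i integrable_V_chain con[OF that] by (intro integral_mono) auto
    also have "\<dots> = ?D * (En k V x + V x)"
      using integrable_V_chain by (simp add: En_def S.prob_space)
    also have "\<dots> \<le> ?D * ((2 + K) * V x)"
      using En_V_le'[of k x] K_nonneg V_ge_1[of x] mult_left_mono[of 1 "V x" K]
      by (intro mult_left_mono D) (simp add: algebra_simps)
    finally show ?thesis by (simp add: C_def algebra_simps)
  qed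
  have conv: "convergent (\<lambda>n. En n g x)"
    if "g \<in> borel_measurable borel" "\<And>x. \<bar>g x\<bar> \<le> B * V x" for g B x
  proof (intro Cauchy_convergent CauchyI')
    fix e :: real assume e: "0 < e"
    have "(\<lambda>n. C * \<kappa> ^ n * B * V x) \<longlonglongrightarrow> C * 0 * B * V x"
      using \<kappa> by (intro tendsto_intros LIMSEQ_realpow_zero) auto
    then have "\<forall>\<^sub>F n in sequentially. C * \<kappa> ^ n * B * V x < e"
      using e by (intro order_tendstoD) auto
    then obtain N where N: "\<And>n. N \<le> n \<Longrightarrow> C * \<kappa> ^ n * B * V x < e"
      by (auto simp: eventually_sequentially)
    have "dist (En a g x) (En b g x) < e" if "N \<le> a" "a < b" for a b
      using cauchy[OF \<open>g \<in> _\<close> \<open>\<And>x. \<bar>g x\<bar> \<le> B * V x\<close>, of "b - a" a x] N[of a] that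
      by (simp add: dist_real_def abs_minus_commute)
    then show "\<exists>M. \<forall>m\<ge>M. \<forall>n>m. dist (En m g x) (En n g x) < e" by blast
  qed
  have "\<bar>En n g x - lim (\<lambda>n. En n g x)\<bar> \<le> C * \<kappa> ^ n * B * V x"
    if "g \<in> borel_measurable borel" "\<And>x. \<bar>g x\<bar> \<le> B * V x" for g B x n
  proof -
    have "(\<lambda>k. En (k + n) g x) \<longlonglongrightarrow> lim (\<lambda>n. En n g x)"
      using conv[OF that] LIMSEQ_ignore_initial_segment convergent_LIMSEQ_iff by blast
    then have "(\<lambda>k. \<bar>En (k + n) g x - En n g x\<bar>) \<longlonglongrightarrow> \<bar>lim (\<lambda>n. En n g x) - En n g x\<bar>"
      by (intro tendsto_intros)
    then have "\<bar>lim (\<lambda>n. En n g x) - En n g x\<bar> \<le> C * \<kappa> ^ n * B * V x"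
      by (rule LIMSEQ_le_const2) (use cauchy[OF that] in auto)
    then show ?thesis by (simp add: abs_minus_commute)
  qed
  note limit_rate = this
  show ?thesis
  proof (rule that[OF C \<kappa>])
    fix g :: "'a \<Rightarrow> real" and B n x
    assume g: "g \<in> borel_measurable borel" "\<And>x. \<bar>g x\<bar> \<le> B * V x"
    show "convergent (\<lambda>n. En n g x)" by (rule conv[OF g])
    show "\<bar>En n g x - lim (\<lambda>n. En n g x)\<bar> \<le> C * \<kappa> ^ n * B * V x" by (rule limit_rate[OF g])
  qed
qed

text \<open>Stationary expectations exist as limits along the chain; the bounds are uniform over the
  functions dominated by \<open>V\<close>, which is what makes the limiting set function countably additive.\<close>

lemma stationary_distribution:
  obtains \<Gamma> where "prob_space \<Gamma>" "sets \<Gamma> = sets borel"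
    "\<And>g b. g \<in> borel_measurable borel \<Longrightarrow> (\<And>x. 0 \<le> g x) \<Longrightarrow> (\<And>x. g x \<le> b) \<Longrightarrow>
       (\<lambda>n. En n g x) \<longlonglongrightarrow> (\<integral>y. g y \<partial>\<Gamma>)"
proof -
  obtain C \<kappa> :: real where C: "0 \<le> C" and \<kappa>: "0 < \<kappa>" "\<kappa> < 1" and
    conv: "\<And>g B x. g \<in> borel_measurable borel \<Longrightarrow> (\<And>x. \<bar>g x\<bar> \<le> B * V x) \<Longrightarrow> convergent (\<lambda>n. En n g x)" and
    rate: "\<And>g B n x. g \<in> borel_measurable borel \<Longrightarrow> (\<And>x. \<bar>g x\<bar> \<le> B * V x) \<Longrightarrow>
      \<bar>En n g x - lim (\<lambda>n. En n g x)\<bar> \<le> C * \<kappa> ^ n * B * V x"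
    using geometric_Cauchy by metis
  define l where "l g = lim (\<lambda>n. En n g x)" for g
  have bd: "\<bar>g y\<bar> \<le> b * V y" if "\<And>x. 0 \<le> g x" "\<And>x. g x \<le> b" for g b y
    using that[of y] order_trans[of 0 "g y" b] mult_left_mono[OF V_ge_1[of y], of b] by simp
  have lim: "(\<lambda>n. En n g x) \<longlonglongrightarrow> l g" if "g \<in> borel_measurable borel" "\<And>x. 0 \<le> g x" "\<And>x. g x \<le> b" for g b
    using conv[OF that(1) bd[of g b, OF that(2,3)]] by (simp add: l_def convergent_LIMSEQ_iff)
  have rate': "\<bar>En n g x - l g\<bar> \<le> b * (C * \<kappa> ^ n * V x)"
    if "g \<in> borel_measurable borel" "\<And>x. 0 \<le> g x" "\<And>x. g x \<le> b" for g b n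
    using rate[OF that(1) bd[of g b, OF that(2,3)], of n x] by (simp add: l_def ac_simps)
  have to0: "(\<lambda>n. b * (C * \<kappa> ^ n * V x)) \<longlonglongrightarrow> 0" for b
    using tendsto_mult[OF tendsto_const[of b] tendsto_mult[OF tendsto_mult[OF tendsto_const[of C] LIMSEQ_realpow_zero[of \<kappa>]] tendsto_const[of "V x"]]] \<kappa> by simp
  have int: "integrable S (\<lambda>\<omega>. g (chain F x \<omega> n))" if "g \<in> borel_measurable borel" "\<And>x. 0 \<le> g x" "\<And>x. g x \<le> b" for g :: "'a \<Rightarrow> real" and b n
    by (rule integrable_chain[OF that(1) bd[of g b, OF that(2,3)]])
  \<comment> \<open>An interchange of limits: one time \<open>n\<close> serves \<open>u\<close> and
    all \<open>U i\<close> at once because the rate depends on the bound \<open>b\<close> only, and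
    at that fixed time dominated convergence applies.\<close>
  have mono_lim: "(\<lambda>i. l (U i)) \<longlonglongrightarrow> l u"
    if [measurable]: "\<And>i. U i \<in> borel_measurable borel" "u \<in> borel_measurable borel"
      and U: "\<And>i x. 0 \<le> U i x" "\<And>i x. U i x \<le> b" "\<And>x. (\<lambda>i. U i x) \<longlonglongrightarrow> u x" for U u b
  proof -
    have u: "0 \<le> u y" "u y \<le> b" for y
      using LIMSEQ_le_const[OF U(3), of 0 y] LIMSEQ_le_const2[OF U(3), of y b] U(1,2) by auto
    show ?thesis
    proof (rule LIMSEQ_I)
      fix e :: real assume e: "0 < e"
      have "\<forall>\<^sub>F n in sequentially. b * (C * \<kappa> ^ n * V x) < e / 3"
        using to0[of b] e by (intro order_tendstoD) auto
      then obtain n where n: "b * (C * \<kappa> ^ n * V x) < e / 3" by (auto simp: eventually_sequentially)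
      have "(\<lambda>i. En n (U i) x) \<longlonglongrightarrow> En n u x"
        unfolding En_def
        by (rule integral_dominated_convergence[where w="\<lambda>_. b"])
           (use U in auto)
      then have "\<forall>\<^sub>F i in sequentially. dist (En n (U i) x) (En n u x) < e / 3"
        using e by (intro tendstoD) auto
      then obtain N where N: "\<And>i. N \<le> i \<Longrightarrow> \<bar>En n (U i) x - En n u x\<bar> < e / 3"
        by (auto simp: eventually_sequentially dist_real_def)
      have near: "\<bar>En n (U i) x - l (U i)\<bar> < e / 3" "\<bar>En n u x - l u\<bar> < e / 3" for i
        using le_less_trans[OF rate' n] U u by auto
      have "\<bar>l (U i) - l u\<bar> < e" if "N \<le> i" for i
        using N[OF that] near(1)[of i] near(2) by linarith
      then show "\<exists>N. \<forall>i\<ge>N. norm (l (U i) - l u) < e" by auto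
    qed
  qed
  define G where "G A = ennreal (l (indicator A))" for A :: "'a set"
  have ind: "(indicator A :: 'a \<Rightarrow> real) \<in> borel_measurable borel" if "A \<in> sets borel" for A :: "'a set"
    using that by measurable
  have l_ind: "(\<lambda>n. En n (indicator A) x) \<longlonglongrightarrow> l (indicator A)" if "A \<in> sets borel" for A :: "'a set"
    by (rule lim[OF ind[OF that], of 1]) (auto simp: indicator_def)
  have l_nonneg: "0 \<le> l g" if "g \<in> borel_measurable borel" "\<And>x. 0 \<le> g x" "\<And>x. g x \<le> b" for g b
    by (rule LIMSEQ_le_const[OF lim[OF that]]) (auto simp: En_def that intro!: integral_nonneg_AE)
  have l_add: "l (\<lambda>x. g x + h x) = l g + l h"
    if "g \<in> borel_measurable borel" "\<And>x. 0 \<le> g x" "\<And>x. g x \<le> b"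
      "h \<in> borel_measurable borel" "\<And>x. 0 \<le> h x" "\<And>x. h x \<le> b" for g h b
  proof -
    have "En n (\<lambda>x. g x + h x) x = En n g x + En n h x" for n
      using int[OF that(1-3)] int[OF that(4-6)] by (simp add: En_def)
    then have "(\<lambda>n. En n (\<lambda>x. g x + h x) x) \<longlonglongrightarrow> l g + l h"
      using tendsto_add[OF lim[OF that(1-3)] lim[OF that(4-6)]] by simp
    then show ?thesis unfolding l_def using limI by blast
  qed
  have meas: "measure_space UNIV (sets borel) G"
  proof -
    interpret sigma_algebra UNIV "sets (borel :: 'a measure)"
      using sets.sigma_algebra_axioms[of "borel :: 'a measure"] by simp
    have pos: "positive (sets borel) G"
      by (simp add: positive_def G_def l_def En_def)
    have add: "Measure_Space.additive (sets borel) G"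
    proof (unfold Measure_Space.additive_def, intro ballI impI)
      fix A B :: "'a set" assume AB: "A \<in> sets borel" "B \<in> sets borel" "A \<inter> B = {}"
      have "(indicator (A \<union> B) :: 'a \<Rightarrow> real) = (\<lambda>x. indicator A x + indicator B x)"
        using AB(3) by (auto simp: indicator_def fun_eq_iff)
      then have "l (indicator (A \<union> B)) = l (indicator A) + l (indicator B)"
        using l_add[OF ind[OF AB(1)] _ _ ind[OF AB(2)], of 1] by (auto simp: indicator_def)
      moreover have "0 \<le> l (indicator A)" "0 \<le> l (indicator B)"
        using l_nonneg[OF ind[OF AB(1)], of 1] l_nonneg[OF ind[OF AB(2)], of 1] by (auto simp: indicator_def)
      ultimately show "G (A \<union> B) = G A + G B" by (simp add: G_def ennreal_plus)
    qed
    have "countably_additive (sets borel) G"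
    proof (rule empty_continuous_imp_countably_additive[OF pos add])
      fix A :: "nat \<Rightarrow> 'a set" assume A: "range A \<subseteq> sets borel" "decseq A" "(\<Inter>i. A i) = {}"
      have "(\<lambda>i. l (indicator (A i))) \<longlonglongrightarrow> l (\<lambda>_. 0)"
      proof (rule mono_lim[of _ _ 1])
        show "(\<lambda>i. indicator (A i) y :: real) \<longlonglongrightarrow> 0" for y
          using LIMSEQ_indicator_decseq[OF A(2), of y] unfolding A(3) by simp
      qed (use A ind in \<open>auto simp: indicator_def\<close>)
      moreover have "l (\<lambda>_. 0) = 0" by (simp add: l_def En_def)
      ultimately show "(\<lambda>i. G (A i)) \<longlonglongrightarrow> 0"
        unfolding G_def by (metis ennreal_0 tendsto_ennrealI)
    qed (simp add: G_def)
    then show ?thesis using pos sigma_algebra_axioms by (simp add: measure_space_def)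
  qed
  define \<Gamma> where "\<Gamma> = measure_of UNIV (sets (borel :: 'a measure)) G"
  have sets_\<Gamma>[simp, measurable_cong]: "sets \<Gamma> = sets borel"
    using sets.sigma_sets_eq[of "borel :: 'a measure"] by (simp add: \<Gamma>_def)
  have em: "emeasure \<Gamma> A = G A" if "A \<in> sets borel" for A
    using emeasure_measure_of_sigma[of UNIV "sets borel" G A] meas that
    by (simp add: \<Gamma>_def measure_space_def)
  have spG: "space \<Gamma> = UNIV" using sets_eq_imp_space_eq[OF sets_\<Gamma>] by simp
  have P: "prob_space \<Gamma>"
  proof
    have "l (indicator UNIV) = 1"
      using LIMSEQ_unique[OF l_ind[of UNIV]] by (simp add: En_def S.prob_space)
    then show "emeasure \<Gamma> (space \<Gamma>) = 1" by (simp add: spG em G_def)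
  qed
  interpret G: prob_space \<Gamma> by fact
  \<comment> \<open>The bound stays a premise of the induction formula since each construction step
    changes or inherits it: scaling by \<open>c\<close> needs \<open>b / c\<close>, summands and
    approximants inherit \<open>b\<close>.\<close>
  have eq: "(\<forall>x. g x \<le> b) \<longrightarrow> (\<integral>y. g y \<partial>\<Gamma>) = l g"
    if g: "g \<in> borel_measurable borel" "\<And>x. 0 \<le> g x" for g b
    using g(1)[folded measurable_cong_sets[OF sets_\<Gamma> refl]] g(2)
  proof (induction g arbitrary: b rule: borel_measurable_induct_real)
    case (set A)
    then have A: "A \<in> sets borel" by simp
    have "0 \<le> l (indicator A)" using l_nonneg[OF ind[OF A], of 1] by (auto simp: indicator_def)
    then have "measure \<Gamma> A = l (indicator A)" using em[OF A] by (simp add: measure_def G_def)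
    then show ?case using A by simp
  next
    case (mult u c)
    show ?case
    proof (cases "c = 0")
      case True
      then show ?thesis by (simp add: l_def En_def)
    next
      case False
      then have c: "0 < c" using mult by simp
      have "(\<integral>y. u y \<partial>\<Gamma>) = l u" and u: "\<forall>x. u x \<le> b / c" if "\<forall>x. c * u x \<le> b"
        using mult.IH[of "b / c"] c that by (auto simp: field_simps)
      moreover have "l (\<lambda>x. c * u x) = c * l u" if "\<forall>x. c * u x \<le> b"
      proof -
        have "(\<lambda>n. c * En n u x) \<longlonglongrightarrow> c * l u"
          using lim[of u "b / c"] mult u[OF that] by (intro tendsto_intros) auto
        then have "(\<lambda>n. En n (\<lambda>x. c * u x) x) \<longlonglongrightarrow> c * l u" by (simp add: En_def)
        then show ?thesis unfolding l_def using limI by blast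
      qed
      ultimately show ?thesis by simp
    qed
  next
    case (add u v)
    show ?case
    proof
      assume b: "\<forall>x. v x + u x \<le> b"
      have nonneg: "0 \<le> u x" "0 \<le> v x" for x using add.hyps by blast+
      have uv: "\<forall>x. u x \<le> b" "\<forall>x. v x \<le> b"
        using b nonneg by (meson add_increasing add_increasing2 le_add_same_cancel1 le_add_same_cancel2 order_trans)+
      have [measurable]: "u \<in> borel_measurable borel" "v \<in> borel_measurable borel"
        using add by auto
      have "integrable \<Gamma> u" "integrable \<Gamma> v"
        using add uv by (auto intro!: G.integrable_const_bound[where B=b])
      then show "(\<integral>y. v y + u y \<partial>\<Gamma>) = l (\<lambda>x. v x + u x)"
        using l_add[of v b u] add uv by simp
    qed
  next
    case (seq U)
    show ?case
    proof
      assume b: "\<forall>x. g x \<le> b"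
      have [measurable]: "\<And>i. U i \<in> borel_measurable borel" using seq by auto
      have [measurable]: "g \<in> borel_measurable borel" using g by auto
      have lim_U: "(\<lambda>i. U i y) \<longlonglongrightarrow> g y" for y using seq by (simp add: spG)
      have Ub: "U i y \<le> b" for i y
      proof -
        have "incseq (\<lambda>i. U i y)" using \<open>incseq U\<close> by (simp add: incseq_def le_fun_def)
        from incseq_le[OF this lim_U, of i] b show ?thesis by (meson order_trans)
      qed
      have "(\<lambda>i. \<integral>y. U i y \<partial>\<Gamma>) \<longlonglongrightarrow> (\<integral>y. g y \<partial>\<Gamma>)"
        by (rule integral_dominated_convergence[where w="\<lambda>_. b"]) (use lim_U Ub seq in auto)
      moreover have "(\<lambda>i. l (U i)) \<longlonglongrightarrow> l g"
        by (rule mono_lim[of _ _ b]) (use lim_U Ub seq in auto)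
      moreover have "(\<integral>y. U i y \<partial>\<Gamma>) = l (U i)" for i using seq.IH[of i b] Ub by auto
      ultimately show "(\<integral>y. g y \<partial>\<Gamma>) = l g" using LIMSEQ_unique by auto
    qed
  qed
  show ?thesis
  proof (rule that[OF P sets_\<Gamma>])
    fix g :: "'a \<Rightarrow> real" and b
    assume g: "g \<in> borel_measurable borel" "\<And>x. 0 \<le> g x" "\<And>x. g x \<le> b"
    show "(\<lambda>n. En n g x) \<longlonglongrightarrow> (\<integral>y. g y \<partial>\<Gamma>)"
      using lim[OF g] eq[OF g(1,2), of b] g(3) by auto
  qed
qed

end

context harris_chain
begin

text \<open>Invariance holds because \<open>En n (En 1 g)\<close> and \<open>En (n + 1) g\<close>
  agree and have the same limit. Once \<open>V\<close> is known to be
  \<open>\<Gamma>\<close>-integrable, the rate follows by integrating the two-point contraction over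
  the second starting point with respect to \<open>\<Gamma>\<close>.\<close>

theorem V_uniformly_ergodic:
  obtains \<Gamma> where "V_uniformly_ergodic_with F \<mu> V \<Gamma>" "(\<integral>\<^sup>+y. ennreal (V y) \<partial>\<Gamma>) < \<infinity>"
proof -
  \<comment> \<open>Any state serves as the starting point from which the limits are taken.\<close>
  define x0 :: 'a where "x0 = undefined"
  obtain \<Gamma> where P: "prob_space \<Gamma>" and sets_\<Gamma>[simp, measurable_cong]: "sets \<Gamma> = sets borel"
    and lim: "\<And>g b. g \<in> borel_measurable borel \<Longrightarrow> (\<And>x. 0 \<le> g x) \<Longrightarrow> (\<And>x. g x \<le> b) \<Longrightarrow>
       (\<lambda>n. En n g x0) \<longlonglongrightarrow> (\<integral>y. g y \<partial>\<Gamma>)"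
    using stationary_distribution[of x0] by blast
  interpret G: prob_space \<Gamma> by fact
  interpret PG: pair_prob_space \<Gamma> \<mu> ..
  have spG: "space \<Gamma> = UNIV" using sets_eq_imp_space_eq[OF sets_\<Gamma>] by simp
  have bd: "\<bar>g y\<bar> \<le> b * V y" if "\<And>x. 0 \<le> g x" "\<And>x. g x \<le> b" for g b y
    using that[of y] order_trans[of 0 "g y" b] mult_left_mono[OF V_ge_1[of y], of b] by simp
  have dist: "distr (\<Gamma> \<Otimes>\<^sub>M \<mu>) borel (case_prod F) = \<Gamma>" (is "?D = _")
  proof (rule measure_eqI)
    fix A assume "A \<in> sets ?D"
    then have A[measurable]: "A \<in> sets borel" by simp
    let ?i = "indicator A :: 'a \<Rightarrow> real"
    have i: "\<bar>?i y\<bar> \<le> 1 * V y" for y by (rule bd) (auto simp: indicator_def)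
    have e: "0 \<le> En n ?i y" "En n ?i y \<le> 1" for n y
      using integrable_chain[OF _ i, of y n]
      by (auto simp: En_def intro!: integral_nonneg_AE S.integral_le_const)
    have "emeasure ?D A = (\<integral>\<^sup>+y. \<integral>\<^sup>+u. indicator A (F y u) \<partial>\<mu> \<partial>\<Gamma>)"
      by (subst nn_integral_indicator[symmetric], simp, subst nn_integral_distr)
         (auto simp: nn_integral_fst[symmetric])
    also have "\<dots> = (\<integral>\<^sup>+y. ennreal (En 1 ?i y) \<partial>\<Gamma>)"
    proof (intro nn_integral_cong)
      fix y
      have "(\<integral>\<^sup>+u. indicator A (F y u) \<partial>\<mu>) = (\<integral>\<^sup>+\<omega>. indicator A (chain F y \<omega> (Suc 0)) \<partial>S)"
        by (subst nn_chain_Suc) (auto simp: S.emeasure_space_1)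
      also have "\<dots> = (\<integral>\<^sup>+\<omega>. ennreal (?i (chain F y \<omega> 1)) \<partial>S)"
        by (simp only: ennreal_indicator One_nat_def)
      also have "\<dots> = ennreal (En 1 ?i y)"
        unfolding En_def by (rule nn_integral_eq_integral[OF integrable_chain[OF _ i]]) auto
      finally show "(\<integral>\<^sup>+u. indicator A (F y u) \<partial>\<mu>) = ennreal (En 1 ?i y)" .
    qed
    also have "\<dots> = ennreal (\<integral>y. En 1 ?i y \<partial>\<Gamma>)"
      using e by (intro nn_integral_eq_integral G.integrable_const_bound[where B=1]) auto
    also have "(\<integral>y. En 1 ?i y \<partial>\<Gamma>) = (\<integral>y. ?i y \<partial>\<Gamma>)"
    proof (rule LIMSEQ_unique)
      show "(\<lambda>n. En n (En 1 ?i) x0) \<longlonglongrightarrow> (\<integral>y. En 1 ?i y \<partial>\<Gamma>)"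
        by (rule lim[of _ 1]) (use e in auto)
      have "(\<lambda>n. En (n + 1) ?i x0) \<longlonglongrightarrow> (\<integral>y. ?i y \<partial>\<Gamma>)"
        by (rule LIMSEQ_ignore_initial_segment[OF lim[of _ 1]]) (auto simp: indicator_def)
      then show "(\<lambda>n. En n (En 1 ?i) x0) \<longlonglongrightarrow> (\<integral>y. ?i y \<partial>\<Gamma>)"
        using En_add[OF _ i, of _ 1 x0] by simp
    qed
    also have "\<dots> = measure \<Gamma> A" by simp
    finally show "emeasure ?D A = emeasure \<Gamma> A" by (simp add: G.emeasure_eq_measure)
  qed simp
  \<comment> \<open>The convergence \<open>lim\<close> is available for bounded functions only, so
    \<open>V\<close> is truncated at \<open>N\<close> before \<open>N\<close> tends to
    infinity.\<close>
  have "(\<integral>\<^sup>+y. ennreal (V y) \<partial>\<Gamma>) \<le> ennreal (V x0 + K)"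
  proof (rule LIMSEQ_le_const2)
    let ?m = "\<lambda>N::nat. \<lambda>y. min (V y) (real N)"
    show "(\<lambda>N. \<integral>\<^sup>+y. ennreal (?m N y) \<partial>\<Gamma>) \<longlonglongrightarrow> (\<integral>\<^sup>+y. ennreal (V y) \<partial>\<Gamma>)"
    proof (rule nn_integral_LIMSEQ)
      show "incseq (\<lambda>N y. ennreal (?m N y))"
        by (auto simp: incseq_def le_fun_def intro!: ennreal_leI)
      show "(\<lambda>N. ennreal (?m N y)) \<longlonglongrightarrow> ennreal (V y)" for y
      proof (rule tendsto_eventually)
        obtain N where "V y \<le> real N" using real_arch_simple by blast
        then have "\<forall>n\<ge>N. ?m n y = V y" by (auto simp: min_def)
        then show "\<forall>\<^sub>F N in sequentially. ennreal (?m N y) = ennreal (V y)"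
          unfolding eventually_sequentially by metis
      qed
    qed simp
    have "(\<integral>\<^sup>+y. ennreal (?m N y) \<partial>\<Gamma>) \<le> ennreal (V x0 + K)" for N
    proof -
      have m0: "0 \<le> ?m N y" for y using V_nonneg by simp
      have mV: "\<bar>?m N y\<bar> \<le> 1 * V y" for y using m0[of y] by simp
      have "(\<lambda>n. En n (?m N) x0) \<longlonglongrightarrow> (\<integral>y. ?m N y \<partial>\<Gamma>)"
        by (rule lim[of _ "real N"]) (use m0 in auto)
      moreover have "En n (?m N) x0 \<le> V x0 + K" for n
        using En_abs_le[OF _ mV, of n x0] En_V_le'[of n x0] by simp
      ultimately have "(\<integral>y. ?m N y \<partial>\<Gamma>) \<le> V x0 + K" by (intro LIMSEQ_le_const2) auto
      moreover have "(\<integral>\<^sup>+y. ennreal (?m N y) \<partial>\<Gamma>) = ennreal (\<integral>y. ?m N y \<partial>\<Gamma>)"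
        using m0 by (intro nn_integral_eq_integral G.integrable_const_bound[where B="real N"]) auto
      ultimately show ?thesis by (simp add: ennreal_leI)
    qed
    then show "\<exists>N. \<forall>n\<ge>N. (\<integral>\<^sup>+y. ennreal (?m n y) \<partial>\<Gamma>) \<le> ennreal (V x0 + K)" by blast
  qed
  then have finV: "(\<integral>\<^sup>+y. ennreal (V y) \<partial>\<Gamma>) < \<infinity>"
    using ennreal_less_top[of "V x0 + K"] by (simp add: le_less_trans)
  have iV: "integrable \<Gamma> V"
    using finV V_nonneg by (intro integrableI_bounded) auto
  have ig: "integrable \<Gamma> g" if [measurable]: "g \<in> borel_measurable borel" and "\<And>x. \<bar>g x\<bar> \<le> B * V x" for g B
  proof (rule Bochner_Integration.integrable_bound)
    show "integrable \<Gamma> (\<lambda>y. B * V y)" using iV by simp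
    show "AE y in \<Gamma>. norm (g y) \<le> norm (B * V y)"
      using that(2) by (intro AE_I2) (simp, meson abs_ge_self order_trans)
  qed measurable
  have inv1: "(\<integral>y. En 1 g y \<partial>\<Gamma>) = (\<integral>y. g y \<partial>\<Gamma>)"
    if [measurable]: "g \<in> borel_measurable borel" and g: "\<And>x. \<bar>g x\<bar> \<le> B * V x" for g B
  proof -
    have i: "integrable (\<Gamma> \<Otimes>\<^sub>M \<mu>) (\<lambda>z. g (case_prod F z))"
      using ig[OF that] by (subst (asm) dist[symmetric]) (subst (asm) integrable_distr_eq, auto)
    have "(\<integral>y. g y \<partial>\<Gamma>) = (\<integral>z. g (case_prod F z) \<partial>(\<Gamma> \<Otimes>\<^sub>M \<mu>))"
      by (subst dist[symmetric]) (subst integral_distr, auto)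
    also have "\<dots> = (\<integral>y. \<integral>u. g (F y u) \<partial>\<mu> \<partial>\<Gamma>)"
      using PG.integral_fst'[OF i] by simp
    also have "(\<lambda>y. \<integral>u. g (F y u) \<partial>\<mu>) = (\<lambda>y. En 1 g y)"
      using En_Suc[of g _ 0] integrable_chain[OF that, of _ "Suc 0"]
      by (auto simp: fun_eq_iff En_def[of 0] S.prob_space)
    finally show ?thesis by simp
  qed
  have inv: "(\<integral>y. En n g y \<partial>\<Gamma>) = (\<integral>y. g y \<partial>\<Gamma>)"
    if g: "g \<in> borel_measurable borel" "\<And>x. \<bar>g x\<bar> \<le> B * V x" for g B n
  proof (induction n)
    case 0
    show ?case by (simp add: En_def S.prob_space)
  next
    case (Suc n)
    have "En (Suc n) g = En 1 (En n g)" using En_add[OF g, of 1 n] by auto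
    then show ?case using inv1[OF En_measurable[OF g(1)] En_growth[OF g], of n] Suc by simp
  qed
  obtain C \<kappa> where C: "0 \<le> C" and \<kappa>: "0 < \<kappa>" "\<kappa> < 1" and con:
    "\<And>g B n x y. g \<in> borel_measurable borel \<Longrightarrow> (\<And>x. \<bar>g x\<bar> \<le> B * V x) \<Longrightarrow>
      \<bar>En n g x - En n g y\<bar> \<le> C * \<kappa> ^ n * B * (V x + V y)"
    using geometric_contraction by blast
  define v where "v = (\<integral>y. V y \<partial>\<Gamma>)"
  have v: "0 \<le> v" unfolding v_def using V_nonneg by (intro integral_nonneg_AE) auto
  have rate: "\<bar>En n g x - (\<integral>y. g y \<partial>\<Gamma>)\<bar> \<le> C * (1 + v) * \<kappa> ^ n * V x"
    if [measurable]: "g \<in> borel_measurable borel" and g: "\<And>x. \<bar>g x\<bar> \<le> 1 * V x" for g n x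
  proof -
    note ie = ig[OF En_measurable[OF that(1)] En_growth[OF that], of n]
    have "En n g x - (\<integral>y. g y \<partial>\<Gamma>) = (\<integral>y. En n g x - En n g y \<partial>\<Gamma>)"
      using ie by (simp add: inv[OF that] G.prob_space)
    also have "\<bar>\<dots>\<bar> \<le> (\<integral>y. \<bar>En n g x - En n g y\<bar> \<partial>\<Gamma>)"
      by (rule integral_abs_bound)
    also have "\<dots> \<le> (\<integral>y. C * \<kappa> ^ n * 1 * (V x + V y) \<partial>\<Gamma>)"
      using ie iV by (intro integral_mono con[OF that]) auto
    also have "\<dots> = C * \<kappa> ^ n * (V x + v)" using iV by (simp add: v_def G.prob_space)
    also have "\<dots> \<le> C * \<kappa> ^ n * ((1 + v) * V x)"
      using C \<kappa> v V_ge_1[of x] mult_left_mono[of 1 "V x" v]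
      by (intro mult_left_mono) (auto simp: algebra_simps)
    finally show ?thesis by (simp add: algebra_simps)
  qed
  have "V_uniformly_ergodic_with F \<mu> V \<Gamma>"
    unfolding V_uniformly_ergodic_with_def stationary_distr_def
  proof (rule conjI, (intro conjI P sets_\<Gamma> dist)[1], rule exI[of _ "C * (1 + v)"], rule exI[of _ \<kappa>],
      rule conjI[OF \<kappa>(2)], intro ballI impI allI conjI)
    fix g :: "'a \<Rightarrow> real" and x n
    assume g: "g \<in> borel_measurable borel" "\<forall>x. \<bar>g x\<bar> \<le> V x"
    have g': "\<And>x. \<bar>g x\<bar> \<le> 1 * V x" using g by simp
    show "integrable S (\<lambda>\<omega>. g (chain F x \<omega> n))" by (rule integrable_chain[OF g(1) g'])
    show "integrable \<Gamma> g" by (rule ig[OF g(1) g'])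
    show "\<bar>(\<integral>\<omega>. g (chain F x \<omega> n) \<partial>S) - (\<integral>y. g y \<partial>\<Gamma>)\<bar> \<le> C * (1 + v) * \<kappa> ^ n * V x"
      using rate[OF g(1) g'] by (simp add: En_def)
  qed
  then show ?thesis using finV by (rule that)
qed

end

section \<open>Continuity of affine perturbations in weighted total variation\<close>

text \<open>Outer regularity replaces \<open>A\<close> by an open set \<open>U\<close> at the cost
  \<open>e / 2\<close>. The indicator of \<open>U\<close> is a pointwise limit of continuous
  functions with bounded support, all dominated by it.\<close>

lemma L1_approx_indicator:
  fixes A :: "real set"
  assumes A: "A \<in> sets lborel" "emeasure lborel A < \<infinity>" and e: "0 < e"
  obtains \<psi> :: "real \<Rightarrow> real" and N where "continuous_on UNIV \<psi>" "0 \<le> N" "\<And>x. N < \<bar>x\<bar> \<Longrightarrow> \<psi> x = 0"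
    "integrable lborel \<psi>" "(\<integral>x. \<bar>indicator A x - \<psi> x\<bar> \<partial>lborel) < e"
proof -
  obtain U where U: "open U" "A \<subseteq> U" "emeasure lborel (U - A) < ennreal (e / 2)"
    using outer_regular_lborel[of A "e / 2"] A e by auto
  have [measurable]: "U \<in> sets borel" "A \<in> sets borel" using U A by auto
  have "emeasure lborel U \<le> emeasure lborel A + emeasure lborel (U - A)"
    using emeasure_subadditive[of A lborel "U - A"] U(2) by (auto simp: Un_absorb1)
  then have Ufin: "emeasure lborel U < \<infinity>"
    using A(2) less_trans[OF U(3) ennreal_less_top] by (simp add: le_less_trans)
  \<comment> \<open>The complement has to be nonempty, as \<open>infdist\<close> to the empty set is
    0 by convention.\<close>
  then have "U \<noteq> UNIV" by auto
  then have cU: "- U \<noteq> {}" by blast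
  \<comment> \<open>The first factor exhausts \<open>U\<close> from inside, the second one cuts off
    at distance \<open>k + 1\<close> from the origin.\<close>
  define \<psi> :: "nat \<Rightarrow> real \<Rightarrow> real"
    where "\<psi> k x = min 1 (k * infdist x (- U)) * max 0 (min 1 (k + 1 - \<bar>x\<bar>))" for k x
  have cont: "continuous_on UNIV (\<psi> k)" for k
    unfolding \<psi>_def by (intro continuous_intros)
  have [measurable]: "\<psi> k \<in> borel_measurable borel" for k
    by (rule borel_measurable_continuous_onI[OF cont])
  have bnd: "\<bar>\<psi> k x\<bar> \<le> indicator U x" for k x
  proof (cases "x \<in> U")
    case True
    have "0 \<le> infdist x (- U)" by (rule infdist_nonneg)
    then have "0 \<le> \<psi> k x" "\<psi> k x \<le> 1 * 1"
      unfolding \<psi>_def by (intro mult_nonneg_nonneg mult_mono; simp)+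
    then show ?thesis using True by simp
  qed (simp add: \<psi>_def)
  have iU: "integrable lborel (indicator U :: real \<Rightarrow> real)"
    using Ufin by (simp add: integrable_indicator_iff)
  have iA: "integrable lborel (indicator A :: real \<Rightarrow> real)"
    using A by (simp add: integrable_indicator_iff)
  have i\<psi>: "integrable lborel (\<psi> k)" for k
    by (rule Bochner_Integration.integrable_bound[OF iU]) (use bnd in auto)
  have "(\<lambda>k. \<integral>x. \<bar>indicator U x - \<psi> k x\<bar> \<partial>lborel) \<longlonglongrightarrow> (\<integral>x. 0 \<partial>(lborel :: real measure))"
  proof (rule integral_dominated_convergence[where w="\<lambda>x. 2 * indicator U x"])
    show "AE x in lborel. (\<lambda>k. \<bar>indicator U x - \<psi> k x\<bar>) \<longlonglongrightarrow> 0"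
    proof (intro AE_I2)
      fix x :: real
      show "(\<lambda>k. \<bar>indicator U x - \<psi> k x\<bar>) \<longlonglongrightarrow> 0"
      proof (cases "x \<in> U")
        case True
        then have pos: "0 < infdist x (- U)"
          using infdist_pos_not_in_closed[of "- U" x] U(1) cU by (auto simp: closed_Compl)
        obtain k0 where k0: "1 / infdist x (- U) + \<bar>x\<bar> \<le> real k0" using real_arch_simple by blast
        have "\<psi> k x = 1" if "k0 \<le> k" for k
        proof -
          have k: "1 / infdist x (- U) + \<bar>x\<bar> \<le> real k" using k0 that by linarith
          then have "1 / infdist x (- U) \<le> real k" by linarith
          then have "1 \<le> real k * infdist x (- U)" using pos by (simp add: field_simps)
          moreover have "0 \<le> 1 / infdist x (- U)" using pos by simp
          then have "\<bar>x\<bar> \<le> real k" using k by linarith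
          ultimately show ?thesis by (simp add: \<psi>_def)
        qed
        then have "\<forall>\<^sub>F k in sequentially. \<bar>indicator U x - \<psi> k x\<bar> = 0"
          using True unfolding eventually_sequentially by (intro exI[of _ k0]) auto
        then show ?thesis by (rule tendsto_eventually)
      qed (simp add: \<psi>_def)
    qed
    show "AE x in lborel. norm \<bar>indicator U x - \<psi> k x\<bar> \<le> 2 * indicator U x" for k
      using bnd[of k] by (intro AE_I2) (fastforce simp: abs_le_iff split: split_indicator)
  qed (use iU in auto)
  then have "\<forall>\<^sub>F k in sequentially. (\<integral>x. \<bar>indicator U x - \<psi> k x\<bar> \<partial>lborel) < e / 2"
    using e by (intro order_tendstoD) auto
  then obtain k where k: "(\<integral>x. \<bar>indicator U x - \<psi> k x\<bar> \<partial>lborel) < e / 2"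
    by (auto simp: eventually_sequentially)
  have "(\<integral>x. \<bar>indicator A x - indicator U x :: real\<bar> \<partial>lborel) = (\<integral>x. indicator (U - A) x \<partial>lborel)"
    using U(2) by (intro Bochner_Integration.integral_cong) (auto split: split_indicator)
  also have "\<dots> = measure lborel (U - A)" by simp
  also have "\<dots> < e / 2"
  proof -
    have "emeasure lborel (U - A) \<noteq> top" using U(3) by auto
    then show ?thesis
      using U(3) e by (simp add: emeasure_eq_ennreal_measure ennreal_less_iff)
  qed
  finally have AU: "(\<integral>x. \<bar>indicator A x - indicator U x :: real\<bar> \<partial>lborel) < e / 2" .
  have "(\<integral>x. \<bar>indicator A x - \<psi> k x\<bar> \<partial>lborel)
      \<le> (\<integral>x. \<bar>indicator A x - indicator U x :: real\<bar> + \<bar>indicator U x - \<psi> k x\<bar> \<partial>lborel)"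
    using iA iU i\<psi> by (intro integral_mono) auto
  also have "\<dots> = (\<integral>x. \<bar>indicator A x - indicator U x :: real\<bar> \<partial>lborel) + (\<integral>x. \<bar>indicator U x - \<psi> k x\<bar> \<partial>lborel)"
    using iA iU i\<psi> by (intro Bochner_Integration.integral_add) auto
  also have "\<dots> < e" using AU k by linarith
  finally show ?thesis
    by (intro that[of "\<psi> k" "real k + 1"]) (use cont i\<psi> in \<open>auto simp: \<psi>_def\<close>)
qed

text \<open>Density of continuous functions with bounded support in \<open>L^1\<close>, by induction
  on integrable functions: indicators, sums, dominated limits.\<close>

lemma L1_approx_continuous:
  fixes g :: "real \<Rightarrow> real"
  assumes "integrable lborel g" "0 < e"
  shows "\<exists>\<psi> N. continuous_on UNIV \<psi> \<and> 0 \<le> N \<and> (\<forall>x. N < \<bar>x\<bar> \<longrightarrow> \<psi> x = 0) \<and>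
    integrable lborel \<psi> \<and> (\<integral>x. \<bar>g x - \<psi> x\<bar> \<partial>lborel) < e"
  using assms
proof (induction arbitrary: e rule: integrable_induct)
  case (base A c)
  have "0 < e / (\<bar>c\<bar> + 1)" using base by simp
  then obtain \<psi> N where \<psi>: "continuous_on UNIV \<psi>" "0 \<le> N" "\<And>x. N < \<bar>x\<bar> \<Longrightarrow> \<psi> x = 0"
    "integrable lborel \<psi>" "(\<integral>x. \<bar>indicator A x - \<psi> x\<bar> \<partial>lborel) < e / (\<bar>c\<bar> + 1)"
    using L1_approx_indicator[OF base(1,2)] by blast
  have "(\<integral>x. \<bar>indicator A x *\<^sub>R c - c * \<psi> x\<bar> \<partial>lborel) = (\<integral>x. \<bar>c\<bar> * \<bar>indicator A x - \<psi> x\<bar> \<partial>lborel)"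
    by (intro Bochner_Integration.integral_cong) (auto simp: abs_mult[symmetric] algebra_simps)
  also have "\<dots> = \<bar>c\<bar> * (\<integral>x. \<bar>indicator A x - \<psi> x\<bar> \<partial>lborel)" by simp
  also have "\<dots> \<le> \<bar>c\<bar> * (e / (\<bar>c\<bar> + 1))" using \<psi> by (intro mult_left_mono) auto
  also have "\<dots> < e" using base by (simp add: field_simps)
  finally have "(\<integral>x. \<bar>indicator A x *\<^sub>R c - c * \<psi> x\<bar> \<partial>lborel) < e" .
  then show ?case using \<psi> by (intro exI[of _ "\<lambda>x. c * \<psi> x"] exI[of _ N]) (auto intro!: continuous_intros)
next
  case (add f g)
  have e: "0 < e / 2" using add by simp
  obtain \<psi>1 N1 where 1: "continuous_on UNIV \<psi>1" "0 \<le> N1" "\<forall>x. N1 < \<bar>x\<bar> \<longrightarrow> \<psi>1 x = 0"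
    "integrable lborel \<psi>1" "(\<integral>x. \<bar>f x - \<psi>1 x\<bar> \<partial>lborel) < e / 2" using add.IH(1)[OF e] by blast
  obtain \<psi>2 N2 where 2: "continuous_on UNIV \<psi>2" "0 \<le> N2" "\<forall>x. N2 < \<bar>x\<bar> \<longrightarrow> \<psi>2 x = 0"
    "integrable lborel \<psi>2" "(\<integral>x. \<bar>g x - \<psi>2 x\<bar> \<partial>lborel) < e / 2" using add.IH(2)[OF e] by blast
  have "(\<integral>x. \<bar>(f x + g x) - (\<psi>1 x + \<psi>2 x)\<bar> \<partial>lborel) \<le> (\<integral>x. \<bar>f x - \<psi>1 x\<bar> + \<bar>g x - \<psi>2 x\<bar> \<partial>lborel)"
    using add 1 2 by (intro integral_mono) auto
  also have "\<dots> = (\<integral>x. \<bar>f x - \<psi>1 x\<bar> \<partial>lborel) + (\<integral>x. \<bar>g x - \<psi>2 x\<bar> \<partial>lborel)"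
    using add 1 2 by (intro Bochner_Integration.integral_add) auto
  also have "\<dots> < e" using 1 2 by linarith
  finally show ?case using 1 2
    by (intro exI[of _ "\<lambda>x. \<psi>1 x + \<psi>2 x"] exI[of _ "max N1 N2"]) (auto intro!: continuous_intros)
next
  case (lim f s)
  note [measurable] = borel_measurable_integrable[OF lim.hyps(4)] borel_measurable_integrable[OF lim.hyps(1)]
  have e: "0 < e / 2" using lim by simp
  have "(\<lambda>i. \<integral>x. \<bar>f x - s i x\<bar> \<partial>lborel) \<longlonglongrightarrow> (\<integral>x. 0 \<partial>(lborel :: real measure))"
  proof (rule integral_dominated_convergence[where w="\<lambda>x. 3 * \<bar>f x\<bar>"])
    show "AE x in lborel. (\<lambda>i. \<bar>f x - s i x\<bar>) \<longlonglongrightarrow> 0"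
      using lim.hyps(2) by (intro AE_I2 tendsto_rabs_zero) (auto intro!: tendsto_eq_intros)
    show "AE x in lborel. norm \<bar>f x - s i x\<bar> \<le> 3 * \<bar>f x\<bar>" for i
    proof (intro AE_I2)
      fix x :: real
      have "\<bar>s i x\<bar> \<le> 2 * \<bar>f x\<bar>" using lim.hyps(3)[of x i] by simp
      then show "norm \<bar>f x - s i x\<bar> \<le> 3 * \<bar>f x\<bar>" by simp
    qed
  qed (use lim in auto)
  then have "\<forall>\<^sub>F i in sequentially. (\<integral>x. \<bar>f x - s i x\<bar> \<partial>lborel) < e / 2"
    using e by (intro order_tendstoD) auto
  then obtain i where i: "(\<integral>x. \<bar>f x - s i x\<bar> \<partial>lborel) < e / 2"
    by (auto simp: eventually_sequentially)
  obtain \<psi> N where \<psi>: "continuous_on UNIV \<psi>" "0 \<le> N" "\<forall>x. N < \<bar>x\<bar> \<longrightarrow> \<psi> x = 0"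
    "integrable lborel \<psi>" "(\<integral>x. \<bar>s i x - \<psi> x\<bar> \<partial>lborel) < e / 2" using lim.IH[OF e, of i] by blast
  have "(\<integral>x. \<bar>f x - \<psi> x\<bar> \<partial>lborel) \<le> (\<integral>x. \<bar>f x - s i x\<bar> + \<bar>s i x - \<psi> x\<bar> \<partial>lborel)"
    using lim \<psi> by (intro integral_mono) auto
  also have "\<dots> = (\<integral>x. \<bar>f x - s i x\<bar> \<partial>lborel) + (\<integral>x. \<bar>s i x - \<psi> x\<bar> \<partial>lborel)"
    using lim \<psi> by (intro Bochner_Integration.integral_add) auto
  also have "\<dots> < e" using i \<psi> by linarith
  finally show ?case using \<psi> by blast
qed

text \<open>The choice of \<open>\<delta>\<close> before \<open>h\<close> is the point. As
  \<open>h\<close> is only measurable, the perturbation is moved onto the density: the substitution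
  \<open>y = s + t * u\<close> leaves \<open>h y\<close> fixed and turns \<open>\<phi> u\<close>
  into \<open>\<phi> ((y - s) / t) / t\<close>, which is uniformly close to \<open>\<phi> y\<close>
  once \<open>f\<close> has been replaced by a continuous \<open>\<phi>\<close> with bounded
  support.\<close>

lemma integral_affine_perturbation:
  fixes f :: "real \<Rightarrow> real" and r :: real
  assumes [measurable]: "f \<in> borel_measurable borel" and f0: "\<And>u. 0 \<le> f u" and r: "0 \<le> r"
    and int: "integrable lborel (\<lambda>u. (1 + \<bar>u\<bar>) powr r * f u)" and e: "0 < e"
  obtains \<delta> where "0 < \<delta>" "\<And>s t h. \<bar>s\<bar> \<le> \<delta> \<Longrightarrow> \<bar>t - 1\<bar> \<le> \<delta> \<Longrightarrow> h \<in> borel_measurable borel \<Longrightarrow>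
     (\<And>y. 0 \<le> h y) \<Longrightarrow> (\<And>y. h y \<le> (1 + \<bar>y\<bar>) powr r) \<Longrightarrow>
     (\<integral>u. h (s + t * u) * f u \<partial>lborel) \<le> (\<integral>u. h u * f u \<partial>lborel) + e"
proof -
  define w where "w u = (1 + \<bar>u\<bar>) powr r" for u :: real
  have w_pos: "0 < w u" for u by (simp add: w_def add_pos_nonneg)
  have [measurable]: "w \<in> borel_measurable borel" unfolding w_def by measurable
  \<comment> \<open>For \<open>s\<close> within 1/2 of 0 and \<open>t\<close> within 1/2 of 1 one
    has \<open>1 + \<bar>s + t * u\<bar> \<le> 2 * (1 + \<bar>u\<bar>)\<close>, so
    \<open>c * w u\<close> dominates both \<open>h u\<close> and
    \<open>h (s + t * u)\<close>.\<close>
  define c where "c = (2::real) powr r"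
  have c: "0 < c" by (simp add: c_def)
  \<comment> \<open>Exchanging \<open>f\<close> for \<open>\<phi>\<close> costs
    \<open>c * d = e / 4\<close>. It happens twice, and \<open>e / 2\<close> is left for moving
    \<open>\<phi>\<close>.\<close>
  define d where "d = e / (4 * c)"
  have d: "0 < d" using e c by (simp add: d_def)
  obtain \<psi> N where \<psi>: "continuous_on UNIV \<psi>" "0 \<le> N" "\<And>x. N < \<bar>x\<bar> \<Longrightarrow> \<psi> x = 0"
    "integrable lborel \<psi>" "(\<integral>x. \<bar>w x * f x - \<psi> x\<bar> \<partial>lborel) < d"
    using L1_approx_continuous[OF int d] unfolding w_def by blast
  \<comment> \<open>Dividing by the weight makes the weighted distance of \<open>f\<close> and
    \<open>\<phi>\<close> equal to the plain \<open>L^1\<close> distance of \<open>w * f\<close> and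
    \<open>\<psi>\<close>.\<close>
  define \<phi> where "\<phi> x = \<psi> x / w x" for x
  have cont: "continuous_on UNIV \<phi>"
    unfolding \<phi>_def w_def
    by (intro continuous_intros \<psi>) (auto simp: add_nonneg_eq_0_iff)
  have [measurable]: "\<phi> \<in> borel_measurable borel" "\<psi> \<in> borel_measurable borel"
    by (rule borel_measurable_continuous_onI[OF cont], rule borel_measurable_continuous_onI[OF \<psi>(1)])
  have \<phi>0: "\<phi> x = 0" if "N < \<bar>x\<bar>" for x using \<psi>(3)[OF that] by (simp add: \<phi>_def)
  have w\<phi>: "w x * \<phi> x = \<psi> x" for x using w_pos[of x] by (simp add: \<phi>_def)
  \<comment> \<open>Outside \<open>{-M..M}\<close> both \<open>\<phi> y\<close> and
    \<open>\<phi> ((y - s) / t)\<close> vanish, since \<open>\<bar>y - s\<bar> > 2 * N + 1/2\<close>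
    and \<open>t \<le> 3/2\<close>.\<close>
  define M where "M = 2 * N + 1"
  have M: "0 < M" using \<psi>(2) by (simp add: M_def)
  \<comment> \<open>Chosen so that interval length \<open>2 * M\<close> times the bound
    \<open>(1 + M) powr r\<close> for \<open>h\<close> times \<open>\<eta>\<close> equals
    \<open>e / 2\<close>.\<close>
  define \<eta> where "\<eta> = e / (4 * M * (1 + M) powr r)"
  have M': "0 < (1 + M) powr r" using M by simp
  have \<eta>: "0 < \<eta>" unfolding \<eta>_def using M M' e by (intro divide_pos_pos mult_pos_pos) auto
  let ?K = "{-1/2..1/2::real} \<times> {1/2..3/2::real} \<times> {-M..M}"
  let ?q = "\<lambda>(s, t, y). \<phi> ((y - s) / t) / t"
  have "continuous_on ?K ?q"
    unfolding split_beta'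
    by (intro continuous_intros continuous_on_compose2[OF cont]) auto
  moreover have "compact ?K" by (intro compact_Times compact_Icc)
  ultimately have "uniformly_continuous_on ?K ?q"
    by (rule compact_uniformly_continuous)
  from this[unfolded uniformly_continuous_on_def, rule_format, OF \<eta>]
  obtain \<delta>1 where \<delta>1: "0 < \<delta>1" and
    uc: "\<And>x x'. x \<in> ?K \<Longrightarrow> x' \<in> ?K \<Longrightarrow> dist x' x < \<delta>1 \<Longrightarrow> dist (?q x') (?q x) < \<eta>"
    by blast
  define \<delta> where "\<delta> = min (1/2) (\<delta>1 / 4)"
  have \<delta>: "0 < \<delta>" "\<delta> \<le> 1 / 2" "\<delta> \<le> \<delta>1 / 4" using \<delta>1 by (auto simp: \<delta>_def)
  show ?thesis
  proof (rule that[OF \<delta>(1)])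
    fix s t :: real and h :: "real \<Rightarrow> real"
    assume st: "\<bar>s\<bar> \<le> \<delta>" "\<bar>t - 1\<bar> \<le> \<delta>" and [measurable]: "h \<in> borel_measurable borel"
      and h: "\<And>y. 0 \<le> h y" "\<And>y. h y \<le> (1 + \<bar>y\<bar>) powr r"
    have t: "1 / 2 \<le> t" "t \<le> 3 / 2" and s: "\<bar>s\<bar> \<le> 1 / 2" using st \<delta> by (auto simp: abs_le_iff)
    have hst: "h (s + t * u) \<le> c * w u" for u
    proof -
      have "\<bar>t * u\<bar> \<le> 3 / 2 * \<bar>u\<bar>" using mult_right_mono[OF t(2), of "\<bar>u\<bar>"] t by (simp add: abs_mult)
      then have "1 + \<bar>s + t * u\<bar> \<le> 2 * (1 + \<bar>u\<bar>)" using s by (simp add: abs_le_iff) linarith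
      then have "(1 + \<bar>s + t * u\<bar>) powr r \<le> (2 * (1 + \<bar>u\<bar>)) powr r" using r by (intro powr_mono2) auto
      also have "\<dots> = c * w u" unfolding c_def w_def by (rule powr_mult)
      finally show ?thesis using h(2)[of "s + t * u"] by linarith
    qed
    have hw: "h u \<le> w u" for u using h(2) by (simp add: w_def)
    have c1: "1 \<le> c" using r by (simp add: c_def ge_one_powr_ge_zero)
    have hc: "h u \<le> c * w u" for u
      using hw[of u] mult_right_mono[OF c1, of "w u"] w_pos[of u] by linarith
    have iwf: "integrable lborel (\<lambda>u. c * (w u * f u))" using int by (simp add: w_def)
    have i1: "integrable lborel (\<lambda>u. k u * f u)"
      if [measurable]: "k \<in> borel_measurable borel" and "\<And>u. 0 \<le> k u" "\<And>u. k u \<le> c * w u" for k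
    proof (rule Bochner_Integration.integrable_bound[OF iwf])
      show "AE u in lborel. norm (k u * f u) \<le> norm (c * (w u * f u))"
      proof (intro AE_I2)
        fix u
        have "k u * f u \<le> (c * w u) * f u" by (intro mult_right_mono that f0)
        then show "norm (k u * f u) \<le> norm (c * (w u * f u))"
          using that(2)[of u] f0[of u] c w_pos[of u] by (simp add: abs_mult mult.assoc)
      qed
    qed measurable
    have i2: "integrable lborel (\<lambda>u. k u * \<phi> u)"
      if [measurable]: "k \<in> borel_measurable borel" and "\<And>u. 0 \<le> k u" "\<And>u. k u \<le> c * w u" for k
    proof (rule Bochner_Integration.integrable_bound)
      show "integrable lborel (\<lambda>u. c * \<psi> u)" using \<psi>(4) by simp
      show "AE u in lborel. norm (k u * \<phi> u) \<le> norm (c * \<psi> u)"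
      proof (intro AE_I2)
        fix u
        have "k u * \<bar>\<phi> u\<bar> \<le> (c * w u) * \<bar>\<phi> u\<bar>" by (intro mult_right_mono that) auto
        then show "norm (k u * \<phi> u) \<le> norm (c * \<psi> u)"
          using that(2)[of u] c w_pos[of u] unfolding w\<phi>[symmetric] by (simp add: abs_mult mult.assoc)
      qed
    qed measurable
    have swap: "\<bar>(\<integral>u. k u * f u \<partial>lborel) - (\<integral>u. k u * \<phi> u \<partial>lborel)\<bar> \<le> e / 4"
      if k: "k \<in> borel_measurable borel" "\<And>u. 0 \<le> k u" "\<And>u. k u \<le> c * w u" for k
    proof -
      have "(\<integral>u. k u * f u \<partial>lborel) - (\<integral>u. k u * \<phi> u \<partial>lborel) = (\<integral>u. k u * f u - k u * \<phi> u \<partial>lborel)"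
        using i1[OF k] i2[OF k] by simp
      also have "\<bar>\<dots>\<bar> \<le> (\<integral>u. \<bar>k u * f u - k u * \<phi> u\<bar> \<partial>lborel)" by (rule integral_abs_bound)
      also have "\<dots> \<le> (\<integral>u. c * \<bar>w u * f u - \<psi> u\<bar> \<partial>lborel)"
      proof (rule integral_mono)
        fix u
        have "\<bar>k u * f u - k u * \<phi> u\<bar> = k u * \<bar>f u - \<phi> u\<bar>"
          using k(2)[of u] by (simp add: right_diff_distrib[symmetric] abs_mult)
        also have "\<dots> \<le> (c * w u) * \<bar>f u - \<phi> u\<bar>" by (intro mult_right_mono k) auto
        also have "\<dots> = c * \<bar>w u * f u - \<psi> u\<bar>"
          using w_pos[of u] unfolding w\<phi>[symmetric] right_diff_distrib[symmetric] by (simp add: abs_mult)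
        finally show "\<bar>k u * f u - k u * \<phi> u\<bar> \<le> c * \<bar>w u * f u - \<psi> u\<bar>" .
      qed (use i1[OF k] i2[OF k] int \<psi> in \<open>auto simp: w_def\<close>)
      also have "\<dots> \<le> c * d" using \<psi>(5) c by simp
      finally show ?thesis using c by (simp add: d_def)
    qed
    have sub: "(\<integral>u. h (s + t * u) * \<phi> u \<partial>lborel) = (\<integral>y. h y * (\<phi> ((y - s) / t) / t) \<partial>lborel)"
    proof -
      have "(\<integral>y. h y * (\<phi> ((y - s) / t) / t) \<partial>lborel)
         = \<bar>t\<bar> * (\<integral>u. h (s + t * u) * (\<phi> (((s + t * u) - s) / t) / t) \<partial>lborel)"
        using t by (subst lborel_integral_real_affine[of t _ s]) auto
      also have "\<dots> = \<bar>t\<bar> * (\<integral>u. h (s + t * u) * \<phi> u / t \<partial>lborel)"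
        using t by simp
      also have "\<dots> = (\<integral>u. h (s + t * u) * \<phi> u \<partial>lborel)" using t by simp
      finally show ?thesis ..
    qed
    have int_sub: "integrable lborel (\<lambda>y. h y * (\<phi> ((y - s) / t) / t))"
    proof -
      have "integrable lborel (\<lambda>u. h (s + t * u) * (\<phi> u / t))"
        using i2[of "\<lambda>u. h (s + t * u)"] h hst by simp
      then have "integrable lborel (\<lambda>y. h (s + t * (- s / t + (1 / t) * y)) * (\<phi> (- s / t + (1 / t) * y) / t))"
        using t by (intro lborel_integrable_real_affine) auto
      moreover have "s + t * (- s / t + (1 / t) * y) = y" "- s / t + (1 / t) * y = (y - s) / t" for y
        using t by (simp_all add: field_simps)
      ultimately show ?thesis by simp
    qed
    have iB: "integrable lborel (\<lambda>y. (1 + M) powr r * \<eta> * indicator {-M..M} y)"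
      by (intro integrable_mult_right) (simp add: integrable_indicator_iff emeasure_lborel_Icc_eq)
    have "(\<integral>u. h (s + t * u) * \<phi> u \<partial>lborel) - (\<integral>u. h u * \<phi> u \<partial>lborel)
       = (\<integral>y. h y * (\<phi> ((y - s) / t) / t) - h y * \<phi> y \<partial>lborel)"
      unfolding sub using int_sub i2[of h] h hc by simp
    also have "\<dots> \<le> (\<integral>y. (1 + M) powr r * \<eta> * indicator {-M..M} y \<partial>lborel)"
    proof (rule integral_mono)
      fix y :: real
      have "h y * (\<phi> ((y - s) / t) / t - \<phi> y) \<le> (1 + M) powr r * \<eta> * indicator {-M..M} y"
      proof (cases "y \<in> {-M..M}")
        case True
        have "dist (s, t, y) (0, 1, y) \<le> \<bar>s\<bar> + \<bar>t - 1\<bar>"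
          by (simp add: dist_Pair_Pair dist_real_def sqrt_sum_squares_le_sum_abs[of s "t - 1", simplified])
        then have "dist (s, t, y) (0, 1, y) < \<delta>1" using st \<delta> \<delta>1 by linarith
        then have "\<bar>\<phi> ((y - s) / t) / t - \<phi> y\<bar> < \<eta>"
          using uc[of "(0, 1, y)" "(s, t, y)"] True s[THEN abs_le_D1] s[THEN abs_le_D2] t
          by (simp add: dist_real_def)
        moreover have "h y \<le> (1 + M) powr r"
          by (rule order_trans[OF h(2)]) (use True r in \<open>auto intro!: powr_mono2\<close>)
        ultimately have "h y * (\<phi> ((y - s) / t) / t - \<phi> y) \<le> (1 + M) powr r * \<eta>"
          using h(1)[of y] \<eta> by (intro order_trans[OF mult_left_mono[of _ \<eta> "h y"] mult_right_mono]) auto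
        then show ?thesis using True by simp
      next
        case False
        then have y: "M < \<bar>y\<bar>" by (auto simp: abs_if)
        have "N < \<bar>(y - s) / t\<bar>"
        proof -
          have "N * t \<le> N * (3 / 2)" using t \<psi>(2) by (intro mult_left_mono)
          also have "\<dots> < \<bar>y - s\<bar>" using y s \<psi>(2) unfolding M_def by linarith
          finally show ?thesis using t by (simp add: field_simps)
        qed
        then have "\<phi> ((y - s) / t) = 0" by (rule \<phi>0)
        moreover have "\<phi> y = 0" using y \<psi>(2) by (intro \<phi>0) (simp add: M_def)
        ultimately show ?thesis using False by simp
      qed
      then show "h y * (\<phi> ((y - s) / t) / t) - h y * \<phi> y \<le> (1 + M) powr r * \<eta> * indicator {-M..M} y"
        by (simp add: right_diff_distrib)
    qed (use int_sub i2[of h] h hc iB in auto)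
    also have "\<dots> = (1 + M) powr r * \<eta> * (2 * M)" using M by simp
    also have "\<dots> = e / 2" using M M' by (simp add: \<eta>_def)
    finally have "(\<integral>u. h (s + t * u) * \<phi> u \<partial>lborel) - (\<integral>u. h u * \<phi> u \<partial>lborel) \<le> e / 2" .
    moreover have "\<bar>(\<integral>u. h (s + t * u) * f u \<partial>lborel) - (\<integral>u. h (s + t * u) * \<phi> u \<partial>lborel)\<bar> \<le> e / 4"
      by (rule swap) (use h(1) hst in auto)
    moreover have "\<bar>(\<integral>u. h u * f u \<partial>lborel) - (\<integral>u. h u * \<phi> u \<partial>lborel)\<bar> \<le> e / 4"
      by (rule swap) (use h(1) hc in auto)
    ultimately show "(\<integral>u. h (s + t * u) * f u \<partial>lborel) \<le> (\<integral>u. h u * f u \<partial>lborel) + e"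
      by linarith
  qed
qed

section \<open>The minorization condition for the autoregressive chain\<close>

lemma compact_bounded_away:
  assumes h: "loc_bounded_away_from_0_on A h" and K: "compact K" "K \<subseteq> A"
  obtains c where "0 < c" "\<And>x. x \<in> K \<Longrightarrow> c \<le> h x"
proof -
  have "\<forall>x\<in>K. \<exists>\<delta> c. 0 < \<delta> \<and> 0 < c \<and> (\<forall>y\<in>A. dist y x < \<delta> \<longrightarrow> c \<le> h y)"
    using h K(2) unfolding loc_bounded_away_from_0_on_def by blast
  then obtain \<delta> c where dc: "\<And>x. x \<in> K \<Longrightarrow> 0 < \<delta> x" "\<And>x. x \<in> K \<Longrightarrow> 0 < c x"
    "\<And>x y. x \<in> K \<Longrightarrow> y \<in> A \<Longrightarrow> dist y x < \<delta> x \<Longrightarrow> c x \<le> h y"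
    by metis
  have "K \<subseteq> (\<Union>x\<in>K. ball x (\<delta> x))" using dc(1) by auto
  then obtain D where D: "D \<subseteq> K" "finite D" "K \<subseteq> (\<Union>x\<in>D. ball x (\<delta> x))"
    using compactE_image[OF K(1), of K "\<lambda>x. ball x (\<delta> x)"] by auto
  show ?thesis
  proof (rule that[of "Min (insert 1 (c ` D))"])
    show "0 < Min (insert 1 (c ` D))" using D dc(2) by (subst Min_gr_iff) auto
    fix x assume x: "x \<in> K"
    then obtain z where z: "z \<in> D" "dist x z < \<delta> z" using D(3) by (auto simp: dist_commute)
    have "Min (insert 1 (c ` D)) \<le> c z" using D z by (intro Min_le) auto
    also have "\<dots> \<le> h x" using dc(3)[of z x] z D x K by auto
    finally show "Min (insert 1 (c ` D)) \<le> h x" .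
  qed
qed

lemma compact_bounded:
  assumes h: "loc_bounded_on A h" and K: "compact K" "K \<subseteq> A"
  obtains C where "\<And>x. x \<in> K \<Longrightarrow> \<bar>h x\<bar> \<le> C"
proof -
  have "\<forall>x\<in>K. \<exists>\<delta> C. 0 < \<delta> \<and> (\<forall>y\<in>A. dist y x < \<delta> \<longrightarrow> \<bar>h y\<bar> \<le> C)"
    using h K(2) unfolding loc_bounded_on_def by blast
  then obtain \<delta> C where dc: "\<And>x. x \<in> K \<Longrightarrow> 0 < \<delta> x"
    "\<And>x y. x \<in> K \<Longrightarrow> y \<in> A \<Longrightarrow> dist y x < \<delta> x \<Longrightarrow> \<bar>h y\<bar> \<le> C x"
    by metis
  have "K \<subseteq> (\<Union>x\<in>K. ball x (\<delta> x))" using dc(1) by auto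
  then obtain D where D: "D \<subseteq> K" "finite D" "K \<subseteq> (\<Union>x\<in>D. ball x (\<delta> x))"
    using compactE_image[OF K(1), of K "\<lambda>x. ball x (\<delta> x)"] by auto
  show ?thesis
  proof (rule that[of "Max (insert 0 (C ` D))"])
    fix x assume x: "x \<in> K"
    then obtain z where z: "z \<in> D" "dist x z < \<delta> z" using D(3) by (auto simp: dist_commute)
    have "\<bar>h x\<bar> \<le> C z" using dc(2)[of z x] z D x K by auto
    also have "\<dots> \<le> Max (insert 0 (C ` D))" using D z by (intro Max_ge) auto
    finally show "\<bar>h x\<bar> \<le> Max (insert 0 (C ` D))" .
  qed
qed

section \<open>The shift structure of the lagged state vector\<close>

text \<open>The zero-based position of the index \<open>i\<close>, read as an age: after a shift the
  newest value has lag 0 and every older one has its lag raised by 1.\<close>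

definition lag :: "'n::{finite,wellorder} \<Rightarrow> nat" where
  "lag i = card {j. j < i}"

lemma lag_less_card: "lag (i::'n::{finite,wellorder}) < CARD('n)"
  unfolding lag_def by (intro psubset_card_mono) auto

lemma Least_True_le: "(LEAST j::'n::{finite,wellorder}. True) \<le> i"
  by (rule Least_le) simp

lemma not_least:
  assumes "i \<noteq> (LEAST j::'n::{finite,wellorder}. True)"
  shows "Max {j. j < i} < i" "lag i = Suc (lag (Max {j. j < i}))"
proof -
  have ne: "{j. j < i} \<noteq> {}" using assms Least_True_le[of i] by (auto simp: less_le)
  then show lt: "Max {j. j < i} < i" using Max_in[OF _ ne] by auto
  have "{j. j < i} = insert (Max {j. j < i}) {j. j < Max {j. j < i}}"
  proof (intro set_eqI iffI)
    fix j assume "j \<in> {j. j < i}"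
    then have "j \<le> Max {j. j < i}" by (intro Max_ge) auto
    then show "j \<in> insert (Max {j. j < i}) {j. j < Max {j. j < i}}" by auto
  qed (use lt in auto)
  then show "lag i = Suc (lag (Max {j. j < i}))"
    unfolding lag_def by (metis (lifting) card_insert_disjoint finite less_irrefl mem_Collect_eq)
qed

lemma lag_least: "lag (LEAST j::'n::{finite,wellorder}. True) = 0"
  using Least_True_le by (auto simp: lag_def not_less)

lemma lag_strict_mono: "i < j \<Longrightarrow> lag i < lag (j::'n::{finite,wellorder})"
  unfolding lag_def by (intro psubset_card_mono) auto

lemma inj_on_pred: "inj_on (\<lambda>i::'n::{finite,wellorder}. Max {j. j < i}) (- {LEAST j. True})"
proof (rule inj_onI)
  fix i j :: 'n assume "i \<in> - {LEAST j. True}" "j \<in> - {LEAST j. True}" "Max {k. k < i} = Max {k. k < j}"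
  then have "lag i = lag j" by (simp add: not_least(2))
  then show "i = j" using lag_strict_mono[of i j] lag_strict_mono[of j i] by (cases i j rule: linorder_cases) auto
qed

text \<open>Under a shift the old coordinates move along the injective predecessor map and the
  oldest is lost. Both the norm bound and the decay of the penalty rest on this.\<close>

lemma sum_pred_le:
  fixes g :: "'n::{finite,wellorder} \<Rightarrow> real"
  assumes "\<And>i. 0 \<le> g i"
  shows "(\<Sum>i\<in>- {LEAST j. True}. g (Max {j. j < i})) \<le> (\<Sum>i\<in>UNIV. g i)"
proof -
  have "(\<Sum>i\<in>- {LEAST j. True}. g (Max {j. j < i})) = sum g ((\<lambda>i. Max {j. j < i}) ` (- {LEAST j. True}))"
    by (simp add: sum.reindex[OF inj_on_pred])
  also have "\<dots> \<le> sum g UNIV" using assms by (intro sum_mono2) auto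
  finally show ?thesis .
qed

lemma shift_least[simp]: "shift z x $ (LEAST j. True) = z"
  by (simp add: shift_def)

lemma shift_not_least: "i \<noteq> (LEAST j. True) \<Longrightarrow> shift z x $ i = x $ Max {j. j < i}"
  by (simp add: shift_def)

lemma shift_scale: "shift (c * z) (c *\<^sub>R x) = c *\<^sub>R shift z x"
  by (simp add: shift_def vec_eq_iff)

lemma norm_shift_le: "norm (shift z (x::(real, 'n::{finite,wellorder}) vec)) \<le> \<bar>z\<bar> + norm x"
proof (rule power2_le_imp_le)
  let ?l = "LEAST j::'n. True"
  have n2: "(norm v)\<^sup>2 = (\<Sum>i\<in>UNIV. (v $ i)\<^sup>2)" for v :: "(real, 'n) vec"
    by (simp add: norm_vec_def L2_set_def sum_nonneg)
  have "(norm (shift z x))\<^sup>2 = z\<^sup>2 + (\<Sum>i\<in>- {?l}. (shift z x $ i)\<^sup>2)"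
    unfolding n2 by (subst sum.remove[of _ ?l]) (auto simp: Compl_eq_Diff_UNIV)
  also have "\<dots> = z\<^sup>2 + (\<Sum>i\<in>- {?l}. (x $ Max {j. j < i})\<^sup>2)"
    by (intro arg_cong2[where f="(+)"] sum.cong) (auto simp: shift_not_least)
  also have "\<dots> \<le> z\<^sup>2 + (norm x)\<^sup>2"
    unfolding n2 by (intro add_left_mono sum_pred_le) auto
  also have "\<dots> \<le> (\<bar>z\<bar> + norm x)\<^sup>2" by (simp add: power2_sum)
  finally show "(norm (shift z x))\<^sup>2 \<le> (\<bar>z\<bar> + norm x)\<^sup>2" .
qed simp

lemma shift_measurable[measurable (raw)]:
  fixes g :: "'m \<Rightarrow> (real, 'n::{finite,wellorder}) vec"
  assumes [measurable]: "f \<in> borel_measurable M" "g \<in> borel_measurable M"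
  shows "(\<lambda>w. shift (f w) (g w)) \<in> borel_measurable M"
proof -
  have "continuous_on UNIV (\<lambda>p::real \<times> (real, 'n) vec. shift (fst p) (snd p) $ i)" for i
    by (cases "i = (LEAST j. True)") (auto simp: shift_def intro!: continuous_intros)
  then have "continuous_on UNIV (\<lambda>p::real \<times> (real, 'n) vec. \<chi> i. shift (fst p) (snd p) $ i)"
    by (rule continuous_on_vec_lambda)
  then have "continuous_on UNIV (\<lambda>p::real \<times> (real, 'n) vec. shift (fst p) (snd p))" by simp
  from borel_measurable_continuous_on[OF this, of "\<lambda>w. (f w, g w)" M]
  show ?thesis by simp
qed

text \<open>After \<open>n\<close> shifts every coordinate with lag below \<open>n\<close> has been
  written by the input, and all lags are below the dimension. This is what frees the minorizing
  measure from the starting point.\<close>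

lemma chain_shift_forget:
  "chain (\<lambda>x z. shift z x) x \<omega> CARD('n) = chain (\<lambda>x z. shift z x) (y::(real, 'n::{finite,wellorder}) vec) \<omega> CARD('n)"
proof -
  have "lag i < n \<Longrightarrow> chain (\<lambda>x z. shift z x) x \<omega> n $ i = chain (\<lambda>x z. shift z x) y \<omega> n $ i" for n i
  proof (induction n arbitrary: i)
    case (Suc n)
    then show ?case
      by (cases "i = (LEAST j. True)") (auto simp: shift_not_least not_least(2))
  qed simp
  then show ?thesis by (simp add: vec_eq_iff lag_less_card)
qed

section \<open>Noise with a density, and the autoregressive chain driven by it\<close>

locale noise_density =
  fixes f :: "real \<Rightarrow> real"
  assumes f_measurable[measurable]: "f \<in> borel_measurable borel"
    and f_nonneg: "0 \<le> f u"
    and f_density: "(\<integral>\<^sup>+u. ennreal (f u) \<partial>lborel) = 1"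
begin

definition "\<mu> = density lborel (\<lambda>u. ennreal (f u))"

lemma sets_\<mu>[simp, measurable_cong]: "sets \<mu> = sets borel"
  by (simp add: \<mu>_def)

lemma space_\<mu>[simp]: "space \<mu> = UNIV"
  by (simp add: \<mu>_def)

lemma prob_space_\<mu>: "prob_space \<mu>"
  using f_density by (intro prob_spaceI) (simp add: \<mu>_def emeasure_density)

lemma nn_integral_\<mu>:
  "g \<in> borel_measurable borel \<Longrightarrow> (\<integral>\<^sup>+u. g u \<partial>\<mu>) = (\<integral>\<^sup>+u. ennreal (f u) * g u \<partial>lborel)"
  by (simp add: \<mu>_def nn_integral_density)

end

sublocale noise_density \<subseteq> prob_space \<mu> by (rule prob_space_\<mu>)

locale ar_chain = noise_density f for f +
  fixes a b :: "(real, 'n::{finite,wellorder}) vec \<Rightarrow> real"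
  assumes a_measurable[measurable]: "a \<in> borel_measurable borel"
    and b_measurable[measurable]: "b \<in> borel_measurable borel"

sublocale ar_chain \<subseteq> noise_chain \<mu> "ar_step a b"
  by unfold_locales (simp_all add: ar_step_def split_beta')

context ar_chain
begin

text \<open>The new coordinate has density \<open>f ((z - a x) / b x) / b x\<close>. For bounded
  \<open>x\<close> and \<open>z\<close> in \<open>{0..1}\<close> the argument of \<open>f\<close>
  stays in a compact set, so the density is at least \<open>f0 / b1\<close>.\<close>

lemma one_step_minorization:
  assumes f_away: "loc_bounded_away_from_0_on UNIV f" and b_pos: "\<And>x. 0 < b x"
    and b_bdd: "loc_bounded_on UNIV b" and b_away: "loc_bounded_away_from_0_on UNIV b"
    and a_bdd: "\<And>x. norm x \<le> R \<Longrightarrow> \<bar>a x\<bar> \<le> A"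
  obtains \<epsilon> where "0 < \<epsilon>" "\<And>x g. norm x \<le> R \<Longrightarrow> g \<in> borel_measurable borel \<Longrightarrow>
    ennreal \<epsilon> * (\<integral>\<^sup>+z. g (shift z x) \<partial>uniform_measure lborel {0..1}) \<le> (\<integral>\<^sup>+u. g (ar_step a b x u) \<partial>\<mu>)"
proof -
  obtain b0 where b0: "0 < b0" "\<And>x. norm x \<le> R \<Longrightarrow> b0 \<le> b x"
    using compact_bounded_away[OF b_away, of "cball 0 R"] by auto
  obtain B where "\<And>x. norm x \<le> R \<Longrightarrow> \<bar>b x\<bar> \<le> B"
    using compact_bounded[OF b_bdd, of "cball 0 R"] by auto
  then obtain b1 where b1: "0 < b1" "\<And>x. norm x \<le> R \<Longrightarrow> b x \<le> b1"
    by (metis abs_ge_self max.strict_coboundedI2 max.coboundedI1 order_trans zero_less_one)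
  obtain f0 where f0: "0 < f0" "\<And>u. \<bar>u\<bar> \<le> (1 + \<bar>A\<bar>) / b0 \<Longrightarrow> f0 \<le> f u"
    using compact_bounded_away[OF f_away, of "cball 0 ((1 + \<bar>A\<bar>) / b0)"] by auto
  show ?thesis
  proof (rule that[of "f0 / b1"])
    show "0 < f0 / b1" using f0 b1 by simp
    fix x :: "(real, 'n) vec" and g :: "(real, 'n) vec \<Rightarrow> ennreal" assume x: "norm x \<le> R" and [measurable]: "g \<in> borel_measurable borel"
    let ?L = "\<integral>\<^sup>+u. g (ar_step a b x u) \<partial>\<mu>" and ?J = "\<integral>\<^sup>+z. g (shift z x) * indicator {0..1} z \<partial>lborel"
    have bx: "0 < b x" "b0 \<le> b x" "b x \<le> b1" using b0 b1 b_pos x by auto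
    have "ennreal f0 * ?J = (\<integral>\<^sup>+z. ennreal f0 * (g (shift z x) * indicator {0..1} z) \<partial>lborel)"
      by (simp add: nn_integral_cmult)
    also have "\<dots> \<le> (\<integral>\<^sup>+z. ennreal (f ((z - a x) / b x)) * g (shift z x) \<partial>lborel)"
    proof (rule nn_integral_mono)
      fix z
      show "ennreal f0 * (g (shift z x) * indicator {0..1} z) \<le> ennreal (f ((z - a x) / b x)) * g (shift z x)"
      proof (cases "z \<in> {0..1}")
        case True
        have "\<bar>z - a x\<bar> \<le> 1 + \<bar>A\<bar>" using True a_bdd[OF x] by auto
        then have "\<bar>(z - a x) / b x\<bar> \<le> (1 + \<bar>A\<bar>) / b0"
          using bx b0 by (auto simp: abs_divide intro!: frac_le)
        from f0(2)[OF this] show ?thesis using True by (auto intro!: mult_right_mono ennreal_leI)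
      qed simp
    qed
    also have "\<dots> = ennreal (b x) * (\<integral>\<^sup>+u. ennreal (f u) * g (shift (a x + b x * u) x) \<partial>lborel)"
      using bx by (subst nn_integral_real_affine[of _ "b x" "a x"]) auto
    also have "\<dots> = ennreal (b x) * ?L"
      by (simp add: nn_integral_\<mu> ar_step_def)
    also have "\<dots> \<le> ennreal b1 * ?L"
      using bx by (intro mult_right_mono ennreal_leI) auto
    finally have "ennreal (1 / b1) * (ennreal f0 * ?J) \<le> ennreal (1 / b1) * (ennreal b1 * ?L)"
      by (rule mult_left_mono) simp
    also have "\<dots> = ?L" using b1 by (simp add: mult.assoc[symmetric] ennreal_mult[symmetric])
    also have "ennreal (1 / b1) * (ennreal f0 * ?J) = ennreal (f0 / b1) * ?J"
      using b1 f0 by (simp add: mult.assoc[symmetric] ennreal_mult[symmetric])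
    also have "?J = (\<integral>\<^sup>+z. g (shift z x) \<partial>uniform_measure lborel {0..1})"
      by (subst nn_integral_uniform_measure) (auto simp: divide_ennreal_def)
    finally show "ennreal (f0 / b1) * (\<integral>\<^sup>+z. g (shift z x) \<partial>uniform_measure lborel {0..1}) \<le> ?L" .
  qed
qed

text \<open>Iterating the one-step bound compares the chain with one whose new coordinates are
  uniform on \<open>{0..1}\<close>. After as many steps as there are coordinates the latter has
  forgotten its start.\<close>

lemma minorization_bounded_sets:
  assumes f_away: "loc_bounded_away_from_0_on UNIV f" and b_pos: "\<And>x. 0 < b x"
    and b_bdd: "loc_bounded_on UNIV b" and b_away: "loc_bounded_away_from_0_on UNIV b"
    and a_bdd: "\<And>x. \<bar>a x\<bar> \<le> A * (1 + norm x)" and R: "0 \<le> R"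
  shows "\<exists>\<epsilon>>0. \<exists>\<nu>. prob_space \<nu> \<and> sets \<nu> = sets borel \<and>
      (\<forall>x. norm x \<le> R \<longrightarrow> (\<forall>h\<in>borel_measurable borel.
         ennreal \<epsilon> * (\<integral>\<^sup>+y. h y \<partial>\<nu>) \<le> (\<integral>\<^sup>+\<omega>. h (chain (ar_step a b) x \<omega> CARD('n)) \<partial>stream_space \<mu>)))"
proof -
  let ?U = "uniform_measure lborel {0..1::real}"
  let ?G = "\<lambda>(x::(real, 'n) vec) z. shift z x"
  \<comment> \<open>Each uniform step enlarges the norm by at most 1, so the one-step bound must
    hold on this larger ball.\<close>
  define R' where "R' = R + real CARD('n)"
  have "\<bar>a x\<bar> \<le> \<bar>A\<bar> * (1 + R')" if "norm x \<le> R'" for x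
  proof -
    have "A * (1 + norm x) \<le> \<bar>A\<bar> * (1 + R')" using that by (intro mult_mono) auto
    then show ?thesis using a_bdd[of x] by linarith
  qed
  then obtain \<epsilon> where \<epsilon>: "0 < \<epsilon>" and one: "\<And>x g. norm x \<le> R' \<Longrightarrow> g \<in> borel_measurable borel \<Longrightarrow>
      ennreal \<epsilon> * (\<integral>\<^sup>+z. g (shift z x) \<partial>?U) \<le> (\<integral>\<^sup>+u. g (ar_step a b x u) \<partial>\<mu>)"
    using one_step_minorization[OF f_away b_pos b_bdd b_away] by metis
  interpret U: prob_space ?U by (rule prob_space_uniform_measure) auto
  interpret G: noise_chain ?U ?G by unfold_locales (simp_all add: split_beta')
  have iter: "ennreal (\<epsilon> ^ n) * (\<integral>\<^sup>+\<omega>. h (chain ?G x \<omega> n) \<partial>stream_space ?U)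
      \<le> (\<integral>\<^sup>+\<omega>. h (chain (ar_step a b) x \<omega> n) \<partial>S)"
    if [measurable]: "h \<in> borel_measurable borel" and "norm x + real n \<le> R'" for h x n
    using that(2)
  proof (induction n arbitrary: x)
    case 0
    show ?case by (simp add: S.emeasure_space_1 G.S.emeasure_space_1)
  next
    case (Suc n)
    have AE01: "AE z in ?U. z \<in> {0..1}" by (rule AE_uniform_measureI) auto
    have "ennreal (\<epsilon> ^ Suc n) * (\<integral>\<^sup>+\<omega>. h (chain ?G x \<omega> (Suc n)) \<partial>stream_space ?U)
        = ennreal \<epsilon> * (ennreal (\<epsilon> ^ n) * (\<integral>\<^sup>+z. \<integral>\<^sup>+\<omega>. h (chain ?G (shift z x) \<omega> n) \<partial>stream_space ?U \<partial>?U))"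
      using \<epsilon> by (subst G.nn_chain_Suc) (auto simp: ennreal_mult mult.assoc)
    also have "\<dots> = ennreal \<epsilon> * (\<integral>\<^sup>+z. ennreal (\<epsilon> ^ n) * (\<integral>\<^sup>+\<omega>. h (chain ?G (shift z x) \<omega> n) \<partial>stream_space ?U) \<partial>?U)"
      by (subst nn_integral_cmult) auto
    also have "\<dots> \<le> ennreal \<epsilon> * (\<integral>\<^sup>+z. (\<integral>\<^sup>+\<omega>. h (chain (ar_step a b) (shift z x) \<omega> n) \<partial>S) \<partial>?U)"
    proof (intro mult_left_mono nn_integral_mono_AE)
      show "AE z in ?U. ennreal (\<epsilon> ^ n) * (\<integral>\<^sup>+\<omega>. h (chain ?G (shift z x) \<omega> n) \<partial>stream_space ?U)
         \<le> (\<integral>\<^sup>+\<omega>. h (chain (ar_step a b) (shift z x) \<omega> n) \<partial>S)"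
        using AE01
      proof eventually_elim
        case (elim z)
        have "norm (shift z x) \<le> 1 + norm x" using norm_shift_le[of z x] elim by auto
        then show ?case using Suc.prems by (intro Suc.IH) auto
      qed
    qed simp
    also have "\<dots> \<le> (\<integral>\<^sup>+u. (\<integral>\<^sup>+\<omega>. h (chain (ar_step a b) (ar_step a b x u) \<omega> n) \<partial>S) \<partial>\<mu>)"
      using Suc.prems by (intro one) auto
    also have "\<dots> = (\<integral>\<^sup>+\<omega>. h (chain (ar_step a b) x \<omega> (Suc n)) \<partial>S)"
      by (subst nn_chain_Suc) auto
    finally show ?case .
  qed
  let ?p = "CARD('n)"
  let ?\<nu> = "distr (stream_space ?U) borel (\<lambda>\<omega>. chain ?G 0 \<omega> ?p)"
  show ?thesis
  proof (intro exI[of _ "\<epsilon> ^ ?p"] exI[of _ ?\<nu>] conjI allI impI ballI)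
    show "prob_space ?\<nu>" by (rule G.S.prob_space_distr) measurable
    fix x :: "(real, 'n) vec" and h assume x: "norm x \<le> R" and h[measurable]: "h \<in> (borel_measurable borel :: ((real, 'n) vec \<Rightarrow> ennreal) set)"
    have "(\<integral>\<^sup>+y. h y \<partial>?\<nu>) = (\<integral>\<^sup>+\<omega>. h (chain ?G x \<omega> ?p) \<partial>stream_space ?U)"
      using chain_shift_forget[of 0 _ x] by (subst nn_integral_distr) auto
    then show "ennreal (\<epsilon> ^ ?p) * (\<integral>\<^sup>+y. h y \<partial>?\<nu>) \<le> (\<integral>\<^sup>+\<omega>. h (chain (ar_step a b) x \<omega> ?p) \<partial>S)"
      using iter[OF h, of x ?p] x by (simp add: R'_def)
  qed (use \<epsilon> in auto)
qed

end

section \<open>Equivalence of the two conditions on the collapsed chain\<close>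

text \<open>Measurability is inherited from \<open>h\<close>: the extension is the pointwise limit
  of \<open>h\<close> rescaled along the integer radii \<open>k\<close> in each direction.\<close>

lemma star_ext_measurable:
  assumes [measurable]: "(h::(real, 'n::finite) vec \<Rightarrow> real) \<in> borel_measurable borel"
    and lim: "\<And>\<epsilon>. 0 < \<epsilon> \<Longrightarrow> \<exists>W. \<forall>w\<ge>W. \<forall>\<theta>\<in>sphere 0 1. \<bar>h (w *\<^sub>R \<theta>) / w - hs \<theta>\<bar> \<le> \<epsilon>"
  shows "star_ext hs \<in> borel_measurable borel"
proof (rule borel_measurable_LIMSEQ_real)
  let ?s = "\<lambda>k::nat. \<lambda>x. if x = 0 then 0 else h (real k *\<^sub>R (x /\<^sub>R norm x)) / real k * norm x"
  show "?s k \<in> borel_measurable borel" for k by measurable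
  fix x :: "(real, 'n) vec"
  show "(\<lambda>k. ?s k x) \<longlonglongrightarrow> star_ext hs x"
  proof (cases "x = 0")
    case False
    let ?t = "x /\<^sub>R norm x"
    have t: "?t \<in> sphere 0 1" using False by simp
    have "(\<lambda>k. h (real k *\<^sub>R ?t) / real k) \<longlonglongrightarrow> hs ?t"
    proof (rule LIMSEQ_I)
      fix e :: real assume "0 < e"
      then obtain W where W: "\<forall>w\<ge>W. \<forall>\<theta>\<in>sphere 0 1. \<bar>h (w *\<^sub>R \<theta>) / w - hs \<theta>\<bar> \<le> e / 2"
        using lim[of "e / 2"] by auto
      obtain k0 where "W \<le> real k0" using real_arch_simple by blast
      then have "norm (h (real k *\<^sub>R ?t) / real k - hs ?t) < e" if "k0 \<le> k" for k
      proof -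
        have "W \<le> real k" using \<open>W \<le> real k0\<close> that by linarith
        then have "\<bar>h (real k *\<^sub>R ?t) / real k - hs ?t\<bar> \<le> e / 2" using W t by blast
        then show ?thesis using \<open>0 < e\<close> by simp
      qed
      then show "\<exists>k0. \<forall>k\<ge>k0. norm (h (real k *\<^sub>R ?t) / real k - hs ?t) < e" by blast
    qed
    then have "(\<lambda>k. h (real k *\<^sub>R ?t) / real k * norm x) \<longlonglongrightarrow> hs ?t * norm x"
      by (intro tendsto_intros)
    then show ?thesis using False by (simp add: star_ext_def)
  qed (simp add: star_ext_def)
qed

lemma (in noise_density) moment_one_plus:
  assumes "(\<integral>\<^sup>+u. ennreal (\<bar>u\<bar> powr r) \<partial>\<mu>) < \<infinity>" and r: "0 < r"
  shows "(\<integral>\<^sup>+u. ennreal ((1 + \<bar>u\<bar>) powr r) \<partial>\<mu>) < \<infinity>"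
proof -
  have "(\<integral>\<^sup>+u. ennreal ((1 + \<bar>u\<bar>) powr r) \<partial>\<mu>) \<le> (\<integral>\<^sup>+u. ennreal (2 powr r) * (1 + ennreal (\<bar>u\<bar> powr r)) \<partial>\<mu>)"
  proof (rule nn_integral_mono)
    fix u :: real
    have "(1 + \<bar>u\<bar>) powr r \<le> (2 * max 1 \<bar>u\<bar>) powr r" using r by (intro powr_mono2) auto
    also have "\<dots> = 2 powr r * max 1 \<bar>u\<bar> powr r" by (rule powr_mult)
    also have "\<dots> \<le> 2 powr r * (1 + \<bar>u\<bar> powr r)"
      by (intro mult_left_mono) (auto simp: max_def)
    finally show "ennreal ((1 + \<bar>u\<bar>) powr r) \<le> ennreal (2 powr r) * (1 + ennreal (\<bar>u\<bar> powr r))"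
      by (simp add: ennreal_mult[symmetric] ennreal_plus[symmetric] ennreal_leI del: ennreal_plus flip: ennreal_1)
  qed
  also have "\<dots> = ennreal (2 powr r) * (1 + (\<integral>\<^sup>+u. ennreal (\<bar>u\<bar> powr r) \<partial>\<mu>))"
    using emeasure_space_1 by (simp add: nn_integral_cmult nn_integral_add)
  also have "\<dots> < \<infinity>" using assms(1) by (simp add: ennreal_mult_less_top)
  finally show ?thesis .
qed

locale collapsed_chain = noise_density f for f +
  fixes as bs :: "(real, 'n::{finite,wellorder}) vec \<Rightarrow> real" and r C :: real
  assumes as_measurable[measurable]: "star_ext as \<in> borel_measurable borel"
    and bs_measurable[measurable]: "star_ext bs \<in> borel_measurable borel"
    and bounded_on_sphere: "\<theta> \<in> sphere 0 1 \<Longrightarrow> \<bar>as \<theta>\<bar> \<le> C \<and> \<bar>bs \<theta>\<bar> \<le> C"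
    and r_pos: "0 < r" and moment: "(\<integral>\<^sup>+u. ennreal (\<bar>u\<bar> powr r) \<partial>\<mu>) < \<infinity>"
begin

lemma wfun_measurable[measurable (raw)]:
  assumes [measurable]: "g \<in> N \<rightarrow>\<^sub>M borel" "h \<in> N \<rightarrow>\<^sub>M borel"
  shows "(\<lambda>w. wfun as bs (g w) (h w)) \<in> borel_measurable N"
  unfolding wfun_def zfun_def by measurable

lemma collapsed_step_measurable[measurable (raw)]:
  assumes [measurable]: "g \<in> N \<rightarrow>\<^sub>M borel" "h \<in> N \<rightarrow>\<^sub>M borel"
  shows "(\<lambda>w. collapsed_step as bs (g w) (h w)) \<in> borel_measurable N"
  unfolding collapsed_step_def zfun_def by measurable

end

sublocale collapsed_chain \<subseteq> noise_chain \<mu> "collapsed_step as bs"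
  by unfold_locales (simp_all add: split_beta')

context collapsed_chain
begin

lemma C_nonneg: "0 \<le> C"
proof -
  have "axis (LEAST j. True) 1 \<in> sphere (0::(real, 'n) vec) 1" by simp
  from bounded_on_sphere[OF this] show ?thesis by linarith
qed

lemma star_ext_sphere: "\<theta> \<in> sphere 0 1 \<Longrightarrow> star_ext h \<theta> = h \<theta>" for h :: "(real, 'n) vec \<Rightarrow> real"
  by (auto simp: star_ext_def)

text \<open>The image vector may be 0, and then the step yields 0 rather than a unit vector. This is
  harmless because every later use carries the factor \<open>wfun as bs x u powr r\<close>, which
  vanishes in that case.\<close>

lemma collapsed_step_cases:
  obtains "wfun as bs x u = 0" "collapsed_step as bs x u = 0"
  | "0 < wfun as bs x u" "collapsed_step as bs x u \<in> sphere 0 1"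
  by (cases "wfun as bs x u = 0") (auto simp: collapsed_step_def wfun_def)

lemma wfun_le:
  assumes "\<theta> \<in> sphere 0 1"
  shows "wfun as bs \<theta> u \<le> (C + 1) * (1 + \<bar>u\<bar>)"
proof -
  have b: "\<bar>as \<theta>\<bar> \<le> C" "\<bar>bs \<theta>\<bar> \<le> C" using bounded_on_sphere[OF assms] by auto
  have "wfun as bs \<theta> u \<le> \<bar>as \<theta> + bs \<theta> * u\<bar> + 1"
    using norm_shift_le[of "zfun as bs \<theta> u" \<theta>] assms by (simp add: wfun_def zfun_def star_ext_sphere)
  also have "\<dots> \<le> \<bar>as \<theta>\<bar> + \<bar>bs \<theta>\<bar> * \<bar>u\<bar> + 1"
    using abs_triangle_ineq[of "as \<theta>" "bs \<theta> * u"] by (simp add: abs_mult)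
  also have "\<dots> \<le> C + C * \<bar>u\<bar> + 1" using b by (intro add_mono mult_right_mono) auto
  finally show ?thesis using C_nonneg by (simp add: algebra_simps)
qed

definition wr :: "(real, 'n) vec \<Rightarrow> real \<Rightarrow> ennreal" where
  "wr x u = ennreal (wfun as bs x u powr r)"

definition D :: real where
  "D = enn2real (\<integral>\<^sup>+u. ennreal (((C + 1) * (1 + \<bar>u\<bar>)) powr r) \<partial>\<mu>)"

lemma wr_measurable[measurable (raw)]:
  assumes [measurable]: "g \<in> N \<rightarrow>\<^sub>M borel" "h \<in> N \<rightarrow>\<^sub>M borel"
  shows "(\<lambda>w. wr (g w) (h w)) \<in> borel_measurable N"
  unfolding wr_def by measurable

lemma wr_integral_le: "\<theta> \<in> sphere 0 1 \<Longrightarrow> (\<integral>\<^sup>+u. wr \<theta> u \<partial>\<mu>) \<le> ennreal D"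
proof -
  assume \<theta>: "\<theta> \<in> sphere 0 1"
  have "(\<integral>\<^sup>+u. ennreal (((C + 1) * (1 + \<bar>u\<bar>)) powr r) \<partial>\<mu>)
      = ennreal ((C + 1) powr r) * (\<integral>\<^sup>+u. ennreal ((1 + \<bar>u\<bar>) powr r) \<partial>\<mu>)"
    by (simp add: powr_mult ennreal_mult nn_integral_cmult)
  also have "\<dots> < \<infinity>"
    using moment_one_plus[OF moment r_pos] by (simp add: ennreal_mult_less_top)
  finally have "ennreal D = (\<integral>\<^sup>+u. ennreal (((C + 1) * (1 + \<bar>u\<bar>)) powr r) \<partial>\<mu>)"
    by (simp add: D_def)
  then show ?thesis
    using wfun_le[OF \<theta>] r_pos
    by (auto simp: wr_def wfun_def intro!: nn_integral_mono ennreal_leI powr_mono2)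
qed

definition wprod :: "nat \<Rightarrow> (real, 'n) vec \<Rightarrow> ennreal" where
  "wprod n x = (\<integral>\<^sup>+\<omega>. (\<Prod>t<n. wr (chain (collapsed_step as bs) x \<omega> t) (\<omega> !! t)) \<partial>S)"

lemma wprod_measurable[measurable]: "wprod n \<in> borel_measurable borel"
  unfolding wprod_def by measurable

lemma wprod_0[simp]: "wprod 0 x = 1"
  by (simp add: wprod_def S.emeasure_space_1)

text \<open>Conditioning on the first step: \<open>wprod n\<close> is the \<open>n\<close>-th
  iterate, started at the constant 1, of the operator that multiplies by the weight and moves by the
  collapsed chain.\<close>

lemma wprod_Suc: "wprod (Suc n) x = (\<integral>\<^sup>+u. wr x u * wprod n (collapsed_step as bs x u) \<partial>\<mu>)"
proof -
  have "wprod (Suc n) x = (\<integral>\<^sup>+u. \<integral>\<^sup>+\<omega>. (\<Prod>t<Suc n. wr (chain (collapsed_step as bs) x (u ## \<omega>) t) ((u ## \<omega>) !! t)) \<partial>S \<partial>\<mu>)"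
    unfolding wprod_def by (rule nn_integral_stream_space) measurable
  also have "\<dots> = (\<integral>\<^sup>+u. \<integral>\<^sup>+\<omega>. wr x u * (\<Prod>t<n. wr (chain (collapsed_step as bs) (collapsed_step as bs x u) \<omega> t) (\<omega> !! t)) \<partial>S \<partial>\<mu>)"
    by (simp only: prod.lessThan_Suc_shift chain_Stream chain.simps(1) snth.simps stream.sel)
  finally show ?thesis unfolding wprod_def by (simp add: nn_integral_cmult)
qed

text \<open>Comparing \<open>g\<close> and \<open>h\<close> on the sphere is enough, since the only
  value of the step off the sphere is 0 and the weight vanishes there.\<close>

lemma wr_mult_mono:
  assumes "\<And>\<theta>. \<theta> \<in> sphere 0 1 \<Longrightarrow> g \<theta> \<le> h \<theta>"
  shows "wr x u * g (collapsed_step as bs x u) \<le> wr x u * h (collapsed_step as bs x u)"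
proof (cases rule: collapsed_step_cases[of x u])
  case 1
  then show ?thesis by (simp add: wr_def)
qed (use assms in \<open>auto intro!: mult_left_mono\<close>)

lemma wprod_le_power: "\<theta> \<in> sphere 0 1 \<Longrightarrow> wprod n \<theta> \<le> ennreal (D ^ n)"
proof (induction n arbitrary: \<theta>)
  case (Suc n)
  have "wprod (Suc n) \<theta> \<le> (\<integral>\<^sup>+u. wr \<theta> u * ennreal (D ^ n) \<partial>\<mu>)"
    unfolding wprod_Suc
    by (intro nn_integral_mono wr_mult_mono[of "wprod n" "\<lambda>_. ennreal (D ^ n)"] Suc.IH)
  also have "\<dots> = (\<integral>\<^sup>+u. wr \<theta> u \<partial>\<mu>) * ennreal (D ^ n)" by (simp add: nn_integral_multc)
  also have "\<dots> \<le> ennreal D * ennreal (D ^ n)" by (intro mult_right_mono wr_integral_le Suc.prems) simp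
  finally show ?case by (simp add: ennreal_mult D_def)
qed simp

abbreviation Q :: "((real, 'n) vec \<Rightarrow> real) \<Rightarrow> (real, 'n) vec \<Rightarrow> ennreal" where
  "Q g \<theta> \<equiv> \<integral>\<^sup>+u. wr \<theta> u * ennreal (g (collapsed_step as bs \<theta> u)) \<partial>\<mu>"

definition cond_one where
  "cond_one \<longleftrightarrow> (\<exists>lam::(real, 'n) vec \<Rightarrow> real. lam \<in> borel_measurable borel \<and>
     (\<exists>c>0. \<exists>C. \<forall>\<theta>\<in>sphere 0 1. c \<le> lam \<theta> \<and> lam \<theta> \<le> C) \<and>
     (SUP \<theta>\<in>sphere 0 1. \<integral>\<^sup>+u. ennreal (lam (collapsed_step as bs \<theta> u) / lam \<theta>
        * wfun as bs \<theta> u powr r) \<partial>\<mu>) < 1)"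

definition cond_two where
  "cond_two \<longleftrightarrow> limsup (\<lambda>n. enn_root n (SUP \<theta>\<in>sphere 0 1. wprod n \<theta>)) < 1"

text \<open>Off the sphere the sign of \<open>lam\<close> is unknown and \<open>ennreal\<close>
  would truncate, but there both sides are 0. So the ratio in condition (i) may be read as an
  inequality for \<open>Q\<close>.\<close>

lemma cond_one_quotient:
  assumes "0 < lam \<theta>" and pos: "\<And>\<theta>. \<theta> \<in> sphere 0 1 \<Longrightarrow> 0 < lam \<theta>"
  shows "ennreal (lam (collapsed_step as bs \<theta> u) / lam \<theta> * wfun as bs \<theta> u powr r)
    = ennreal (1 / lam \<theta>) * (wr \<theta> u * ennreal (lam (collapsed_step as bs \<theta> u)))"
proof (cases rule: collapsed_step_cases[of \<theta> u])
  case 1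
  then show ?thesis by (simp add: wr_def)
next
  case 2
  then have "0 < lam (collapsed_step as bs \<theta> u)" using pos by blast
  then show ?thesis using assms(1) by (simp add: wr_def ennreal_mult[symmetric] mult.commute)
qed

lemma cond_one_weight:
  assumes cond_one
  obtains lam c C' \<rho> where "lam \<in> borel_measurable borel" "0 < c"
    "\<And>\<theta>. \<theta> \<in> sphere 0 1 \<Longrightarrow> c \<le> lam \<theta> \<and> lam \<theta> \<le> C'" "0 \<le> \<rho>" "\<rho> < 1"
    "\<And>\<theta>. \<theta> \<in> sphere 0 1 \<Longrightarrow>
       Q lam \<theta> \<le> ennreal (\<rho> * lam \<theta>)"
proof -
  obtain lam c C' where lam[measurable]: "lam \<in> borel_measurable borel" and c: "0 < c"
    and lc: "\<And>\<theta>. \<theta> \<in> sphere 0 1 \<Longrightarrow> c \<le> lam \<theta> \<and> lam \<theta> \<le> C'"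
    and SUP1: "(SUP \<theta>\<in>sphere 0 1. \<integral>\<^sup>+u. ennreal (lam (collapsed_step as bs \<theta> u) / lam \<theta>
        * wfun as bs \<theta> u powr r) \<partial>\<mu>) < 1" (is "?S < 1")
    using assms unfolding cond_one_def by blast
  define \<rho> where "\<rho> = enn2real ?S"
  have "?S < top" using SUP1 by (rule less_trans) simp
  then have S\<rho>: "?S = ennreal \<rho>" by (simp add: \<rho>_def)
  have pos: "0 < lam \<theta>" if "\<theta> \<in> sphere 0 1" for \<theta> using lc[OF that] c by linarith
  show ?thesis
  proof (rule that[OF lam c lc])
    show "0 \<le> \<rho>" by (simp add: \<rho>_def)
    show "\<rho> < 1" using SUP1 unfolding S\<rho> by (simp add: ennreal_less_one_iff)
    fix \<theta> :: "(real, 'n) vec" assume \<theta>: "\<theta> \<in> sphere 0 1"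
    have "ennreal (1 / lam \<theta>) * Q lam \<theta>
      = (\<integral>\<^sup>+u. ennreal (1 / lam \<theta>) * (wr \<theta> u * ennreal (lam (collapsed_step as bs \<theta> u))) \<partial>\<mu>)"
      by (simp add: nn_integral_cmult)
    also have "\<dots> = (\<integral>\<^sup>+u. ennreal (lam (collapsed_step as bs \<theta> u) / lam \<theta> * wfun as bs \<theta> u powr r) \<partial>\<mu>)"
      using cond_one_quotient[of lam \<theta>, OF pos[OF \<theta>] pos] by simp
    also have "\<dots> \<le> ennreal \<rho>" unfolding S\<rho>[symmetric] using \<theta> by (rule SUP_upper)
    finally have "ennreal (lam \<theta>) * (ennreal (1 / lam \<theta>) * Q lam \<theta>)
      \<le> ennreal (lam \<theta>) * ennreal \<rho>" by (rule mult_left_mono) simp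
    then show "Q lam \<theta> \<le> ennreal (\<rho> * lam \<theta>)"
      using pos[OF \<theta>] \<open>0 \<le> \<rho>\<close> by (simp add: mult.assoc[symmetric] ennreal_mult[symmetric] mult.commute[of \<rho>])
  qed
qed

lemma enn_root_le: "x \<le> ennreal y \<Longrightarrow> 0 < n \<Longrightarrow> 0 \<le> y \<Longrightarrow> enn_root n x \<le> ennreal (root n y)"
  by (auto simp: enn_root_def top_unique intro!: ennreal_leI real_root_le_mono enn2real_leI)

lemma cond_one_imp_cond_two:
  assumes cond_one
  shows cond_two
proof -
  obtain lam c C' \<rho> where [measurable]: "lam \<in> borel_measurable borel" and c: "0 < c"
    and lc: "\<And>\<theta>. \<theta> \<in> sphere 0 1 \<Longrightarrow> c \<le> lam \<theta> \<and> lam \<theta> \<le> C'" and \<rho>: "0 \<le> \<rho>" "\<rho> < 1"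
    and contr: "\<And>\<theta>. \<theta> \<in> sphere 0 1 \<Longrightarrow>
       Q lam \<theta> \<le> ennreal (\<rho> * lam \<theta>)"
    using cond_one_weight[OF assms] by blast
  have it: "wprod n \<theta> \<le> ennreal (\<rho> ^ n / c * lam \<theta>)" if "\<theta> \<in> sphere 0 1" for n \<theta>
    using that
  proof (induction n arbitrary: \<theta>)
    case 0
    then show ?case using c lc[OF 0] by (simp add: ennreal_leI flip: ennreal_1)
  next
    case (Suc n)
    have "wprod (Suc n) \<theta> \<le> (\<integral>\<^sup>+u. wr \<theta> u * ennreal (\<rho> ^ n / c * lam (collapsed_step as bs \<theta> u)) \<partial>\<mu>)"
      unfolding wprod_Suc
      by (intro nn_integral_mono wr_mult_mono[of "wprod n" "\<lambda>\<theta>. ennreal (\<rho> ^ n / c * lam \<theta>)"] Suc.IH)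
    also have "\<dots> = (\<integral>\<^sup>+u. ennreal (\<rho> ^ n / c) * (wr \<theta> u * ennreal (lam (collapsed_step as bs \<theta> u))) \<partial>\<mu>)"
      using \<rho> c by (intro nn_integral_cong) (subst ennreal_mult', auto simp: mult.left_commute)
    also have "\<dots> = ennreal (\<rho> ^ n / c) * Q lam \<theta>"
      by (simp add: nn_integral_cmult)
    also have "\<dots> \<le> ennreal (\<rho> ^ n / c) * ennreal (\<rho> * lam \<theta>)"
      by (intro mult_left_mono contr Suc.prems) simp
    also have "\<dots> = ennreal (\<rho> ^ Suc n / c * lam \<theta>)"
      using \<rho> c by (subst ennreal_mult'[symmetric]) (auto simp: mult.commute mult.left_commute)
    finally show ?case .
  qed
  \<comment> \<open>A positive constant, so that \<open>root n k\<close> tends to 1 and only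
    \<open>\<rho>\<close> survives in the upper limit.\<close>
  define k where "k = max 1 (C' / c)"
  have k: "0 < k" "C' / c \<le> k" by (auto simp: k_def)
  have S: "(SUP \<theta>\<in>sphere 0 1. wprod n \<theta>) \<le> ennreal (k * \<rho> ^ n)" for n
  proof (rule SUP_least)
    fix \<theta> :: "(real, 'n) vec" assume \<theta>: "\<theta> \<in> sphere 0 1"
    have "\<rho> ^ n / c * lam \<theta> = (lam \<theta> / c) * \<rho> ^ n" by simp
    also have "\<dots> \<le> k * \<rho> ^ n"
    proof (rule mult_right_mono)
      have "lam \<theta> / c \<le> C' / c" using lc[OF \<theta>] c by (intro divide_right_mono) auto
      then show "lam \<theta> / c \<le> k" using k by linarith
    qed (use \<rho> in simp)
    finally show "wprod n \<theta> \<le> ennreal (k * \<rho> ^ n)"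
      using it[OF \<theta>, of n] by (meson ennreal_leI order_trans)
  qed
  have "limsup (\<lambda>n. enn_root n (SUP \<theta>\<in>sphere 0 1. wprod n \<theta>)) \<le> limsup (\<lambda>n. ennreal (root n k * \<rho>))"
  proof (rule Limsup_mono)
    show "\<forall>\<^sub>F n in sequentially. enn_root n (SUP \<theta>\<in>sphere 0 1. wprod n \<theta>) \<le> ennreal (root n k * \<rho>)"
      using eventually_gt_at_top[of 0]
    proof eventually_elim
      case (elim n)
      have "root n (k * \<rho> ^ n) = root n k * \<rho>"
        using \<rho> elim by (simp add: real_root_mult real_root_power_cancel)
      then show ?case using enn_root_le[OF S[of n] elim] k \<rho> by simp
    qed
  qed
  also have "\<dots> = ennreal (1 * \<rho>)"
    by (intro lim_imp_Limsup tendsto_ennrealI tendsto_mult LIMSEQ_root_const k tendsto_const) simp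
  also have "\<dots> < 1" using \<rho> by (simp add: ennreal_less_one_iff)
  finally show ?thesis unfolding cond_two_def .
qed

text \<open>The weight \<open>\<Sum>k<N. \<rho>\<^sup>-\<^sup>k \<Pi>\<^sub>k\<close> telescopes under one step because \<open>\<Pi>\<^sub>N \<le> \<rho>\<^sup>N\<close>.\<close>
lemma cond_two_imp_cond_one:
  assumes cond_two
  shows cond_one
proof -
  define sq where "sq n = (SUP \<theta>\<in>sphere (0::(real, 'n) vec) 1. wprod n \<theta>)" for n
  obtain \<rho>0 where \<rho>0: "limsup (\<lambda>n. enn_root n (sq n)) < \<rho>0" "\<rho>0 < 1"
    using assms dense unfolding cond_two_def sq_def by blast
  define \<rho> where "\<rho> = enn2real \<rho>0"
  have \<rho>e: "\<rho>0 = ennreal \<rho>" using less_trans[OF \<rho>0(2) ennreal_one_less_top] by (simp add: \<rho>_def)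
  have \<rho>: "0 < \<rho>" "\<rho> < 1"
  proof -
    have "0 < \<rho>0" using \<rho>0(1) by (metis not_gr_zero not_less_zero)
    then show "0 < \<rho>" unfolding \<rho>e by simp
    show "\<rho> < 1" using \<rho>0(2) unfolding \<rho>e by (simp add: ennreal_less_one_iff \<rho>_def)
  qed
  have "\<forall>\<^sub>F n in sequentially. enn_root n (sq n) < ennreal \<rho>"
    using Limsup_lessD[OF \<rho>0(1)] unfolding \<rho>e .
  then obtain N0 where N0: "\<And>n. N0 \<le> n \<Longrightarrow> enn_root n (sq n) < ennreal \<rho>"
    by (auto simp: eventually_sequentially)
  \<comment> \<open>The successor makes \<open>N\<close> positive: \<open>root 0\<close> is
    constantly 0, and the weight needs its summand for \<open>k = 0\<close>, which equals 1 and
    bounds it from below.\<close>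
  define N where "N = Suc N0"
  have "enn_root N (sq N) < ennreal \<rho>" by (rule N0) (simp add: N_def)
  then have sqN: "sq N \<noteq> top" "root N (enn2real (sq N)) < \<rho>"
    by (auto simp: enn_root_def ennreal_less_iff real_root_ge_zero split: if_splits)
  have "enn2real (sq N) = root N (enn2real (sq N)) ^ N"
    by (rule real_root_pow_pos2[symmetric]) (simp_all add: N_def)
  also have "\<dots> \<le> \<rho> ^ N" using sqN(2) by (intro power_mono) (auto intro: real_root_ge_zero)
  finally have sqN': "sq N \<le> ennreal (\<rho> ^ N)"
    using sqN(1) by (metis ennreal_enn2real ennreal_leI less_top)
  define p where "p k \<theta> = enn2real (wprod k \<theta>)" for k \<theta>
  have wp: "wprod k \<theta> = ennreal (p k \<theta>)" if "\<theta> \<in> sphere 0 1" for k \<theta>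
    using le_less_trans[OF wprod_le_power[OF that, of k] ennreal_less_top] by (simp add: p_def)
  have p_nonneg: "0 \<le> p k \<theta>" for k \<theta> by (simp add: p_def)
  have D: "0 \<le> D" by (simp add: D_def)
  have p_le: "p k \<theta> \<le> D ^ k" if "\<theta> \<in> sphere 0 1" for k \<theta>
    using wprod_le_power[OF that, of k] D unfolding wp[OF that] by (subst (asm) ennreal_le_iff) auto
  have pN: "p N \<theta> \<le> \<rho> ^ N" if "\<theta> \<in> sphere 0 1" for \<theta>
  proof -
    have "ennreal (p N \<theta>) \<le> sq N" unfolding sq_def wp[OF that, symmetric] using that by (rule SUP_upper)
    then show ?thesis using sqN' \<rho> by (meson ennreal_le_iff order_trans zero_le_power less_imp_le)
  qed
  have [measurable]: "p k \<in> borel_measurable borel" for k unfolding p_def by measurable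
  define lam where "lam \<theta> = (\<Sum>k<N. p k \<theta> / \<rho> ^ k)" for \<theta>
  have [measurable]: "lam \<in> borel_measurable borel" unfolding lam_def by measurable
  have lam1: "1 \<le> lam \<theta>" if "\<theta> \<in> sphere 0 1" for \<theta>
  proof -
    have "p 0 \<theta> / \<rho> ^ 0 \<le> lam \<theta>"
      unfolding lam_def using p_nonneg \<rho> by (intro member_le_sum) (auto simp: N_def)
    then show ?thesis by (simp add: p_def)
  qed
  have lam2: "lam \<theta> \<le> (\<Sum>k<N. D ^ k / \<rho> ^ k)" if "\<theta> \<in> sphere 0 1" for \<theta>
    unfolding lam_def using p_le[OF that] \<rho> by (intro sum_mono divide_right_mono) auto
  have step: "Q lam \<theta> \<le> ennreal (\<rho> * lam \<theta>)"
    if \<theta>: "\<theta> \<in> sphere 0 1" for \<theta>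
  proof -
    have "Q lam \<theta>
      \<le> (\<integral>\<^sup>+u. wr \<theta> u * (\<Sum>k<N. ennreal (1 / \<rho> ^ k) * wprod k (collapsed_step as bs \<theta> u)) \<partial>\<mu>)"
    proof (intro nn_integral_mono wr_mult_mono[of "\<lambda>\<theta>. ennreal (lam \<theta>)" "\<lambda>\<theta>. \<Sum>k<N. ennreal (1 / \<rho> ^ k) * wprod k \<theta>"])
      fix \<theta> :: "(real, 'n) vec" assume \<theta>: "\<theta> \<in> sphere 0 1"
      have "ennreal (lam \<theta>) = (\<Sum>k<N. ennreal (p k \<theta> / \<rho> ^ k))"
        unfolding lam_def using p_nonneg \<rho> by (intro sum_ennreal[symmetric]) auto
      also have "\<dots> = (\<Sum>k<N. ennreal (1 / \<rho> ^ k) * wprod k \<theta>)"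
        unfolding wp[OF \<theta>] using p_nonneg \<rho> by (intro sum.cong) (auto simp: ennreal_mult[symmetric])
      finally show "ennreal (lam \<theta>) \<le> (\<Sum>k<N. ennreal (1 / \<rho> ^ k) * wprod k \<theta>)" by simp
    qed
    also have "\<dots> = (\<Sum>k<N. \<integral>\<^sup>+u. ennreal (1 / \<rho> ^ k) * (wr \<theta> u * wprod k (collapsed_step as bs \<theta> u)) \<partial>\<mu>)"
      by (subst nn_integral_sum[symmetric]) (auto simp: sum_distrib_left mult.left_commute)
    also have "\<dots> = (\<Sum>k<N. ennreal (1 / \<rho> ^ k) * wprod (Suc k) \<theta>)"
      by (simp add: nn_integral_cmult wprod_Suc)
    also have "\<dots> = (\<Sum>k<N. ennreal (\<rho> * (p (Suc k) \<theta> / \<rho> ^ Suc k)))"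
      unfolding wp[OF \<theta>] using p_nonneg \<rho> by (intro sum.cong) (auto simp: ennreal_mult[symmetric])
    also have "\<dots> = ennreal (\<rho> * (\<Sum>k<N. p (Suc k) \<theta> / \<rho> ^ Suc k))"
      unfolding sum_distrib_left using p_nonneg \<rho> by (intro sum_ennreal) auto
    also have "\<dots> \<le> ennreal (\<rho> * lam \<theta>)"
    proof (intro ennreal_leI mult_left_mono)
      have "p 0 \<theta> / \<rho> ^ 0 + (\<Sum>k<N. p (Suc k) \<theta> / \<rho> ^ Suc k) = (\<Sum>k<Suc N. p k \<theta> / \<rho> ^ k)"
        by (simp only: sum.lessThan_Suc_shift)
      also have "\<dots> = lam \<theta> + p N \<theta> / \<rho> ^ N" by (simp add: lam_def)
      also have "\<dots> \<le> lam \<theta> + 1" using pN[OF \<theta>] \<rho> by simp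
      finally show "(\<Sum>k<N. p (Suc k) \<theta> / \<rho> ^ Suc k) \<le> lam \<theta>" by (simp add: p_def)
    qed (use \<rho> in simp)
    finally show ?thesis .
  qed
  show ?thesis unfolding cond_one_def
  proof (intro exI[of _ lam] conjI)
    show "\<exists>c>0. \<exists>C. \<forall>\<theta>\<in>sphere 0 1. c \<le> lam \<theta> \<and> lam \<theta> \<le> C"
      using lam1 lam2 zero_less_one by blast
    have "(SUP \<theta>\<in>sphere 0 1. \<integral>\<^sup>+u. ennreal (lam (collapsed_step as bs \<theta> u) / lam \<theta> * wfun as bs \<theta> u powr r) \<partial>\<mu>) \<le> ennreal \<rho>"
    proof (rule SUP_least)
      fix \<theta> :: "(real, 'n) vec" assume \<theta>: "\<theta> \<in> sphere 0 1"
      have pos: "0 < lam \<theta>" if "\<theta> \<in> sphere 0 1" for \<theta> using lam1[OF that] by linarith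
      have "(\<integral>\<^sup>+u. ennreal (lam (collapsed_step as bs \<theta> u) / lam \<theta> * wfun as bs \<theta> u powr r) \<partial>\<mu>)
        = ennreal (1 / lam \<theta>) * Q lam \<theta>"
        using cond_one_quotient[of lam \<theta>, OF pos[OF \<theta>] pos] by (simp add: nn_integral_cmult)
      also have "\<dots> \<le> ennreal (1 / lam \<theta>) * ennreal (\<rho> * lam \<theta>)"
        by (intro mult_left_mono step \<theta>) simp
      also have "\<dots> = ennreal \<rho>" using pos[OF \<theta>] \<rho> by (simp add: ennreal_mult[symmetric])
      finally show "(\<integral>\<^sup>+u. ennreal (lam (collapsed_step as bs \<theta> u) / lam \<theta> * wfun as bs \<theta> u powr r) \<partial>\<mu>) \<le> ennreal \<rho>" .
    qed
    also have "\<dots> < 1" using \<rho> by (simp add: ennreal_less_one_iff)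
    finally show "(SUP \<theta>\<in>sphere 0 1. \<integral>\<^sup>+u. ennreal (lam (collapsed_step as bs \<theta> u) / lam \<theta> * wfun as bs \<theta> u powr r) \<partial>\<mu>) < 1" .
  qed measurable
qed

end

section \<open>One-step contraction of the homogeneous weight\<close>

text \<open>The event is an interval of length at most \<open>2 * s / \<beta>\<close>, on which
  \<open>f \<le> 2 * \<beta> * B / m\<close>, so \<open>\<beta>\<close> cancels. If
  \<open>\<beta>\<close> is at least \<open>m\<close>, boundedness of \<open>f\<close> gives this.
  If \<open>\<bar>\<alpha>\<bar>\<close> is, a small value of \<open>\<alpha> + \<beta> * u\<close>
  forces \<open>\<bar>u\<bar> \<ge> m / (2 * \<beta>)\<close>, and the decay of \<open>f\<close>
  gives it.\<close>

lemma (in noise_density) small_ball: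
  assumes f_bdd: "\<And>u. (1 + \<bar>u\<bar>) * f u \<le> B" and \<beta>: "0 < \<beta>" and m: "0 < m" "m \<le> max \<bar>\<alpha>\<bar> \<beta>"
    and s: "0 \<le> s" "s \<le> m / 2"
  shows "emeasure \<mu> {u. \<bar>\<alpha> + \<beta> * u\<bar> < s} \<le> ennreal (4 * B * s / m)"
proof -
  let ?c = "- \<alpha> / \<beta>"
  have B: "0 \<le> B" using f_bdd[of 0] f_nonneg[of 0] by simp
  have f_le: "f u \<le> 2 * \<beta> * B / m" if u: "\<bar>\<alpha> + \<beta> * u\<bar> < s" for u
  proof (cases "m \<le> \<beta>")
    case True
    have "f u \<le> (1 + \<bar>u\<bar>) * f u" using f_nonneg[of u] by (simp add: algebra_simps)
    also have "\<dots> \<le> 1 * B" using f_bdd by simp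
    also have "\<dots> \<le> (2 * \<beta> / m) * B"
      using True m B by (intro mult_right_mono) (auto simp: field_simps)
    finally show ?thesis by simp
  next
    case False
    then have "m \<le> \<bar>\<alpha>\<bar>" using m by auto
    then have "m / 2 \<le> \<bar>\<beta> * u\<bar>" using u s by linarith
    then have "m / (2 * \<beta>) \<le> 1 + \<bar>u\<bar>" using \<beta> by (simp add: abs_mult field_simps)
    then have "m / (2 * \<beta>) * f u \<le> B"
      using f_bdd[of u] mult_right_mono[OF _ f_nonneg[of u]] by (meson order_trans)
    then show ?thesis using m \<beta> by (simp add: field_simps)
  qed
  have "emeasure \<mu> {u. \<bar>\<alpha> + \<beta> * u\<bar> < s} = (\<integral>\<^sup>+u. ennreal (f u) * indicator {u. \<bar>\<alpha> + \<beta> * u\<bar> < s} u \<partial>lborel)"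
    unfolding \<mu>_def by (rule emeasure_density) measurable
  also have "\<dots> \<le> (\<integral>\<^sup>+u. ennreal (2 * \<beta> * B / m) * indicator {?c - s / \<beta>..?c + s / \<beta>} u \<partial>lborel)"
  proof (rule nn_integral_mono)
    fix u :: real
    have "u \<in> {?c - s / \<beta>..?c + s / \<beta>}" if "\<bar>\<alpha> + \<beta> * u\<bar> < s"
      using that \<beta> by (auto simp: field_simps abs_less_iff)
    then show "ennreal (f u) * indicator {u. \<bar>\<alpha> + \<beta> * u\<bar> < s} u
        \<le> ennreal (2 * \<beta> * B / m) * indicator {?c - s / \<beta>..?c + s / \<beta>} u"
      using f_le[of u] by (auto simp: indicator_def intro!: ennreal_leI)
  qed
  also have "\<dots> = ennreal (2 * \<beta> * B / m) * ennreal (2 * s / \<beta>)"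
    using s \<beta> by (subst nn_integral_cmult_indicator) (auto simp: field_simps)
  also have "\<dots> = ennreal (4 * B * s / m)"
    using \<beta> m s B by (simp add: ennreal_mult[symmetric])
  finally show ?thesis .
qed

lemma (in noise_density) integrable_growth:
  assumes mom: "(\<integral>\<^sup>+u. ennreal ((1 + \<bar>u\<bar>) powr r) \<partial>\<mu>) < \<infinity>"
    and [measurable]: "k \<in> borel_measurable borel" and k: "\<And>u. 0 \<le> k u" "\<And>u. k u \<le> B * (1 + \<bar>u\<bar>) powr r"
  shows "integrable lborel (\<lambda>u. k u * f u)"
    and "(\<integral>\<^sup>+u. ennreal (k u) \<partial>\<mu>) = ennreal (\<integral>u. k u * f u \<partial>lborel)"
proof -
  have eq: "(\<integral>\<^sup>+u. ennreal (h u) \<partial>\<mu>) = (\<integral>\<^sup>+u. ennreal (h u * f u) \<partial>lborel)"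
    if [measurable]: "h \<in> borel_measurable borel" and "\<And>u. 0 \<le> h u" for h
    using that(2) f_nonneg by (subst nn_integral_\<mu>) (auto simp: ennreal_mult[symmetric] mult.commute)
  have "(\<integral>\<^sup>+u. ennreal (k u * f u) \<partial>lborel) \<le> (\<integral>\<^sup>+u. ennreal B * ennreal ((1 + \<bar>u\<bar>) powr r) \<partial>\<mu>)"
    using k by (subst eq[symmetric]) (auto intro!: nn_integral_mono simp: ennreal_mult''[symmetric] ennreal_leI)
  also have "\<dots> < \<infinity>" using mom by (simp add: nn_integral_cmult ennreal_mult_less_top)
  finally show i: "integrable lborel (\<lambda>u. k u * f u)"
    using k f_nonneg by (intro integrableI_bounded) auto
  show "(\<integral>\<^sup>+u. ennreal (k u) \<partial>\<mu>) = ennreal (\<integral>u. k u * f u \<partial>lborel)"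
    using k f_nonneg by (subst eq) (auto intro!: nn_integral_eq_integral i)
qed

lemma (in noise_density) moment_tail:
  assumes mom: "(\<integral>\<^sup>+u. ennreal ((1 + \<bar>u\<bar>) powr r) \<partial>\<mu>) < \<infinity>" and e: "0 < e"
  obtains T where "0 \<le> T" "(\<integral>\<^sup>+u. ennreal ((1 + \<bar>u\<bar>) powr r * indicator {u. T < \<bar>u\<bar>} u) \<partial>\<mu>) \<le> ennreal e"
proof -
  let ?g = "\<lambda>u::real. (1 + \<bar>u\<bar>) powr r"
  have i: "integrable \<mu> ?g" using mom by (intro integrableI_bounded) auto
  have "(\<lambda>n. \<integral>u. ?g u * indicator {u. real n < \<bar>u\<bar>} u \<partial>\<mu>) \<longlonglongrightarrow> (\<integral>u. 0 \<partial>\<mu>)"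
  proof (rule integral_dominated_convergence[where w="?g"])
    show "AE u in \<mu>. (\<lambda>n. ?g u * indicator {u. real n < \<bar>u\<bar>} u) \<longlonglongrightarrow> 0"
    proof (intro AE_I2 tendsto_eventually)
      fix u :: real
      obtain n0 where "\<bar>u\<bar> \<le> real n0" using real_arch_simple by blast
      then have "?g u * indicator {u. real n < \<bar>u\<bar>} u = 0" if "n0 \<le> n" for n
        using that by (auto simp: indicator_def)
      then show "\<forall>\<^sub>F n in sequentially. ?g u * indicator {u. real n < \<bar>u\<bar>} u = 0"
        unfolding eventually_sequentially by blast
    qed
    show "AE u in \<mu>. norm (?g u * indicator {u. real n < \<bar>u\<bar>} u) \<le> ?g u" for n
      by (intro AE_I2) (auto simp: indicator_def)
  qed (use i in auto)
  then have "\<forall>\<^sub>F n in sequentially. (\<integral>u. ?g u * indicator {u. real n < \<bar>u\<bar>} u \<partial>\<mu>) < e"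
    using e by (intro order_tendstoD) auto
  then obtain n where n: "(\<integral>u. ?g u * indicator {u. real n < \<bar>u\<bar>} u \<partial>\<mu>) < e"
    by (auto simp: eventually_sequentially)
  have "integrable \<mu> (\<lambda>u. ?g u * indicator {u. real n < \<bar>u\<bar>} u)"
    by (rule Bochner_Integration.integrable_bound[OF i]) (auto simp: indicator_def)
  then have "(\<integral>\<^sup>+u. ennreal (?g u * indicator {u. real n < \<bar>u\<bar>} u) \<partial>\<mu>)
      = ennreal (\<integral>u. ?g u * indicator {u. real n < \<bar>u\<bar>} u \<partial>\<mu>)"
    by (intro nn_integral_eq_integral) auto
  then show ?thesis using n by (intro that[of "real n"]) (auto intro!: ennreal_leI)
qed

locale ar_model = ar_chain f a b + collapsed: collapsed_chain f as bs r C
  for f and a b as bs :: "(real, 'n::{finite,wellorder}) vec \<Rightarrow> real" and r C :: real +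
  fixes A B :: real
  assumes f_away: "loc_bounded_away_from_0_on UNIV f"
    and b_pos: "0 < b x"
    and b_bdd: "loc_bounded_on UNIV b" and b_away: "loc_bounded_away_from_0_on UNIV b"
    and f_bdd: "(1 + \<bar>u\<bar>) * f u \<le> B"
    and a_growth: "\<bar>a x\<bar> \<le> A * (1 + norm x)" and b_growth: "\<bar>b x\<bar> \<le> A * (1 + norm x)"
    and limits: "0 < \<epsilon> \<Longrightarrow> \<exists>W. \<forall>w\<ge>W. \<forall>\<theta>\<in>sphere 0 1.
                   \<bar>a (w *\<^sub>R \<theta>) / w - as \<theta>\<bar> \<le> \<epsilon> \<and> \<bar>b (w *\<^sub>R \<theta>) / w - bs \<theta>\<bar> \<le> \<epsilon>"
    and nondegenerate: "CARD('n) > 1 \<Longrightarrow>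
      loc_bounded_away_from_0_on (UNIV - {0}) (\<lambda>x. max \<bar>star_ext as x\<bar> (star_ext bs x)) \<and>
      loc_bounded_away_from_0_on (UNIV - {x. \<exists>i. x $ i = 0}) (star_ext bs)"
begin

abbreviation E1 :: "((real, 'n) vec \<Rightarrow> real) \<Rightarrow> (real, 'n) vec \<Rightarrow> ennreal" where
  "E1 g x \<equiv> \<integral>\<^sup>+u. ennreal (g (ar_step a b x u)) \<partial>\<mu>"

lemma A_nonneg: "0 \<le> A"
  using a_growth[of 0] by simp

lemma limits_state:
  assumes "0 < \<epsilon>"
  obtains W where "1 \<le> W" "\<And>x. W \<le> norm x \<Longrightarrow>
    \<bar>a x / norm x - as (x /\<^sub>R norm x)\<bar> \<le> \<epsilon> \<and> \<bar>b x / norm x - bs (x /\<^sub>R norm x)\<bar> \<le> \<epsilon>"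
proof -
  obtain W where W: "\<forall>w\<ge>W. \<forall>\<theta>\<in>sphere 0 1.
      \<bar>a (w *\<^sub>R \<theta>) / w - as \<theta>\<bar> \<le> \<epsilon> \<and> \<bar>b (w *\<^sub>R \<theta>) / w - bs \<theta>\<bar> \<le> \<epsilon>"
    using limits[OF assms] by blast
  show ?thesis
  proof (rule that[of "max 1 W"])
    fix x :: "(real, 'n) vec" assume x: "max 1 W \<le> norm x"
    then have "x \<noteq> 0" by auto
    then have "x /\<^sub>R norm x \<in> sphere 0 1" "norm x *\<^sub>R (x /\<^sub>R norm x) = x" by auto
    then show "\<bar>a x / norm x - as (x /\<^sub>R norm x)\<bar> \<le> \<epsilon> \<and> \<bar>b x / norm x - bs (x /\<^sub>R norm x)\<bar> \<le> \<epsilon>"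
      using W x by (metis max.bounded_iff)
  qed simp
qed

lemma ar_step_growth: "norm (ar_step a b x u) \<le> (A + 1) * (1 + norm x) * (1 + \<bar>u\<bar>)"
proof -
  have "norm (ar_step a b x u) \<le> \<bar>a x + b x * u\<bar> + norm x"
    unfolding ar_step_def by (rule norm_shift_le)
  also have "\<dots> \<le> \<bar>a x\<bar> + \<bar>b x\<bar> * \<bar>u\<bar> + norm x"
    using abs_triangle_ineq[of "a x" "b x * u"] by (simp add: abs_mult)
  also have "\<dots> \<le> A * (1 + norm x) + A * (1 + norm x) * \<bar>u\<bar> + (1 + norm x) * (1 + \<bar>u\<bar>)"
    using a_growth[of x] b_growth[of x]
    by (intro add_mono mult_right_mono) (auto simp: algebra_simps)
  finally show ?thesis by (simp add: algebra_simps)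
qed

text \<open>Far out the bound comes from compactness of the sphere and the limits of
  \<open>a\<close> and \<open>b\<close>, near the origin from \<open>b\<close> alone. It provides
  the scale \<open>m\<close> in \<open>small_ball\<close>, proportional to
  \<open>1 + norm x\<close>, which makes a small new coordinate unlikely uniformly in the
  state.\<close>

lemma nondegenerate_growth:
  assumes p: "CARD('n) > 1"
  obtains \<kappa> where "0 < \<kappa>" "\<And>x. \<kappa> * (1 + norm x) \<le> max \<bar>a x\<bar> (b x)"
proof -
  have sphere_ne0: "compact (sphere (0::(real, 'n) vec) 1)" "sphere (0::(real, 'n) vec) 1 \<subseteq> UNIV - {0}"
    by auto
  obtain c where c: "0 < c" "\<And>x. x \<in> sphere 0 1 \<Longrightarrow> c \<le> max \<bar>star_ext as x\<bar> (star_ext bs x)"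
    using compact_bounded_away[of "UNIV - {0}" "\<lambda>x. max \<bar>star_ext as x\<bar> (star_ext bs x)" "sphere 0 1"]
      nondegenerate[OF p] sphere_ne0 by blast
  obtain W where W: "1 \<le> W" "\<And>x. W \<le> norm x \<Longrightarrow>
    \<bar>a x / norm x - as (x /\<^sub>R norm x)\<bar> \<le> c / 2 \<and> \<bar>b x / norm x - bs (x /\<^sub>R norm x)\<bar> \<le> c / 2"
    using limits_state[of "c / 2"] c(1) by auto
  obtain b0 where b0: "0 < b0" "\<And>x. norm x \<le> W \<Longrightarrow> b0 \<le> b x"
    using compact_bounded_away[OF b_away, of "cball 0 W"] by auto
  let ?\<kappa> = "min (c / 4) (b0 / (1 + W))"
  show ?thesis
  proof (rule that[of ?\<kappa>])
    show "0 < ?\<kappa>" using c b0 W by simp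
    fix x :: "(real, 'n) vec"
    show "?\<kappa> * (1 + norm x) \<le> max \<bar>a x\<bar> (b x)"
    proof (cases "norm x \<le> W")
      case True
      have "?\<kappa> * (1 + norm x) \<le> b0 / (1 + W) * (1 + W)"
        using True c b0 W by (intro mult_mono) auto
      also have "\<dots> = b0" using W by simp
      also have "\<dots> \<le> b x" using b0 True by simp
      finally show ?thesis by simp
    next
      case False
      then have x: "W \<le> norm x" "1 \<le> norm x" using W by auto
      let ?t = "x /\<^sub>R norm x"
      have "x \<noteq> 0" using x by auto
      then have t: "?t \<in> sphere 0 1" by simp
      have "?\<kappa> * (1 + norm x) \<le> c / 4 * (2 * norm x)"
        using x c(1) by (intro mult_mono min.cobounded1) auto
      also have "\<dots> = c / 2 * norm x" by simp
      also have "\<dots> \<le> max \<bar>a x / norm x\<bar> (b x / norm x) * norm x"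
      proof (rule mult_right_mono)
        have "c / 2 \<le> max \<bar>p\<bar> q" if "\<bar>p - P\<bar> \<le> c / 2 \<and> \<bar>q - Q\<bar> \<le> c / 2" "c \<le> max \<bar>P\<bar> Q" for p q P Q :: real
          using that by linarith
        from this[OF W(2)[OF x(1)] c(2)[OF t, unfolded collapsed.star_ext_sphere[OF t]]]
        show "c / 2 \<le> max \<bar>a x / norm x\<bar> (b x / norm x)" .
      qed simp
      also have "\<dots> = max \<bar>a x\<bar> (b x)"
        using x by (auto simp: max_mult_distrib_right abs_divide)
      finally show ?thesis .
    qed
  qed
qed

end

text \<open>\<open>lam\<close> is a weight as in condition (i); \<open>Lam\<close> is its extension to a function that is homogeneous
  of degree \<open>r\<close>.\<close>
locale weighted_model = ar_model f a b as bs r C A B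
  for f and a b as bs :: "(real, 'n::{finite,wellorder}) vec \<Rightarrow> real" and r C A B +
  fixes lam :: "(real, 'n) vec \<Rightarrow> real" and c C' \<rho> :: real
  assumes lam_measurable[measurable]: "lam \<in> borel_measurable borel"
    and c_pos: "0 < c" and lam_bounds: "\<theta> \<in> sphere 0 1 \<Longrightarrow> c \<le> lam \<theta> \<and> lam \<theta> \<le> C'"
    and rho: "0 \<le> \<rho>" "\<rho> < 1"
    and contraction: "\<theta> \<in> sphere 0 1 \<Longrightarrow>
       collapsed.Q lam \<theta> \<le> ennreal (\<rho> * lam \<theta>)"
begin

definition Lam :: "(real, 'n) vec \<Rightarrow> real" where
  "Lam x = lam (x /\<^sub>R norm x) * norm x powr r"

text \<open>The mean of \<open>Lam\<close> after one step from \<open>\<theta>\<close> with the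
  coefficients frozen at \<open>\<alpha>\<close> and \<open>\<beta>\<close>. The rescaled process
  and the limit chain differ only in these two arguments.\<close>

definition J :: "real \<Rightarrow> real \<Rightarrow> (real, 'n) vec \<Rightarrow> real" where
  "J \<alpha> \<beta> \<theta> = (\<integral>u. Lam (shift (\<alpha> + \<beta> * u) \<theta>) * f u \<partial>lborel)"

lemma C'_pos: "0 < C'"
proof -
  have "axis (LEAST j. True) 1 \<in> sphere (0::(real, 'n) vec) 1" by simp
  from lam_bounds[OF this] c_pos show ?thesis by linarith
qed

lemma Lam_measurable[measurable]: "Lam \<in> borel_measurable borel"
  unfolding Lam_def by measurable

lemma Lam_bounds: "c * norm x powr r \<le> Lam x" "Lam x \<le> C' * norm x powr r"
proof -
  have "c * norm x powr r \<le> Lam x \<and> Lam x \<le> C' * norm x powr r"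
  proof (cases "x = 0")
    case False
    then have "x /\<^sub>R norm x \<in> sphere 0 1" by simp
    from lam_bounds[OF this] show ?thesis by (auto simp: Lam_def intro!: mult_right_mono)
  qed (simp add: Lam_def)
  then show "c * norm x powr r \<le> Lam x" "Lam x \<le> C' * norm x powr r" by auto
qed

lemma Lam_nonneg: "0 \<le> Lam x"
  by (rule order_trans[OF _ Lam_bounds(1)]) (use c_pos in simp)

lemma Lam_scale: "0 < w \<Longrightarrow> Lam (w *\<^sub>R x) = w powr r * Lam x"
proof -
  assume w: "0 < w"
  then have e: "inverse w * inverse (norm x) * w = inverse (norm x)" by (simp add: divide_simps)
  have d: "(w *\<^sub>R x) /\<^sub>R norm (w *\<^sub>R x) = x /\<^sub>R norm x"
    unfolding norm_scaleR scaleR_scaleR using w by (simp only: abs_of_pos inverse_mult_distrib e)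
  show ?thesis unfolding Lam_def d using w by (simp add: powr_mult)
qed

lemma moment_G: "(\<integral>\<^sup>+u. ennreal ((1 + \<bar>u\<bar>) powr r) \<partial>\<mu>) < \<infinity>"
  by (rule moment_one_plus[OF collapsed.moment collapsed.r_pos])

lemma Lam_shift_le:
  assumes "\<bar>y\<bar> + 1 \<le> k * (1 + \<bar>u\<bar>)" "0 \<le> k" and "\<theta> \<in> sphere 0 1"
  shows "Lam (shift y \<theta>) \<le> (C' * k powr r) * (1 + \<bar>u\<bar>) powr r"
proof -
  have "norm (shift y \<theta>) \<le> k * (1 + \<bar>u\<bar>)" using norm_shift_le[of y \<theta>] assms by simp
  then have "norm (shift y \<theta>) powr r \<le> (k * (1 + \<bar>u\<bar>)) powr r"
    using collapsed.r_pos by (intro powr_mono2) auto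
  also have "\<dots> = k powr r * (1 + \<bar>u\<bar>) powr r" by (rule powr_mult)
  finally have "C' * norm (shift y \<theta>) powr r \<le> C' * (k powr r * (1 + \<bar>u\<bar>) powr r)"
    using C'_pos by (intro mult_left_mono) auto
  then show ?thesis using Lam_bounds(2)[of "shift y \<theta>"] by (simp add: mult.assoc)
qed

lemma affine_growth: "\<bar>\<alpha> + \<beta> * u\<bar> + 1 \<le> (1 + \<bar>\<alpha>\<bar> + \<bar>\<beta>\<bar>) * (1 + \<bar>u\<bar>)" for \<alpha> \<beta> u :: real
proof -
  have "\<bar>\<alpha> + \<beta> * u\<bar> + 1 \<le> (\<bar>\<alpha>\<bar> + \<bar>\<beta>\<bar> * \<bar>u\<bar> + 1) + ((1 + \<bar>\<alpha>\<bar>) * \<bar>u\<bar> + \<bar>\<beta>\<bar>)"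
  proof -
    have "\<bar>\<alpha> + \<beta> * u\<bar> \<le> \<bar>\<alpha>\<bar> + \<bar>\<beta>\<bar> * \<bar>u\<bar>"
      using abs_triangle_ineq[of \<alpha> "\<beta> * u"] by (simp add: abs_mult)
    moreover have "0 \<le> (1 + \<bar>\<alpha>\<bar>) * \<bar>u\<bar>" "0 \<le> \<bar>\<beta>\<bar>" by simp_all
    ultimately show ?thesis by linarith
  qed
  then show ?thesis by (simp add: algebra_simps)
qed

lemma J_nn:
  assumes "\<theta> \<in> sphere 0 1"
  shows "(\<integral>\<^sup>+u. ennreal (Lam (shift (\<alpha> + \<beta> * u) \<theta>)) \<partial>\<mu>) = ennreal (J \<alpha> \<beta> \<theta>)"
    and "integrable lborel (\<lambda>u. Lam (shift (\<alpha> + \<beta> * u) \<theta>) * f u)"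
  unfolding J_def using Lam_nonneg
  by (auto intro!: integrable_growth[OF moment_G] Lam_shift_le[OF affine_growth _ assms])

lemma J_nonneg: "0 \<le> J \<alpha> \<beta> \<theta>"
  unfolding J_def using Lam_nonneg f_nonneg by (intro integral_nonneg_AE) auto

lemma J_limit_le:
  assumes \<theta>: "\<theta> \<in> sphere 0 1"
  shows "J (as \<theta>) (bs \<theta>) \<theta> \<le> \<rho> * lam \<theta>"
proof -
  have "ennreal (J (as \<theta>) (bs \<theta>) \<theta>) = collapsed.Q lam \<theta>"
    unfolding J_nn(1)[OF \<theta>, symmetric]
  proof (rule nn_integral_cong)
    fix u
    have z: "zfun as bs \<theta> u = as \<theta> + bs \<theta> * u"
      by (simp add: zfun_def collapsed.star_ext_sphere[OF \<theta>])
    show "ennreal (Lam (shift (as \<theta> + bs \<theta> * u) \<theta>)) = collapsed.wr \<theta> u * ennreal (lam (collapsed_step as bs \<theta> u))"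
      by (simp add: collapsed.wr_def wfun_def collapsed_step_def z Lam_def ennreal_mult' mult.commute[of "lam _"])
  qed
  also have "\<dots> \<le> ennreal (\<rho> * lam \<theta>)" by (rule contraction[OF \<theta>])
  finally show ?thesis
    using rho lam_bounds[OF \<theta>] c_pos by (subst (asm) ennreal_le_iff) auto
qed

text \<open>Homogeneity of \<open>Lam\<close> and of the shift moves the step to the unit sphere,
  with coefficients \<open>a x / norm x\<close> and \<open>b x / norm x\<close>.\<close>

lemma one_step_Lam:
  assumes x: "x \<noteq> 0"
  shows "E1 Lam x
    = ennreal (norm x powr r * J (a x / norm x) (b x / norm x) (x /\<^sub>R norm x))"
proof -
  let ?w = "norm x" and ?t = "x /\<^sub>R norm x"
  have t: "?t \<in> sphere 0 1" using x by simp
  have "ar_step a b x u = ?w *\<^sub>R shift (a x / ?w + b x / ?w * u) ?t" for u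
    using x unfolding ar_step_def shift_scale[symmetric] by (simp add: algebra_simps)
  then have "E1 Lam x
    = (\<integral>\<^sup>+u. ennreal (?w powr r) * ennreal (Lam (shift (a x / ?w + b x / ?w * u) ?t)) \<partial>\<mu>)"
    using x Lam_nonneg by (simp add: Lam_scale ennreal_mult)
  also have "\<dots> = ennreal (?w powr r) * ennreal (J (a x / ?w) (b x / ?w) ?t)"
    by (subst nn_integral_cmult) (measurable, simp only: J_nn(1)[OF t])
  finally show ?thesis using J_nonneg by (simp add: ennreal_mult)
qed

lemma one_step_Lam_le:
  assumes x: "x \<noteq> 0" and J: "J (a x / norm x) (b x / norm x) (x /\<^sub>R norm x) \<le> \<rho>' * lam (x /\<^sub>R norm x)"
  shows "E1 Lam x \<le> ennreal (\<rho>' * Lam x)"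
  unfolding one_step_Lam[OF x] using mult_left_mono[OF J, of "norm x powr r"]
  by (intro ennreal_leI) (simp add: Lam_def mult_ac)

text \<open>Where \<open>bs\<close> is bounded away from 0 the one-step laws of the process and of its homogeneous limit are
  close in weighted total variation, so \<open>lam\<close> need not be continuous.\<close>
lemma one_step_contraction_nondegenerate:
  assumes \<eta>: "0 < \<eta>" and \<rho>': "\<rho> < \<rho>'"
  obtains W where "1 \<le> W" "\<And>x. W \<le> norm x \<Longrightarrow> \<eta> \<le> bs (x /\<^sub>R norm x) \<Longrightarrow>
    E1 Lam x \<le> ennreal (\<rho>' * Lam x)"
proof -
  \<comment> \<open>Normalises \<open>Lam\<close> along the limit step so that it lies below the
    weight \<open>(1 + \<bar>y\<bar>) powr r\<close>, uniformly over the sphere.\<close>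
  define K where "K = C' * (1 + 2 * C) powr r"
  have K: "0 < K" using C'_pos collapsed.C_nonneg by (simp add: K_def)
  \<comment> \<open>The resulting error is \<open>K * e = (\<rho>' - \<rho>) * c\<close>, which the
    lower bound \<open>c\<close> of \<open>lam\<close> absorbs.\<close>
  define e where "e = (\<rho>' - \<rho>) * c / K"
  have e: "0 < e" using \<rho>' c_pos K by (simp add: e_def)
  have "integrable lborel (\<lambda>u. (1 + \<bar>u\<bar>) powr r * f u)"
    by (rule integrable_growth(1)[OF moment_G, of _ 1]) auto
  from integral_affine_perturbation[OF f_measurable f_nonneg less_imp_le[OF collapsed.r_pos] this e]
  obtain \<delta> where \<delta>: "0 < \<delta>" and pert: "\<And>s t h. \<bar>s\<bar> \<le> \<delta> \<Longrightarrow> \<bar>t - 1\<bar> \<le> \<delta> \<Longrightarrow> h \<in> borel_measurable borel \<Longrightarrow>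
     (\<And>y. 0 \<le> h y) \<Longrightarrow> (\<And>y. h y \<le> (1 + \<bar>y\<bar>) powr r) \<Longrightarrow>
     (\<integral>u. h (s + t * u) * f u \<partial>lborel) \<le> (\<integral>u. h u * f u \<partial>lborel) + e"
    by blast
  have "0 < \<delta> * \<eta>" using \<delta> \<eta> by simp
  then obtain W where W: "1 \<le> W" "\<And>x. W \<le> norm x \<Longrightarrow>
    \<bar>a x / norm x - as (x /\<^sub>R norm x)\<bar> \<le> \<delta> * \<eta> \<and> \<bar>b x / norm x - bs (x /\<^sub>R norm x)\<bar> \<le> \<delta> * \<eta>"
    using limits_state by metis
  show ?thesis
  proof (rule that[OF W(1)])
    fix x :: "(real, 'n) vec" assume x: "W \<le> norm x" and bs: "\<eta> \<le> bs (x /\<^sub>R norm x)"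
    let ?w = "norm x" and ?t = "x /\<^sub>R norm x"
    have x0: "x \<noteq> 0" using x W(1) by auto
    then have t: "?t \<in> sphere 0 1" by simp
    define \<alpha>' \<beta>' where "\<alpha>' = as ?t" and "\<beta>' = bs ?t"
    \<comment> \<open>Chosen so that the limit law perturbed by \<open>s + t * u\<close> is exactly
      the law of the process. Dividing by \<open>\<beta>'\<close>, which is at least
      \<open>\<eta>\<close>, turns the tolerance \<open>\<delta> * \<eta>\<close> into
      \<open>\<delta>\<close>.\<close>
    define s t where "s = (a x / ?w - \<alpha>') / \<beta>'" and "t = (b x / ?w) / \<beta>'"
    have \<beta>': "\<eta> \<le> \<beta>'" "0 < \<beta>'" using bs \<eta> by (auto simp: \<beta>'_def)
    have small: "\<bar>y / \<beta>'\<bar> \<le> \<delta>" if "\<bar>y\<bar> \<le> \<delta> * \<eta>" for y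
    proof -
      have "\<delta> * \<eta> \<le> \<delta> * \<beta>'" using \<beta>' \<delta> by (intro mult_left_mono) auto
      then show ?thesis using that \<beta>' by (simp add: abs_divide field_simps)
    qed
    have st: "\<bar>s\<bar> \<le> \<delta>" "\<bar>t - 1\<bar> \<le> \<delta>"
    proof -
      show "\<bar>s\<bar> \<le> \<delta>" unfolding s_def using W(2)[OF x] by (intro small) (simp add: \<alpha>'_def)
      have "t - 1 = (b x / ?w - \<beta>') / \<beta>'" using \<beta>' by (simp add: t_def diff_divide_distrib)
      then show "\<bar>t - 1\<bar> \<le> \<delta>" using W(2)[OF x] by (simp only:) (intro small, simp add: \<beta>'_def)
    qed
    define h where "h y = Lam (shift (\<alpha>' + \<beta>' * y) ?t) / K" for y
    have [measurable]: "h \<in> borel_measurable borel" unfolding h_def by measurable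
    have h0: "0 \<le> h y" for y using Lam_nonneg K by (simp add: h_def)
    have h1: "h y \<le> (1 + \<bar>y\<bar>) powr r" for y
    proof -
      have "\<bar>\<alpha>'\<bar> \<le> C" "\<bar>\<beta>'\<bar> \<le> C"
        using collapsed.bounded_on_sphere[OF t] by (auto simp: \<alpha>'_def \<beta>'_def)
      then have "\<bar>\<alpha>' + \<beta>' * y\<bar> + 1 \<le> (1 + 2 * C) * (1 + \<bar>y\<bar>)"
        by (intro order_trans[OF affine_growth] mult_right_mono) auto
      from Lam_shift_le[OF this _ t] have "Lam (shift (\<alpha>' + \<beta>' * y) ?t) \<le> K * (1 + \<bar>y\<bar>) powr r"
        using collapsed.C_nonneg by (simp add: K_def)
      then show ?thesis using K by (simp add: h_def field_simps)
    qed
    have "\<alpha>' + \<beta>' * (s + t * u) = a x / ?w + b x / ?w * u" for u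
      using \<beta>' by (simp add: s_def t_def field_simps)
    then have "J (a x / ?w) (b x / ?w) ?t = K * (\<integral>u. h (s + t * u) * f u \<partial>lborel)"
      using K by (simp add: J_def h_def)
    also have "\<dots> \<le> K * ((\<integral>u. h u * f u \<partial>lborel) + e)"
      using K by (intro mult_left_mono pert st h0 h1) auto
    also have "\<dots> = J \<alpha>' \<beta>' ?t + K * e"
      using K by (simp add: J_def h_def distrib_left)
    also have "\<dots> \<le> \<rho> * lam ?t + (\<rho>' - \<rho>) * c"
      using J_limit_le[OF t] K by (simp add: \<alpha>'_def \<beta>'_def e_def)
    also have "\<dots> \<le> \<rho> * lam ?t + (\<rho>' - \<rho>) * lam ?t"
      using lam_bounds[OF t] \<rho>' by (intro add_left_mono mult_left_mono) auto
    also have "\<dots> = \<rho>' * lam ?t" by (simp add: algebra_simps)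
    finally show "E1 Lam x \<le> ennreal (\<rho>' * Lam x)"
      by (rule one_step_Lam_le[OF x0])
  qed
qed

end

context weighted_model
begin

abbreviation G :: "real \<Rightarrow> real" where "G u \<equiv> (1 + \<bar>u\<bar>) powr r"

definition Mr :: real where "Mr = enn2real (\<integral>\<^sup>+u. ennreal (G u) \<partial>\<mu>)"

lemma Mr: "(\<integral>\<^sup>+u. ennreal (G u) \<partial>\<mu>) = ennreal Mr" "0 \<le> Mr"
  using moment_G by (simp_all add: Mr_def)

lemma Lam_step_le:
  "Lam (ar_step a b x u) \<le> (C' * (A + 1) powr r) * (1 + norm x) powr r * G u"
proof -
  have "norm (ar_step a b x u) powr r \<le> ((A + 1) * (1 + norm x) * (1 + \<bar>u\<bar>)) powr r"
    using ar_step_growth collapsed.r_pos by (intro powr_mono2) auto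
  also have "\<dots> = (A + 1) powr r * (1 + norm x) powr r * G u" by (simp add: powr_mult)
  finally have "C' * norm (ar_step a b x u) powr r \<le> C' * ((A + 1) powr r * (1 + norm x) powr r * G u)"
    using C'_pos by (intro mult_left_mono) auto
  then show ?thesis using Lam_bounds(2)[of "ar_step a b x u"] by (simp add: mult.assoc)
qed

definition Dc :: real where "Dc = C' * (A + 1) powr r * 2 powr r / c"

lemma Dc_pos: "0 < Dc"
  using C'_pos c_pos A_nonneg by (simp add: Dc_def)

lemma Lam_step_le_Lam:
  assumes x: "1 \<le> norm x"
  shows "Lam (ar_step a b x u) \<le> Dc * Lam x * G u"
proof -
  have "(1 + norm x) powr r \<le> (2 * norm x) powr r" using x collapsed.r_pos by (intro powr_mono2) auto
  also have "\<dots> = 2 powr r * norm x powr r" by (rule powr_mult)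
  also have "\<dots> \<le> 2 powr r * (Lam x / c)"
    using Lam_bounds(1)[of x] c_pos by (intro mult_left_mono) (auto simp: field_simps)
  finally have "(C' * (A + 1) powr r) * (1 + norm x) powr r * G u
     \<le> (C' * (A + 1) powr r) * (2 powr r * (Lam x / c)) * G u"
    using C'_pos by (intro mult_right_mono mult_left_mono) auto
  then show ?thesis using Lam_step_le[of x u] by (simp add: Dc_def)
qed

lemma bounded_region:
  assumes x: "norm x \<le> W" and h: "\<And>u. h u \<le> k * Lam (ar_step a b x u)" and k: "0 \<le> k"
  shows "(\<integral>\<^sup>+u. ennreal (h u) \<partial>\<mu>) \<le> ennreal (k * (C' * (A + 1) powr r) * (1 + W) powr r * Mr)"
proof -
  have C0: "0 \<le> k * (C' * (A + 1) powr r)" using C'_pos k by simp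
  have "h u \<le> k * (C' * (A + 1) powr r) * (1 + W) powr r * G u" for u
  proof -
    have "(1 + norm x) powr r \<le> (1 + W) powr r" using x collapsed.r_pos by (intro powr_mono2) auto
    then have "(C' * (A + 1) powr r) * (1 + norm x) powr r * G u \<le> (C' * (A + 1) powr r) * (1 + W) powr r * G u"
      using C'_pos by (intro mult_right_mono mult_left_mono) auto
    then have "k * Lam (ar_step a b x u) \<le> k * ((C' * (A + 1) powr r) * (1 + W) powr r * G u)"
      using Lam_step_le[of x u] k by (intro mult_left_mono) auto
    with h[of u] show ?thesis by (simp add: mult.assoc)
  qed
  then have "(\<integral>\<^sup>+u. ennreal (h u) \<partial>\<mu>) \<le> (\<integral>\<^sup>+u. ennreal (k * (C' * (A + 1) powr r) * (1 + W) powr r) * ennreal (G u) \<partial>\<mu>)"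
    using C0 by (intro nn_integral_mono) (simp add: ennreal_mult'[symmetric] ennreal_leI)
  also have "\<dots> = ennreal (k * (C' * (A + 1) powr r) * (1 + W) powr r) * ennreal Mr"
    by (simp add: nn_integral_cmult Mr)
  finally show ?thesis using C0 Mr(2) by (simp add: ennreal_mult'[symmetric])
qed

text \<open>\<open>\<rho>1\<close> lies halfway between \<open>\<rho>\<close> and 1, and
  \<open>\<gamma> = \<rho>1 + (1 - \<rho>) / 4\<close>: the added quarter is the allowance for the
  exceptional noise in the drift estimate.\<close>

definition \<rho>1 :: real where "\<rho>1 = (1 + \<rho>) / 2"
definition \<gamma> :: real where "\<gamma> = (3 + \<rho>) / 4"

lemma \<gamma>_bounds: "0 \<le> \<gamma>" "\<gamma> < 1" "3 / 4 \<le> \<gamma>" "\<rho>1 \<le> \<gamma>" "\<rho> < \<rho>1"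
  using rho by (auto simp: \<gamma>_def \<rho>1_def)

text \<open>In dimension one the sphere has two points and \<open>Lam\<close> is continuous, so dominated convergence
  replaces the total variation argument and degenerate \<open>bs\<close> are harmless.\<close>
lemma drift_dimension_one:
  assumes p: "CARD('n) = 1"
  obtains W where "1 \<le> W" "\<And>x. W \<le> norm x \<Longrightarrow>
    E1 Lam x \<le> ennreal (\<rho>1 * Lam x)"
proof -
  have least: "i = (LEAST j. True)" for i :: 'n
    using p by (metis UNIV_I card_1_singletonE singletonD)
  define e where "e = shift 1 (0::(real, 'n) vec)"
  have sh: "shift y x = y *\<^sub>R e" for y and x :: "(real, 'n) vec"
    using least by (simp add: vec_eq_iff shift_def e_def)
  have UNIV1: "(UNIV :: 'n set) = {LEAST j. True}" using least by auto
  have normv: "norm v = \<bar>v $ (LEAST j. True)\<bar>" for v :: "(real, 'n) vec"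
    by (simp add: norm_vec_def L2_set_def UNIV1)
  have ne: "norm e = 1" unfolding normv e_def by simp
  have sphere: "sphere 0 1 \<subseteq> {e, - e}"
  proof
    fix \<theta> :: "(real, 'n) vec" assume "\<theta> \<in> sphere 0 1"
    then have "\<bar>\<theta> $ (LEAST j. True)\<bar> = 1" using normv[of \<theta>] by simp
    moreover have "\<theta> = (\<theta> $ (LEAST j. True)) *\<^sub>R e"
    proof (rule vec_eq_iff[THEN iffD2, rule_format])
      fix i :: 'n
      show "\<theta> $ i = ((\<theta> $ (LEAST j. True)) *\<^sub>R e) $ i"
        unfolding least[of i] by (simp add: e_def)
    qed
    ultimately show "\<theta> \<in> {e, - e}" by (auto simp: abs_if split: if_splits)
  qed
  \<comment> \<open>The two rays carry different constants, but both terms vanish at 0 because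
    \<open>r\<close> is positive. This is the source of continuity.\<close>
  have Lam_e: "Lam (y *\<^sub>R e) = lam e * max 0 y powr r + lam (- e) * max 0 (- y) powr r" for y
  proof (cases y "0::real" rule: linorder_cases)
    case less
    then have "y *\<^sub>R e /\<^sub>R norm (y *\<^sub>R e) = - e" using ne by simp
    then show ?thesis using less ne unfolding Lam_def by simp
  next
    case greater
    then have "y *\<^sub>R e /\<^sub>R norm (y *\<^sub>R e) = e" using ne by simp
    then show ?thesis using greater ne unfolding Lam_def by simp
  qed (simp add: Lam_def)
  have cont: "continuous_on UNIV (\<lambda>y. Lam (y *\<^sub>R e))"
    unfolding Lam_e using collapsed.r_pos
    by (intro continuous_on_add continuous_on_mult continuous_on_const continuous_on_powr' continuous_on_max
        continuous_on_id continuous_on_minus) auto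
  have ev: "\<forall>\<^sub>F w in at_top. J (a (w *\<^sub>R \<theta>) / w) (b (w *\<^sub>R \<theta>) / w) \<theta> \<le> \<rho>1 * lam \<theta>"
    if \<theta>: "\<theta> \<in> sphere 0 1" for \<theta>
  proof -
    let ?\<alpha> = "\<lambda>w. a (w *\<^sub>R \<theta>) / w" and ?\<beta> = "\<lambda>w. b (w *\<^sub>R \<theta>) / w"
    have near: "\<forall>\<^sub>F w in at_top. \<bar>?\<alpha> w - as \<theta>\<bar> \<le> \<epsilon> \<and> \<bar>?\<beta> w - bs \<theta>\<bar> \<le> \<epsilon>" if "0 < \<epsilon>" for \<epsilon>
      using limits[OF that] \<theta> unfolding eventually_at_top_linorder by blast
    have lim: "(?\<alpha> \<longlongrightarrow> as \<theta>) at_top" "(?\<beta> \<longlongrightarrow> bs \<theta>) at_top"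
    proof -
      show "(?\<alpha> \<longlongrightarrow> as \<theta>) at_top"
      proof (rule tendstoI)
        fix \<epsilon> :: real assume "0 < \<epsilon>"
        then show "\<forall>\<^sub>F w in at_top. dist (?\<alpha> w) (as \<theta>) < \<epsilon>"
          using near[of "\<epsilon> / 2"] by (auto simp: dist_real_def elim!: eventually_mono)
      qed
      show "(?\<beta> \<longlongrightarrow> bs \<theta>) at_top"
      proof (rule tendstoI)
        fix \<epsilon> :: real assume "0 < \<epsilon>"
        then show "\<forall>\<^sub>F w in at_top. dist (?\<beta> w) (bs \<theta>) < \<epsilon>"
          using near[of "\<epsilon> / 2"] by (auto simp: dist_real_def elim!: eventually_mono)
      qed
    qed
    let ?k = "1 + (C + 1) + (C + 1)"
    have "((\<lambda>w. J (?\<alpha> w) (?\<beta> w) \<theta>) \<longlongrightarrow> J (as \<theta>) (bs \<theta>) \<theta>) at_top"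
      unfolding J_def
    proof (rule integral_dominated_convergence_at_top[where w="\<lambda>u. (C' * ?k powr r) * G u * f u"])
      show "\<forall>\<^sub>F w in at_top. AE u in lborel.
          norm (Lam (shift (?\<alpha> w + ?\<beta> w * u) \<theta>) * f u) \<le> (C' * ?k powr r) * G u * f u"
        using near[of 1, simplified]
      proof eventually_elim
        case (elim w)
        have "\<bar>as \<theta>\<bar> \<le> C" "\<bar>bs \<theta>\<bar> \<le> C" using collapsed.bounded_on_sphere[OF \<theta>] by auto
        then have "\<bar>?\<alpha> w\<bar> \<le> C + 1" "\<bar>?\<beta> w\<bar> \<le> C + 1" using elim by auto
        then have bnd: "\<bar>?\<alpha> w + ?\<beta> w * u\<bar> + 1 \<le> ?k * (1 + \<bar>u\<bar>)" for u
          by (intro order_trans[OF affine_growth] mult_right_mono) auto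
        have "0 \<le> ?k" using collapsed.C_nonneg by simp
        from Lam_shift_le[OF bnd this \<theta>] show ?case
          using Lam_nonneg f_nonneg by (intro AE_I2) (auto intro: mult_right_mono)
      qed
      show "AE u in lborel. ((\<lambda>w. Lam (shift (?\<alpha> w + ?\<beta> w * u) \<theta>) * f u)
          \<longlongrightarrow> Lam (shift (as \<theta> + bs \<theta> * u) \<theta>) * f u) at_top"
      proof (intro AE_I2 tendsto_mult tendsto_const)
        fix u :: real
        have "((\<lambda>w. ?\<alpha> w + ?\<beta> w * u) \<longlongrightarrow> as \<theta> + bs \<theta> * u) at_top"
          by (intro tendsto_intros lim)
        then show "((\<lambda>w. Lam (shift (?\<alpha> w + ?\<beta> w * u) \<theta>)) \<longlongrightarrow> Lam (shift (as \<theta> + bs \<theta> * u) \<theta>)) at_top"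
          unfolding sh by (rule continuous_on_tendsto_compose[OF cont]) auto
      qed
      show "integrable lborel (\<lambda>u. (C' * ?k powr r) * G u * f u)"
        using C'_pos by (intro integrable_growth(1)[OF moment_G]) auto
    qed measurable
    moreover have "J (as \<theta>) (bs \<theta>) \<theta> < \<rho>1 * lam \<theta>"
    proof -
      have "0 < lam \<theta>" using lam_bounds[OF \<theta>] c_pos by linarith
      then have "\<rho> * lam \<theta> < \<rho>1 * lam \<theta>" using \<gamma>_bounds(5) by simp
      then show ?thesis using J_limit_le[OF \<theta>] by linarith
    qed
    ultimately have "\<forall>\<^sub>F w in at_top. J (?\<alpha> w) (?\<beta> w) \<theta> < \<rho>1 * lam \<theta>"
      by (rule order_tendstoD(2))
    then show ?thesis by (rule eventually_mono) simp
  qed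
  \<comment> \<open>With finitely many directions the directionwise limits are automatically
    uniform.\<close>
  have "finite (sphere (0::(real, 'n) vec) 1)" using sphere by (rule finite_subset) simp
  then have "\<forall>\<^sub>F w in at_top. \<forall>\<theta>\<in>sphere 0 1. J (a (w *\<^sub>R \<theta>) / w) (b (w *\<^sub>R \<theta>) / w) \<theta> \<le> \<rho>1 * lam \<theta>"
    using ev by (intro eventually_ball_finite) auto
  then obtain W where W: "\<And>w \<theta>. W \<le> w \<Longrightarrow> \<theta> \<in> sphere 0 1 \<Longrightarrow>
      J (a (w *\<^sub>R \<theta>) / w) (b (w *\<^sub>R \<theta>) / w) \<theta> \<le> \<rho>1 * lam \<theta>"
    unfolding eventually_at_top_linorder by blast
  show ?thesis
  proof (rule that[of "max 1 W"])
    fix x :: "(real, 'n) vec" assume x: "max 1 W \<le> norm x"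
    then have x0: "x \<noteq> 0" by auto
    then have "J (a x / norm x) (b x / norm x) (x /\<^sub>R norm x) \<le> \<rho>1 * lam (x /\<^sub>R norm x)"
      using W[of "norm x" "x /\<^sub>R norm x"] x by simp
    then show "E1 Lam x \<le> ennreal (\<rho>1 * Lam x)"
      by (rule one_step_Lam_le[OF x0])
  qed simp
qed

end

section \<open>The drift function\<close>

text \<open>Penalises states with a small recent coordinate; the penalty decreases by the factor \<open>H\<close> whenever
  the coordinate ages by one step.\<close>
definition penalty :: "real \<Rightarrow> real \<Rightarrow> real \<Rightarrow> (real, 'n::{finite,wellorder}) vec \<Rightarrow> real" where
  "penalty H \<delta> \<tau> x =
     1 + (\<Sum>i\<in>UNIV. H ^ (CARD('n) - lag i) * (if \<bar>x $ i\<bar> < \<delta> / \<tau> ^ lag i * norm x then 1 else 0))"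

lemma penalty_measurable[measurable]: "penalty H \<delta> \<tau> \<in> borel_measurable borel"
  unfolding penalty_def by measurable

text \<open>For the third claim, every lag is below the dimension, so the exponent of
  \<open>H\<close> is at least 1 and a single small coordinate already contributes
  \<open>H\<close>.\<close>

lemma penalty_bounds:
  fixes x :: "(real, 'n::{finite,wellorder}) vec"
  assumes H: "1 \<le> H"
  shows "1 \<le> penalty H \<delta> \<tau> x" "penalty H \<delta> \<tau> x \<le> 1 + real CARD('n) * H ^ CARD('n)"
    "(\<forall>i. \<delta> / \<tau> ^ lag i * norm x \<le> \<bar>x $ i\<bar>) \<or> H \<le> penalty H \<delta> \<tau> x"
proof -
  let ?t = "\<lambda>i. H ^ (CARD('n) - lag i) * (if \<bar>x $ i\<bar> < \<delta> / \<tau> ^ lag i * norm x then 1 else 0)"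
  have t0: "0 \<le> ?t i" for i using H by simp
  then show "1 \<le> penalty H \<delta> \<tau> x" unfolding penalty_def by (simp add: sum_nonneg)
  have "?t i \<le> H ^ CARD('n)" for i
  proof -
    have "?t i \<le> H ^ (CARD('n) - lag i)" using H by simp
    also have "\<dots> \<le> H ^ CARD('n)" using H by (intro power_increasing) auto
    finally show ?thesis .
  qed
  then have "(\<Sum>i\<in>UNIV. ?t i) \<le> of_nat (card (UNIV :: 'n set)) * H ^ CARD('n)"
    by (intro sum_bounded_above)
  then show "penalty H \<delta> \<tau> x \<le> 1 + real CARD('n) * H ^ CARD('n)" by (simp add: penalty_def)
  show "(\<forall>i. \<delta> / \<tau> ^ lag i * norm x \<le> \<bar>x $ i\<bar>) \<or> H \<le> penalty H \<delta> \<tau> x"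
  proof (rule disj_imp[THEN iffD2], rule impI)
    assume "\<not> (\<forall>i. \<delta> / \<tau> ^ lag i * norm x \<le> \<bar>x $ i\<bar>)"
    then obtain i where i: "\<bar>x $ i\<bar> < \<delta> / \<tau> ^ lag i * norm x" by (auto simp: not_le)
    have "H ^ 1 \<le> H ^ (CARD('n) - lag i)"
      using H lag_less_card[of i] by (intro power_increasing) auto
    also have "\<dots> = ?t i" using i by simp
    also have "\<dots> \<le> (\<Sum>i\<in>UNIV. ?t i)" using t0 by (intro member_le_sum) auto
    finally show "H \<le> penalty H \<delta> \<tau> x" by (simp add: penalty_def)
  qed
qed

text \<open>The threshold shrinks by \<open>\<tau>\<close> with each unit of age, which outweighs a
  growth of the norm by at most \<open>\<tau>\<close>: a coordinate that was not small cannot become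
  so by ageing. One that was small loses one power of \<open>H\<close>, the newest contributes
  nothing by \<open>fresh\<close>, and the oldest drops out.\<close>

lemma penalty_shift:
  fixes x :: "(real, 'n::{finite,wellorder}) vec"
  assumes H: "1 \<le> H" and \<tau>: "0 < \<tau>" and \<delta>: "0 < \<delta>"
    and growth: "norm (shift z x) \<le> \<tau> * norm x" and fresh: "\<delta> * norm (shift z x) \<le> \<bar>z\<bar>"
  shows "penalty H \<delta> \<tau> (shift z x) \<le> 1 + (penalty H \<delta> \<tau> x - 1) / H"
proof -
  let ?p = "CARD('n)" and ?l = "LEAST j::'n. True" and ?X = "shift z x"
  define t where "t i = H ^ (?p - lag i) * (if \<bar>x $ i\<bar> < \<delta> / \<tau> ^ lag i * norm x then 1 else 0)" for i
  have t0: "0 \<le> t i" for i using H by (simp add: t_def)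
  let ?T = "\<lambda>i. H ^ (?p - lag i) * (if \<bar>?X $ i\<bar> < \<delta> / \<tau> ^ lag i * norm ?X then 1 else 0)"
  have "(\<Sum>i\<in>UNIV. ?T i) = ?T ?l + (\<Sum>i\<in>- {?l}. ?T i)"
    by (subst sum.remove[of _ ?l]) (auto simp: Compl_eq_Diff_UNIV)
  also have "?T ?l = 0" using fresh by (simp add: lag_least)
  also have "(\<Sum>i\<in>- {?l}. ?T i) \<le> (\<Sum>i\<in>- {?l}. t (Max {j. j < i}) / H)"
  proof (rule sum_mono)
    fix i :: 'n assume "i \<in> - {?l}"
    then have i: "i \<noteq> ?l" by simp
    let ?j = "Max {j. j < i}"
    have r: "lag i = Suc (lag ?j)" by (rule not_least(2)[OF i])
    show "?T i \<le> t ?j / H"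
    proof (cases "\<bar>?X $ i\<bar> < \<delta> / \<tau> ^ lag i * norm ?X")
      case True
      then have "\<bar>x $ ?j\<bar> < \<delta> / \<tau> ^ lag i * norm ?X" by (simp add: shift_not_least[OF i])
      also have "\<dots> \<le> \<delta> / \<tau> ^ lag i * (\<tau> * norm x)" using \<delta> \<tau> by (intro mult_left_mono growth) auto
      also have "\<dots> = \<delta> / \<tau> ^ lag ?j * norm x" using \<tau> by (simp add: r)
      finally have "t ?j = H ^ (?p - lag ?j)" by (simp add: t_def)
      also have "?p - lag ?j = Suc (?p - lag i)" using lag_less_card[of i] r by simp
      finally show ?thesis using H True by simp
    next
      case False
      then show ?thesis using t0[of ?j] H by (simp add: divide_nonneg_nonneg)
    qed
  qed
  also have "\<dots> = (\<Sum>i\<in>- {?l}. t (Max {j. j < i})) / H" by (simp add: sum_divide_distrib)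
  also have "\<dots> \<le> (\<Sum>i\<in>UNIV. t i) / H" using H t0 by (intro divide_right_mono sum_pred_le) auto
  finally show ?thesis by (simp add: penalty_def t_def)
qed

context weighted_model
begin

text \<open>The drift function is \<open>penalty\<close> times \<open>Lam\<close>. Flagged states
  gain from the falling penalty, which outweighs the crude growth of \<open>Lam\<close>; unflagged
  states have directions in a compact set where \<open>bs\<close> is bounded away from 0, and there
  \<open>Lam\<close> itself contracts.\<close>

lemma drift_higher_dimension:
  assumes p: "CARD('n) > 1"
  obtains V k K where "V \<in> borel_measurable borel" "1 \<le> k" "0 \<le> K"
    "\<And>x. Lam x \<le> V x" "\<And>x. V x \<le> k * Lam x"
    "\<And>x. E1 V x \<le> ennreal (\<gamma> * V x + K)"
proof -
  obtain \<kappa> where \<kappa>: "0 < \<kappa>" "\<And>x. \<kappa> * (1 + norm x) \<le> max \<bar>a x\<bar> (b x)"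
    using nondegenerate_growth[OF p] by blast
  define C2 where "C2 = Dc * Mr"
  \<comment> \<open>For \<open>H \<le> ?P x\<close> the penalty after a typical step is at most
    \<open>2 * ?P x / H\<close>; with \<open>8 * C2 \<le> H\<close> its product with the growth
    \<open>C2\<close> is at most \<open>?P x / 4\<close>.\<close>
  define H where "H = max 1 (8 * C2)"
  have H: "1 \<le> H" "8 * C2 \<le> H" by (auto simp: H_def)
  define k where "k = 1 + real CARD('n) * H ^ CARD('n)"
  have k: "1 \<le> k" using H by (simp add: k_def)
  \<comment> \<open>Makes the contribution \<open>k * Dc * Lam x * \<epsilon>\<close> of the
    exceptional noise equal to \<open>(1 - \<rho>) / 4 * Lam x\<close>.\<close>
  define \<epsilon> where "\<epsilon> = (1 - \<rho>) / (4 * k * Dc)"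
  have \<epsilon>: "0 < \<epsilon>" unfolding \<epsilon>_def using rho k Dc_pos by (intro divide_pos_pos mult_pos_pos) auto
  obtain T where T: "0 \<le> T" "(\<integral>\<^sup>+u. ennreal (G u * indicator {u. T < \<bar>u\<bar>} u) \<partial>\<mu>) \<le> ennreal (\<epsilon> / 2)"
    using moment_tail[OF moment_G, of "\<epsilon> / 2"] \<epsilon> by auto
  \<comment> \<open>The largest growth of the norm in one step when
    \<open>\<bar>u\<bar> \<le> T\<close> and \<open>1 \<le> norm x\<close>.\<close>
  define \<tau> where "\<tau> = 2 * (A + 1) * (1 + T)"
  have \<tau>: "1 \<le> \<tau>"
    using A_nonneg T mult_mono[of 1 "2 * (A + 1)" 1 "1 + T"] by (simp add: \<tau>_def)
  have B: "0 \<le> B" using f_bdd[of 0] f_nonneg[of 0] by simp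
  define c1 where "c1 = (1 + T) powr r * (4 * B / \<kappa>)"
  have c1: "0 \<le> c1" using B \<kappa> by (simp add: c1_def)
  \<comment> \<open>The first bound is the range of \<open>small_ball\<close>. The second keeps the
    \<open>G\<close>-weight of a small new coordinate with \<open>\<bar>u\<bar> \<le> T\<close>, at
    most \<open>c1 * s\<close>, below \<open>\<epsilon> / 2\<close>.\<close>
  define s where "s = min (\<kappa> / 2) (\<epsilon> / (2 * (c1 + 1)))"
  have s: "0 < s" "s \<le> \<kappa> / 2"
    using \<kappa> \<epsilon> c1 min.cobounded1[of "\<kappa> / 2"] by (simp_all only: s_def) simp
  have c1s: "c1 * s \<le> \<epsilon> / 2"
  proof -
    have "c1 * s \<le> (c1 + 1) * (\<epsilon> / (2 * (c1 + 1)))" using c1 s(1) by (intro mult_mono) (auto simp: s_def)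
    also have "\<dots> = \<epsilon> / 2" using c1 by (simp add: field_simps)
    finally show ?thesis .
  qed
  \<comment> \<open>Since the norm grows by at most \<open>\<tau>\<close>, a new coordinate of size
    at least \<open>s * norm x\<close> passes the threshold \<open>\<delta>\<close> relative to the
    new norm.\<close>
  define \<delta> where "\<delta> = s / \<tau>"
  have \<delta>: "0 < \<delta>" "\<delta> * \<tau> = s" using s \<tau> by (auto simp: \<delta>_def)
  \<comment> \<open>Below all thresholds \<open>\<delta> / \<tau> ^ lag i\<close>, so that unflagged
    directions lie in one compact set off the coordinate hyperplanes.\<close>
  define \<delta>0 where "\<delta>0 = \<delta> / \<tau> ^ CARD('n)"
  have \<delta>0: "0 < \<delta>0" using \<delta> \<tau> by (simp add: \<delta>0_def)
  let ?P = "penalty H \<delta> \<tau> :: (real, 'n) vec \<Rightarrow> real"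
  let ?K = "sphere (0::(real, 'n) vec) 1 \<inter> {x. \<forall>i. \<delta>0 \<le> \<bar>x $ i\<bar>}"
  have "closed {x :: (real, 'n) vec. \<delta>0 \<le> \<bar>x $ i\<bar>}" for i
    by (intro closed_Collect_le continuous_intros)
  then have "closed (\<Inter>i. {x :: (real, 'n) vec. \<delta>0 \<le> \<bar>x $ i\<bar>})" by (intro closed_INT) auto
  moreover have "(\<Inter>i. {x :: (real, 'n) vec. \<delta>0 \<le> \<bar>x $ i\<bar>}) = {x. \<forall>i. \<delta>0 \<le> \<bar>x $ i\<bar>}" by auto
  ultimately have K_compact: "compact ?K" by (intro compact_Int_closed compact_sphere) simp
  have K_subset: "?K \<subseteq> UNIV - {x. \<exists>i. x $ i = 0}"
  proof (intro subsetI DiffI UNIV_I notI)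
    fix x :: "(real, 'n) vec" assume x: "x \<in> ?K" "x \<in> {x. \<exists>i. x $ i = 0}"
    then obtain i where "x $ i = 0" by auto
    moreover have "\<delta>0 \<le> \<bar>x $ i\<bar>" using x(1) by blast
    ultimately show False using \<delta>0 by simp
  qed
  obtain \<eta> where \<eta>: "0 < \<eta>" "\<And>x. x \<in> ?K \<Longrightarrow> \<eta> \<le> star_ext bs x"
    using compact_bounded_away[OF conjunct2[OF nondegenerate[OF p]] K_compact K_subset] by blast
  obtain W where W: "1 \<le> W" "\<And>x. W \<le> norm x \<Longrightarrow> \<eta> \<le> bs (x /\<^sub>R norm x) \<Longrightarrow>
    E1 Lam x \<le> ennreal (\<rho>1 * Lam x)"
    using one_step_contraction_nondegenerate[OF \<eta>(1) \<gamma>_bounds(5)] by blast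
  define V where "V x = ?P x * Lam x" for x
  have P1: "1 \<le> ?P x" "?P x \<le> k" for x using penalty_bounds[OF H(1), of \<delta> \<tau> x] by (auto simp: k_def)
  have V_le: "V x \<le> k * Lam x" for x unfolding V_def by (intro mult_right_mono P1 Lam_nonneg)
  have V_ge: "Lam x \<le> V x" for x
    unfolding V_def using mult_right_mono[OF P1(1) Lam_nonneg, of x x] by simp
  \<comment> \<open>The exceptional noise: either very large, or producing a new coordinate that is
    small relative to the state.\<close>
  define E where "E x = {u. T < \<bar>u\<bar>} \<union> {u. \<bar>a x + b x * u\<bar> < s * (1 + norm x)}" for x
  have [measurable]: "E x \<in> sets borel" for x unfolding E_def by measurable
  have E_small: "(\<integral>\<^sup>+u. ennreal (G u * indicator (E x) u) \<partial>\<mu>) \<le> ennreal \<epsilon>" for x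
  proof -
    let ?B = "{u. \<bar>a x + b x * u\<bar> < s * (1 + norm x)}"
    have "(\<integral>\<^sup>+u. ennreal (G u * indicator (E x) u) \<partial>\<mu>)
        \<le> (\<integral>\<^sup>+u. ennreal (G u * indicator {u. T < \<bar>u\<bar>} u) + ennreal ((1 + T) powr r) * indicator ?B u \<partial>\<mu>)"
    proof (rule nn_integral_mono)
      fix u :: real
      show "ennreal (G u * indicator (E x) u)
        \<le> ennreal (G u * indicator {u. T < \<bar>u\<bar>} u) + ennreal ((1 + T) powr r) * indicator ?B u"
      proof (cases "T < \<bar>u\<bar>")
        case True
        then show ?thesis by (simp add: E_def)
      next
        case False
        then have "G u \<le> (1 + T) powr r" using collapsed.r_pos by (intro powr_mono2) auto
        then show ?thesis using False by (simp add: E_def indicator_def ennreal_leI)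
      qed
    qed
    also have "\<dots> = (\<integral>\<^sup>+u. ennreal (G u * indicator {u. T < \<bar>u\<bar>} u) \<partial>\<mu>) + ennreal ((1 + T) powr r) * emeasure \<mu> ?B"
      by (subst nn_integral_add) (auto simp: nn_integral_cmult_indicator)
    also have "\<dots> \<le> ennreal (\<epsilon> / 2) + ennreal ((1 + T) powr r) * ennreal (4 * B * (s * (1 + norm x)) / (\<kappa> * (1 + norm x)))"
    proof (intro add_mono T mult_left_mono small_ball[OF f_bdd b_pos])
      have x1: "0 < 1 + norm x" by (simp add: add_pos_nonneg)
      then show "0 < \<kappa> * (1 + norm x)" "0 \<le> s * (1 + norm x)" using \<kappa> s by auto
      show "s * (1 + norm x) \<le> \<kappa> * (1 + norm x) / 2"
        using mult_right_mono[OF s(2), of "1 + norm x"] x1 by simp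
    qed (use \<kappa> in auto)
    also have "4 * B * (s * (1 + norm x)) / (\<kappa> * (1 + norm x)) = 4 * B / \<kappa> * s"
    proof -
      have "1 + norm x \<noteq> 0" by (metis add_pos_nonneg less_irrefl norm_ge_zero zero_less_one)
      then show ?thesis using \<kappa> by simp
    qed
    also have "ennreal (\<epsilon> / 2) + ennreal ((1 + T) powr r) * ennreal (4 * B / \<kappa> * s) = ennreal (\<epsilon> / 2 + c1 * s)"
      using \<epsilon> c1 s B \<kappa> by (subst ennreal_plus) (auto simp: c1_def ennreal_mult[symmetric] mult.assoc)
    also have "\<dots> \<le> ennreal \<epsilon>" using c1s by (intro ennreal_leI) simp
    finally show ?thesis .
  qed
  \<comment> \<open>Outside \<open>E x\<close> the hypotheses of \<open>penalty_shift\<close> hold.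
    On \<open>E x\<close> the penalty is replaced by its maximum \<open>k\<close> and
    \<open>Lam\<close> by its pointwise growth bound.\<close>
  have step: "V (ar_step a b x u) \<le> (1 + (?P x - 1) / H) * Lam (ar_step a b x u) + k * Dc * Lam x * (G u * indicator (E x) u)"
    if x: "1 \<le> norm x" for x u
  proof (cases "u \<in> E x")
    case True
    have "V (ar_step a b x u) \<le> k * (Dc * Lam x * G u)"
      by (rule order_trans[OF V_le mult_left_mono[OF Lam_step_le_Lam[OF x]]]) (use k in simp)
    moreover have "0 \<le> (1 + (?P x - 1) / H) * Lam (ar_step a b x u)"
      using P1(1)[of x] H Lam_nonneg by (intro mult_nonneg_nonneg add_nonneg_nonneg divide_nonneg_nonneg) auto
    ultimately show ?thesis using True by (simp add: mult.assoc)
  next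
    case False
    then have u: "\<bar>u\<bar> \<le> T" and z: "s * (1 + norm x) \<le> \<bar>a x + b x * u\<bar>" by (auto simp: E_def)
    have growth: "norm (ar_step a b x u) \<le> \<tau> * norm x"
    proof -
      have "(A + 1) * (1 + norm x) * (1 + \<bar>u\<bar>) \<le> (A + 1) * (2 * norm x) * (1 + T)"
        using u x A_nonneg by (intro mult_mono) auto
      then show ?thesis using ar_step_growth[of x u] by (simp add: \<tau>_def mult_ac)
    qed
    have fresh: "\<delta> * norm (ar_step a b x u) \<le> \<bar>a x + b x * u\<bar>"
    proof -
      have "\<delta> * norm (ar_step a b x u) \<le> \<delta> * (\<tau> * norm x)" using \<delta> growth by (intro mult_left_mono) auto
      also have "\<dots> = s * norm x" using \<delta>(2) by (simp add: mult.assoc[symmetric])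
      also have "\<dots> \<le> s * (1 + norm x)" using s by simp
      finally show ?thesis using z by linarith
    qed
    have "?P (ar_step a b x u) \<le> 1 + (?P x - 1) / H"
      using penalty_shift[OF H(1) _ \<delta>(1) growth[unfolded ar_step_def] fresh[unfolded ar_step_def]] \<tau>
      by (simp add: ar_step_def)
    from mult_right_mono[OF this Lam_nonneg] show ?thesis using False by (simp add: V_def)
  qed
  have PL_le: "E1 Lam x \<le> ennreal (C2 * Lam x)" if x: "1 \<le> norm x" for x
  proof -
    have "E1 Lam x \<le> (\<integral>\<^sup>+u. ennreal (Dc * Lam x) * ennreal (G u) \<partial>\<mu>)"
      using Lam_step_le_Lam[OF x] Dc_pos Lam_nonneg[of x]
      by (intro nn_integral_mono) (simp add: ennreal_mult'[symmetric] ennreal_leI)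
    also have "\<dots> = ennreal (Dc * Lam x) * ennreal Mr"
      by (simp add: nn_integral_cmult Mr)
    also have "\<dots> = ennreal (C2 * Lam x)"
      using Dc_pos Lam_nonneg[of x] Mr(2) by (simp add: ennreal_mult'[symmetric] C2_def mult_ac)
    finally show ?thesis .
  qed
  have C2: "0 \<le> C2" using Dc_pos Mr by (simp add: C2_def)
  define K where "K = k * (C' * (A + 1) powr r) * (1 + W) powr r * Mr"
  have K: "0 \<le> K" using k C'_pos Mr by (simp add: K_def)
  have drift: "E1 V x \<le> ennreal (\<gamma> * V x + K)" for x
  proof (cases "norm x \<le> W")
    case True
    have "E1 V x \<le> ennreal K"
      unfolding K_def by (rule bounded_region[OF True V_le]) (use k in simp)
    also have "\<dots> \<le> ennreal (\<gamma> * V x + K)"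
      using \<gamma>_bounds V_ge[of x] Lam_nonneg[of x] by (intro ennreal_leI) simp
    finally show ?thesis .
  next
    case False
    then have x: "1 \<le> norm x" "W \<le> norm x" using W by auto
    define q where "q = 1 + (?P x - 1) / H"
    have q: "0 \<le> q" using P1(1)[of x] H by (simp add: q_def)
    \<comment> \<open>The parameter \<open>m\<close> is whatever one-step growth of
      \<open>Lam\<close> is known at \<open>x\<close>: \<open>C2\<close> in flagged states,
      \<open>\<rho>1\<close> in the others.\<close>
    have drift_from: "E1 V x \<le> ennreal (q * (m * Lam x) + (1 - \<rho>) / 4 * Lam x)"
      if m: "0 \<le> m" "E1 Lam x \<le> ennreal (m * Lam x)" for m
    proof -
      have D0: "0 \<le> k * Dc * Lam x" using k Dc_pos Lam_nonneg by simp
      have "E1 V x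
        \<le> (\<integral>\<^sup>+u. ennreal q * ennreal (Lam (ar_step a b x u)) + ennreal (k * Dc * Lam x) * ennreal (G u * indicator (E x) u) \<partial>\<mu>)"
      proof (rule nn_integral_mono)
        fix u
        have "0 \<le> q * Lam (ar_step a b x u)" "0 \<le> k * Dc * Lam x * (G u * indicator (E x) u)"
          using q D0 Lam_nonneg by (simp_all add: mult_nonneg_nonneg)
        then show "ennreal (V (ar_step a b x u)) \<le> ennreal q * ennreal (Lam (ar_step a b x u)) + ennreal (k * Dc * Lam x) * ennreal (G u * indicator (E x) u)"
          using step[OF x(1), of u] q D0
          by (simp only: ennreal_mult'[symmetric] ennreal_plus[symmetric] q_def[symmetric] ennreal_leI)
      qed
      also have "\<dots> = ennreal q * E1 Lam x
          + ennreal (k * Dc * Lam x) * (\<integral>\<^sup>+u. ennreal (G u * indicator (E x) u) \<partial>\<mu>)"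
        by (subst nn_integral_add) (auto simp: nn_integral_cmult)
      also have "\<dots> \<le> ennreal q * ennreal (m * Lam x) + ennreal (k * Dc * Lam x) * ennreal \<epsilon>"
        by (intro add_mono mult_left_mono m E_small) auto
      also have "\<dots> = ennreal (q * (m * Lam x) + k * Dc * Lam x * \<epsilon>)"
        using q D0 m(1) \<epsilon> Lam_nonneg[of x] by (simp add: ennreal_mult'[symmetric] ennreal_plus[symmetric] del: ennreal_plus)
      also have "k * Dc * Lam x * \<epsilon> = (1 - \<rho>) / 4 * Lam x"
        using k Dc_pos by (simp add: \<epsilon>_def)
      finally show ?thesis .
    qed
    have gV: "\<gamma> * (?P x * Lam x) \<le> \<gamma> * V x + K" using K by (simp add: V_def)
    show ?thesis
    proof (cases "H \<le> ?P x")
      \<comment> \<open>Both contributions are at most \<open>1 / 4 * (?P x * Lam x)\<close>, and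
        their sum stays below \<open>\<gamma> * V x\<close> because
        \<open>3 / 4 \<le> \<gamma>\<close>.\<close>
      case True
      have "q = (H + ?P x - 1) / H" using H by (simp add: q_def add_divide_distrib diff_divide_distrib)
      also have "\<dots> \<le> 2 * ?P x / H" using True H by (intro divide_right_mono) auto
      finally have "q \<le> 2 * ?P x / H" .
      then have "q * (C2 * Lam x) \<le> 2 * ?P x / H * (C2 * Lam x)"
        using C2 Lam_nonneg by (intro mult_right_mono) auto
      also have "\<dots> = (C2 / H) * (2 * ?P x * Lam x)" by simp
      also have "\<dots> \<le> (1 / 8) * (2 * ?P x * Lam x)"
        using H P1(1)[of x] Lam_nonneg[of x] by (intro mult_right_mono) (auto simp: field_simps)
      finally have 1: "q * (C2 * Lam x) \<le> 1 / 4 * (?P x * Lam x)" by (simp add: mult_ac)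
      have "(1 - \<rho>) / 4 * Lam x \<le> 1 / 4 * (?P x * Lam x)"
        using rho V_ge[of x, unfolded V_def] Lam_nonneg[of x] by (intro mult_mono) auto
      with 1 have "q * (C2 * Lam x) + (1 - \<rho>) / 4 * Lam x \<le> 1 / 2 * (?P x * Lam x)" by simp
      also have "\<dots> \<le> \<gamma> * (?P x * Lam x)"
        using \<gamma>_bounds P1(1)[of x] Lam_nonneg[of x] by (intro mult_right_mono) auto
      finally show ?thesis
        using drift_from[OF C2 PL_le[OF x(1)]] gV by (meson ennreal_leI order_trans)
    next
      \<comment> \<open>A penalty below \<open>H\<close> means that no coordinate is flagged, so the
        contraction by \<open>\<rho>1\<close> is available. The penalty does not grow either, as
        \<open>q \<le> ?P x\<close>, and the factors add up to \<open>\<gamma>\<close>.\<close>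
      case False
      then have good: "\<delta> / \<tau> ^ lag i * norm x \<le> \<bar>x $ i\<bar>" for i
        using penalty_bounds(3)[OF H(1), of \<delta> \<tau> x] by blast
      have x0: "norm x \<noteq> 0" "0 < norm x" using x by auto
      have t: "x /\<^sub>R norm x \<in> sphere 0 1" using x0 by simp
      have "\<delta>0 \<le> \<bar>(x /\<^sub>R norm x) $ i\<bar>" for i
      proof -
        have "\<delta>0 \<le> \<delta> / \<tau> ^ lag i"
          unfolding \<delta>0_def using \<delta> \<tau> lag_less_card[of i] by (intro divide_left_mono power_increasing mult_pos_pos) auto
        also have "\<dots> \<le> \<bar>x $ i\<bar> / norm x" using good[of i] x0 by (simp add: pos_le_divide_eq)
        also have "\<dots> = \<bar>(x /\<^sub>R norm x) $ i\<bar>" using x0 by (simp add: abs_mult divide_inverse mult.commute)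
        finally show ?thesis .
      qed
      then have "\<eta> \<le> bs (x /\<^sub>R norm x)"
        using \<eta>(2)[of "x /\<^sub>R norm x"] t collapsed.star_ext_sphere[OF t, of bs] by auto
      from drift_from[OF _ W(2)[OF x(2) this]]
      have d: "E1 V x \<le> ennreal (q * (\<rho>1 * Lam x) + (1 - \<rho>) / 4 * Lam x)"
        using rho by (simp add: \<rho>1_def)
      have "(?P x - 1) / H \<le> (?P x - 1) / 1" using P1(1)[of x] H by (intro divide_left_mono) auto
      then have "q \<le> ?P x" by (simp add: q_def)
      then have "q * (\<rho>1 * Lam x) + (1 - \<rho>) / 4 * Lam x \<le> ?P x * (\<rho>1 * Lam x) + (1 - \<rho>) / 4 * (?P x * Lam x)"
        using rho V_ge[of x, unfolded V_def] Lam_nonneg[of x]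
        by (intro add_mono mult_right_mono mult_left_mono) (auto simp: \<rho>1_def)
      also have "\<dots> = \<gamma> * (?P x * Lam x)" by (simp add: \<rho>1_def \<gamma>_def field_simps)
      finally show ?thesis using d gV by (meson ennreal_leI order_trans)
    qed
  qed
  have "V \<in> borel_measurable borel" unfolding V_def by measurable
  then show ?thesis using k K V_ge V_le drift by (rule that)
qed

lemma drift_function:
  obtains V k K where "V \<in> borel_measurable borel" "1 \<le> k" "0 \<le> K"
    "\<And>x. Lam x \<le> V x" "\<And>x. V x \<le> k * Lam x"
    "\<And>x. E1 V x \<le> ennreal (\<gamma> * V x + K)"
proof (cases "CARD('n) > 1")
  case True
  then show ?thesis using drift_higher_dimension that by blast
next
  case False
  then have p: "CARD('n) = 1" using zero_less_card_finite[where 'a='n] by linarith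
  obtain W where W: "1 \<le> W" "\<And>x. W \<le> norm x \<Longrightarrow>
    E1 Lam x \<le> ennreal (\<rho>1 * Lam x)"
    using drift_dimension_one[OF p] by blast
  define K where "K = 1 * (C' * (A + 1) powr r) * (1 + W) powr r * Mr"
  have K: "0 \<le> K" using C'_pos Mr by (simp add: K_def)
  show ?thesis
  proof (rule that[of Lam 1 K])
    fix x :: "(real, 'n) vec"
    have L: "0 \<le> Lam x" by (rule Lam_nonneg)
    show "E1 Lam x \<le> ennreal (\<gamma> * Lam x + K)"
    proof (cases "norm x \<le> W")
      case True
      have "E1 Lam x \<le> ennreal K"
        unfolding K_def by (rule bounded_region[OF True]) auto
      also have "\<dots> \<le> ennreal (\<gamma> * Lam x + K)" using \<gamma>_bounds L by (intro ennreal_leI) simp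
      finally show ?thesis .
    next
      case False
      then have "E1 Lam x \<le> ennreal (\<rho>1 * Lam x)" by (intro W) simp
      also have "\<dots> \<le> ennreal (\<gamma> * Lam x + K)"
        using mult_right_mono[OF \<gamma>_bounds(4) L] K by (intro ennreal_leI) simp
      finally show ?thesis .
    qed
  qed (use K in auto)
qed

lemma ergodicity:
  obtains V :: "(real, 'n) vec \<Rightarrow> real" and k L M \<Gamma> where "0 < k"
    "\<And>x. k * norm x powr r \<le> V x \<and> V x \<le> L + M * norm x powr r"
    "V_uniformly_ergodic_with (ar_step a b) \<mu> V \<Gamma>" "(\<integral>\<^sup>+x. ennreal (norm x powr r) \<partial>\<Gamma>) < \<infinity>"
proof -
  obtain V k K where [measurable]: "V \<in> borel_measurable borel" and k: "1 \<le> k" and K: "0 \<le> K"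
    and V_ge: "\<And>x. Lam x \<le> V x" and V_le: "\<And>x. V x \<le> k * Lam x"
    and drift: "\<And>x. E1 V x \<le> ennreal (\<gamma> * V x + K)"
    using drift_function by blast
  have V0: "0 \<le> V x" for x using V_ge Lam_nonneg by (rule order_trans[rotated])
  \<comment> \<open>\<open>V\<close> vanishes at the origin, while the Harris argument needs a
    weight of at least 1.\<close>
  define V' where "V' x = V x + 1" for x
  have V'_ge: "c * norm x powr r \<le> V' x" for x
    using Lam_bounds(1)[of x] V_ge[of x] by (simp add: V'_def)
  have V'_le: "V' x \<le> 1 + k * C' * norm x powr r" for x
  proof -
    have "V x \<le> k * (C' * norm x powr r)"
      by (rule order_trans[OF V_le mult_left_mono[OF Lam_bounds(2)]]) (use k in simp)
    then show ?thesis by (simp add: V'_def mult.assoc)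
  qed
  \<comment> \<open>Solves \<open>(1 - \<gamma>) * K' = K + 1\<close>, the normalised form of the
    drift constant after adding 1 to \<open>V\<close>.\<close>
  define K' where "K' = (K + 1) / (1 - \<gamma>)"
  have drift': "E1 V' x \<le> ennreal (\<gamma> * V' x + (1 - \<gamma>) * K')" for x
  proof -
    have "E1 V' x = (\<integral>\<^sup>+u. ennreal (V (ar_step a b x u)) + 1 \<partial>\<mu>)"
      using V0 by (simp add: V'_def ennreal_plus)
    also have "\<dots> = E1 V x + 1"
      using emeasure_space_1 by (subst nn_integral_add) auto
    also have "\<dots> \<le> ennreal (\<gamma> * V x + K) + ennreal 1" by (intro add_mono drift) simp
    also have "\<dots> = ennreal (\<gamma> * V x + K + 1)"
      using V0[of x] K \<gamma>_bounds by (subst ennreal_plus[symmetric]) auto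
    also have "\<dots> \<le> ennreal (\<gamma> * V' x + (1 - \<gamma>) * K')"
    proof (rule ennreal_leI)
      have "(1 - \<gamma>) * K' = K + 1" using \<gamma>_bounds by (simp add: K'_def)
      then show "\<gamma> * V x + K + 1 \<le> \<gamma> * V' x + (1 - \<gamma>) * K'"
        using \<gamma>_bounds by (simp add: V'_def distrib_left)
    qed
    finally show ?thesis .
  qed
  interpret D: drift_chain \<mu> "ar_step a b" V' \<gamma> K'
  proof
    show "V' \<in> borel_measurable borel" unfolding V'_def by measurable
  qed (use V0 \<gamma>_bounds K drift' in \<open>auto simp: V'_def K'_def\<close>)
  interpret harris_chain \<mu> "ar_step a b" V' \<gamma> K' "CARD('n)"
  proof
    fix R :: real
    \<comment> \<open>Sublevel sets of \<open>V'\<close> are bounded because \<open>V'\<close>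
      dominates \<open>c * norm x powr r\<close>; this radius contains the set
      \<open>V' x \<le> R\<close>.\<close>
    define R' where "R' = (\<bar>R\<bar> / c) powr (1 / r)"
    have R': "norm x \<le> R'" if "V' x \<le> R" for x
    proof -
      have "norm x powr r \<le> \<bar>R\<bar> / c" using V'_ge[of x] that c_pos by (simp add: pos_le_divide_eq mult.commute)
      then have "(norm x powr r) powr (1 / r) \<le> R'"
        unfolding R'_def using collapsed.r_pos by (intro powr_mono2) auto
      then show ?thesis using collapsed.r_pos by (simp add: powr_powr)
    qed
    show "\<exists>\<epsilon>>0. \<exists>\<nu>. prob_space \<nu> \<and> sets \<nu> = sets borel \<and> (\<forall>x. V' x \<le> R \<longrightarrow> (\<forall>h\<in>borel_measurable borel.
         ennreal \<epsilon> * (\<integral>\<^sup>+y. h y \<partial>\<nu>) \<le> (\<integral>\<^sup>+\<omega>. h (chain (ar_step a b) x \<omega> CARD('n)) \<partial>stream_space \<mu>)))"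
      using minorization_bounded_sets[OF f_away b_pos b_bdd b_away a_growth, of R'] R'
      unfolding R'_def by (meson powr_ge_zero)
  qed simp
  obtain \<Gamma> where \<Gamma>: "V_uniformly_ergodic_with (ar_step a b) \<mu> V' \<Gamma>" "(\<integral>\<^sup>+y. ennreal (V' y) \<partial>\<Gamma>) < \<infinity>"
    by (rule V_uniformly_ergodic)
  have [measurable_cong]: "sets \<Gamma> = sets borel"
    using \<Gamma>(1) by (simp add: V_uniformly_ergodic_with_def stationary_distr_def)
  have "ennreal c * (\<integral>\<^sup>+x. ennreal (norm x powr r) \<partial>\<Gamma>) = (\<integral>\<^sup>+x. ennreal (c * norm x powr r) \<partial>\<Gamma>)"
    using c_pos by (subst nn_integral_cmult[symmetric]) (auto simp: ennreal_mult)
  also have "\<dots> \<le> (\<integral>\<^sup>+x. ennreal (V' x) \<partial>\<Gamma>)"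
    by (intro nn_integral_mono ennreal_leI V'_ge)
  finally have "ennreal c * (\<integral>\<^sup>+x. ennreal (norm x powr r) \<partial>\<Gamma>) < \<infinity>" using \<Gamma>(2) by (simp add: le_less_trans)
  then have "(\<integral>\<^sup>+x. ennreal (norm x powr r) \<partial>\<Gamma>) < \<infinity>"
    using c_pos by (auto simp: ennreal_mult_less_top)
  then show ?thesis using that[of c V' 1 "k * C'" \<Gamma>] c_pos V'_ge V'_le \<Gamma>(1) by blast
qed

end

text \<open>The ergodic conclusion is attached to \<open>cond_i\<close> only; the equivalence
  transfers it to \<open>cond_ii\<close>. One measure \<open>\<Gamma>\<close> is both the stationary
  law in the ergodicity statement and the law with finite \<open>r\<close>-th moment.\<close>

theorem theorem3p5:
  fixes a b :: "(real, 'n::{finite,wellorder}) vec \<Rightarrow> real"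
    and f :: "real \<Rightarrow> real"
    and as bs :: "(real, 'n) vec \<Rightarrow> real"
    and r r0 :: real
  defines "\<mu> \<equiv> density lborel (\<lambda>u. ennreal (f u))"
  defines "\<Theta> \<equiv> sphere (0::(real, 'n) vec) 1"
  defines "S \<equiv> stream_space \<mu>"
  \<comment> \<open>the model\<close>
  assumes meas_a: "a \<in> borel_measurable borel" and meas_b: "b \<in> borel_measurable borel"
  assumes meas_f: "f \<in> borel_measurable borel" and f_nonneg: "\<forall>u. 0 \<le> f u"
    and f_density: "(\<integral>\<^sup>+u. ennreal (f u) \<partial>lborel) = 1"
  \<comment> \<open>A.1\<close>
  assumes A1_f: "loc_bounded_away_from_0_on UNIV f"
    and A1_b_pos: "\<forall>x. 0 < b x"
    and A1_b_bdd: "loc_bounded_on UNIV b"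
    and A1_b_away: "loc_bounded_away_from_0_on UNIV b"
  \<comment> \<open>A.2\<close>
  assumes A2_f: "\<exists>C. \<forall>u. (1 + \<bar>u\<bar>) * f u \<le> C"
    and A2_r0: "0 < r0" and A2_mom: "(\<integral>\<^sup>+u. ennreal (\<bar>u\<bar> powr r0) \<partial>\<mu>) < \<infinity>"
  \<comment> \<open>A.3\<close>
  assumes A3: "\<exists>C. \<forall>x. \<bar>a x\<bar> \<le> C * (1 + norm x) \<and> \<bar>b x\<bar> \<le> C * (1 + norm x)"
  \<comment> \<open>A.4\<close>
  assumes A4_bdd: "\<exists>C. \<forall>\<theta>\<in>\<Theta>. \<bar>as \<theta>\<bar> \<le> C \<and> \<bar>bs \<theta>\<bar> \<le> C"
    and A4_lim: "\<forall>\<epsilon>>0. \<exists>W. \<forall>w\<ge>W. \<forall>\<theta>\<in>\<Theta>.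
                   \<bar>a (w *\<^sub>R \<theta>) / w - as \<theta>\<bar> \<le> \<epsilon> \<and> \<bar>b (w *\<^sub>R \<theta>) / w - bs \<theta>\<bar> \<le> \<epsilon>"
  \<comment> \<open>A.5\<close>
  assumes A5: "CARD('n) > 1 \<Longrightarrow>
      loc_bounded_away_from_0_on (UNIV - {0}) (\<lambda>x. max \<bar>star_ext as x\<bar> (star_ext bs x)) \<and>
      loc_bounded_away_from_0_on (UNIV - {x. \<exists>i. x $ i = 0}) (star_ext bs)"
  \<comment> \<open>A.6\<close>
  assumes A6: "CARD('n) > 1 \<Longrightarrow>
      \<exists>H :: ((real, 'n) vec) set. finite H \<and> 0 \<notin> H \<and>
        (\<forall>x. (\<forall>c\<in>H. c \<bullet> x \<noteq> 0) \<longrightarrow> isCont (star_ext as) x \<and> isCont (star_ext bs) x)"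
  \<comment> \<open>moment assumption\<close>
  assumes r_pos: "0 < r" and mom_r: "(\<integral>\<^sup>+u. ennreal (\<bar>u\<bar> powr r) \<partial>\<mu>) < \<infinity>"
  defines "cond_i \<equiv> (\<exists>lam::(real, 'n) vec \<Rightarrow> real. lam \<in> borel_measurable borel \<and>
              (\<exists>c>0. \<exists>C. \<forall>\<theta>\<in>\<Theta>. c \<le> lam \<theta> \<and> lam \<theta> \<le> C) \<and>
              (SUP \<theta>\<in>\<Theta>. \<integral>\<^sup>+u. ennreal (lam (collapsed_step as bs \<theta> u) / lam \<theta>
                                       * wfun as bs \<theta> u powr r) \<partial>\<mu>) < 1)"
  defines "cond_ii \<equiv> limsup (\<lambda>n. enn_root n (SUP \<theta>\<in>\<Theta>.
              \<integral>\<^sup>+\<omega>. (\<Prod>t<n. ennreal (wfun as bs (chain (collapsed_step as bs) \<theta> \<omega> t) (\<omega> !! t) powr r)) \<partial>S))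
            < 1"
  shows "(cond_i \<longleftrightarrow> cond_ii) \<and>
         (cond_i \<longrightarrow>
            (\<exists>V K L M \<Gamma>. 0 < K \<and>
               (\<forall>x. K * norm x powr r \<le> V x \<and> V x \<le> L + M * norm x powr r) \<and>
               V_uniformly_ergodic_with (ar_step a b) \<mu> V \<Gamma> \<and>
               (\<integral>\<^sup>+x. ennreal (norm x powr r) \<partial>\<Gamma>) < \<infinity>))"
proof -
  interpret N: noise_density f
    using meas_f f_nonneg f_density by unfold_locales auto
  have \<mu>: "N.\<mu> = \<mu>" by (simp add: N.\<mu>_def \<mu>_def)
  obtain C where C: "\<forall>\<theta>\<in>\<Theta>. \<bar>as \<theta>\<bar> \<le> C \<and> \<bar>bs \<theta>\<bar> \<le> C" using A4_bdd by blast
  obtain A where A: "\<forall>x. \<bar>a x\<bar> \<le> A * (1 + norm x) \<and> \<bar>b x\<bar> \<le> A * (1 + norm x)" using A3 by blast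
  obtain B where B: "\<forall>u. (1 + \<bar>u\<bar>) * f u \<le> B" using A2_f by blast
  have lim: "\<exists>W. \<forall>w\<ge>W. \<forall>\<theta>\<in>sphere 0 1. \<bar>a (w *\<^sub>R \<theta>) / w - as \<theta>\<bar> \<le> \<epsilon> \<and> \<bar>b (w *\<^sub>R \<theta>) / w - bs \<theta>\<bar> \<le> \<epsilon>"
    if "0 < \<epsilon>" for \<epsilon>
    using A4_lim that unfolding \<Theta>_def by blast
  have as_meas: "star_ext as \<in> borel_measurable borel"
    by (rule star_ext_measurable[OF meas_a]) (use lim in meson)
  have bs_meas: "star_ext bs \<in> borel_measurable borel"
    by (rule star_ext_measurable[OF meas_b]) (use lim in meson)
  interpret ar_model f a b as bs r C A B
  proof unfold_locales
    show "\<bar>as \<theta>\<bar> \<le> C \<and> \<bar>bs \<theta>\<bar> \<le> C" if "\<theta> \<in> sphere 0 1" for \<theta>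
      using C that unfolding \<Theta>_def by blast
    show "(\<integral>\<^sup>+u. ennreal (\<bar>u\<bar> powr r) \<partial>N.\<mu>) < \<infinity>" using mom_r unfolding \<mu> .
  qed (use meas_a meas_b as_meas bs_meas r_pos A1_f A1_b_pos A1_b_bdd A1_b_away A B lim A5 in blast)+
  have i: "cond_i \<longleftrightarrow> collapsed.cond_one"
    unfolding cond_i_def collapsed.cond_one_def \<Theta>_def \<mu> ..
  have ii: "cond_ii \<longleftrightarrow> collapsed.cond_two"
    unfolding cond_ii_def collapsed.cond_two_def collapsed.wprod_def collapsed.wr_def \<Theta>_def S_def \<mu> ..
  have "\<exists>V K L M \<Gamma>. 0 < K \<and>
      (\<forall>x. K * norm x powr r \<le> V x \<and> V x \<le> L + M * norm x powr r) \<and>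
      V_uniformly_ergodic_with (ar_step a b) \<mu> V \<Gamma> \<and> (\<integral>\<^sup>+x. ennreal (norm x powr r) \<partial>\<Gamma>) < \<infinity>"
    if cond_i
  proof -
    obtain lam c C' \<rho> where lam: "lam \<in> borel_measurable borel" "0 < c"
      "\<And>\<theta>. \<theta> \<in> sphere 0 1 \<Longrightarrow> c \<le> lam \<theta> \<and> lam \<theta> \<le> C'" "0 \<le> \<rho>" "\<rho> < 1"
      "\<And>\<theta>. \<theta> \<in> sphere 0 1 \<Longrightarrow>
         (\<integral>\<^sup>+u. collapsed.wr \<theta> u * ennreal (lam (collapsed_step as bs \<theta> u)) \<partial>N.\<mu>) \<le> ennreal (\<rho> * lam \<theta>)"
      using collapsed.cond_one_weight[OF \<open>cond_i\<close>[unfolded i]] by blast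
    interpret weighted_model f a b as bs r C A B lam c C' \<rho>
      by unfold_locales (use lam in blast)+
    obtain V k L M \<Gamma> where "0 < k" "\<And>x. k * norm x powr r \<le> V x \<and> V x \<le> L + M * norm x powr r"
      "V_uniformly_ergodic_with (ar_step a b) N.\<mu> V \<Gamma>" "(\<integral>\<^sup>+x. ennreal (norm x powr r) \<partial>\<Gamma>) < \<infinity>"
      by (rule ergodicity) blast
    then show ?thesis unfolding \<mu> by blast
  qed
  then show ?thesis
    using collapsed.cond_one_imp_cond_two collapsed.cond_two_imp_cond_one unfolding i ii by blast
qed

end
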